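(* Let $\Gamma$ be an oriented Jordan smooth curve, $\alpha$ an orientation preserving diffeomorphism of $\Gamma$ onto itself with a nonempty set $\Lambda$ of fixed points, $X(\Gamma)$ a reflexive rearrangement-invariant space of fundamental type with nontrivial Boyd indices, and $a,b\in C(\Gamma)$. Then $A=aI-bW$ is right (respectively, left) invertible in $X(\Gamma)$ if and only if the following three conditions simultaneously hold: (i) $A$ is right (respectively, left) invertible in $X(\gamma)$ for every connected component $\gamma$ of $\Phi\setminus\Lambda$; (ii) $a(t)\neq b(t)$ for every $t\in\Gamma\setminus\Phi$; (iii) if the set $Y$ is infinite, then $\eta_0(\tau)\eta_1(\tau)>0$ for every $\tau\in Y'$.
   Context: R.-i. space with Boyd indices $\alpha_X,\beta_X$ and Zippin indices $p_X,q_X$ (standard definitions via dilation operators and the fundamental function); nontrivial: $0<\alpha_X\le\beta_X<1$; fundamental type: $\alpha_X=p_X$, $\beta_X=q_X$. $Wf=f\circ\alpha$. For $\Omega\subset\Gamma$ of positive measure, $X(\Omega)$ is the subspace of functions of $X(\Gamma)$ supported in $\Omega$. $\Phi=\overline{\{t\in\Gamma:\alpha(t)\ne t\}}$, $Y=\Lambda\cap\Phi$ (the boundary of $\Lambda$), $Y'$ the set of limit points of $Y$. $\eta_0(t)=|a(t)|-|b(t)|\min\{|\alpha'(t)|^{-\alpha_X},|\alpha'(t)|^{-\beta_X}\}$, $\eta_1(t)=|a(t)|-|b(t)|\max\{|\alpha'(t)|^{-\alpha_X},|\alpha'(t)|^{-\beta_X}\}$. *)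

theory Defs
  imports "HOL-Analysis.Analysis"
begin

text \<open>An oriented Jordan smooth curve is given by a parametrisation g on [0,1]
  (simple path: either an arc or a closed Jordan curve), continuously differentiable
  with non-vanishing derivative; for closed curves the derivative matches at the junction.
  The orientation is the one induced by g.\<close>

definition smooth_jordan_curve :: "(real \<Rightarrow> complex) \<Rightarrow> bool" where
  "smooth_jordan_curve g \<longleftrightarrow>
     simple_path g \<and> g C1_differentiable_on {0..1} \<and>
     (\<forall>s\<in>{0..1}. vector_derivative g (at s) \<noteq> 0) \<and>
     (pathfinish g = pathstart g \<longrightarrow> vector_derivative g (at 0) = vector_derivative g (at 1))"

definition arc_measure :: "(real \<Rightarrow> complex) \<Rightarrow> complex measure" where
  "arc_measure g = distr (density (lebesgue_on {0..1})
       (\<lambda>s. ennreal (norm (vector_derivative g (at s))))) borel g"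

definition tangent :: "(real \<Rightarrow> complex) \<Rightarrow> complex \<Rightarrow> complex" where
  "tangent g t = vector_derivative g (at (SOME s. s \<in> {0..1} \<and> g s = t))"

definition curve_deriv :: "complex set \<Rightarrow> (complex \<Rightarrow> complex) \<Rightarrow> complex \<Rightarrow> complex" where
  "curve_deriv G f t = (THE D. (f has_field_derivative D) (at t within G))"

definition curve_C1 :: "complex set \<Rightarrow> (complex \<Rightarrow> complex) \<Rightarrow> bool" where
  "curve_C1 G f \<longleftrightarrow> (\<forall>t\<in>G. (f has_field_derivative curve_deriv G f t) (at t within G))
       \<and> continuous_on G (curve_deriv G f)"

definition curve_diffeo :: "complex set \<Rightarrow> (complex \<Rightarrow> complex) \<Rightarrow> bool" where
  "curve_diffeo G \<alpha> \<longleftrightarrow> bij_betw \<alpha> G G \<and> curve_C1 G \<alpha> \<and> curve_C1 G (inv_into G \<alpha>)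
       \<and> (\<forall>t\<in>G. curve_deriv G \<alpha> t \<noteq> 0)"

definition orientation_preserving :: "(real \<Rightarrow> complex) \<Rightarrow> (complex \<Rightarrow> complex) \<Rightarrow> bool" where
  "orientation_preserving g \<alpha> \<longleftrightarrow>
     (\<forall>t\<in>path_image g.
        Im (curve_deriv (path_image g) \<alpha> t * tangent g t / tangent g (\<alpha> t)) = 0 \<and>
        Re (curve_deriv (path_image g) \<alpha> t * tangent g t / tangent g (\<alpha> t)) > 0)"

definition shift_op :: "complex set \<Rightarrow> (complex \<Rightarrow> complex) \<Rightarrow> (complex \<Rightarrow> complex)
     \<Rightarrow> (complex \<Rightarrow> complex) \<Rightarrow> (complex \<Rightarrow> complex) \<Rightarrow> (complex \<Rightarrow> complex)" where
  "shift_op G a b \<alpha> f = (\<lambda>x. if x \<in> G then a x * f x - b x * f (\<alpha> x) else 0)"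

section \<open>Banach function spaces (Bennett--Sharpley)\<close>

definition banach_function_norm :: "'a measure \<Rightarrow> (('a \<Rightarrow> ennreal) \<Rightarrow> ennreal) \<Rightarrow> bool" where
  "banach_function_norm M \<rho> \<longleftrightarrow>
     (\<forall>f\<in>borel_measurable M. \<rho> f = 0 \<longleftrightarrow> (AE x in M. f x = 0)) \<and>
     (\<forall>f\<in>borel_measurable M. \<forall>c::real. c \<ge> 0 \<longrightarrow> \<rho> (\<lambda>x. ennreal c * f x) = ennreal c * \<rho> f) \<and>
     (\<forall>f\<in>borel_measurable M. \<forall>h\<in>borel_measurable M. \<rho> (\<lambda>x. f x + h x) \<le> \<rho> f + \<rho> h) \<and>
     (\<forall>f\<in>borel_measurable M. \<forall>h\<in>borel_measurable M. (AE x in M. h x \<le> f x) \<longrightarrow> \<rho> h \<le> \<rho> f) \<and>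
     (\<forall>F f. (\<forall>n. F n \<in> borel_measurable M) \<longrightarrow> f \<in> borel_measurable M \<longrightarrow>
        (AE x in M. incseq (\<lambda>n. F n x) \<and> (\<lambda>n. F n x) \<longlonglongrightarrow> f x) \<longrightarrow>
        \<rho> f = (SUP n. \<rho> (F n))) \<and>
     (\<forall>E\<in>sets M. emeasure M E < \<infinity> \<longrightarrow> \<rho> (indicator E) < \<infinity>) \<and>
     (\<forall>E\<in>sets M. emeasure M E < \<infinity> \<longrightarrow>
        (\<exists>C::real. \<forall>f\<in>borel_measurable M. (\<integral>\<^sup>+x\<in>E. f x \<partial>M) \<le> ennreal C * \<rho> f))"

definition distrib_fun :: "'a measure \<Rightarrow> ('a \<Rightarrow> ennreal) \<Rightarrow> ennreal \<Rightarrow> ennreal" where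
  "distrib_fun M f t = emeasure M {x\<in>space M. t < f x}"

definition rearrangement_invariant :: "'a measure \<Rightarrow> (('a \<Rightarrow> ennreal) \<Rightarrow> ennreal) \<Rightarrow> bool" where
  "rearrangement_invariant M \<rho> \<longleftrightarrow>
     (\<forall>f\<in>borel_measurable M. \<forall>h\<in>borel_measurable M.
        distrib_fun M f = distrib_fun M h \<longrightarrow> \<rho> f = \<rho> h)"

definition ri_space :: "'a measure \<Rightarrow> (('a \<Rightarrow> ennreal) \<Rightarrow> ennreal) \<Rightarrow> bool" where
  "ri_space M \<rho> \<longleftrightarrow> banach_function_norm M \<rho> \<and> rearrangement_invariant M \<rho>"

text \<open>The space X and its norm (elements are functions, identified a.e.).\<close>
definition X_space :: "'a measure \<Rightarrow> (('a \<Rightarrow> ennreal) \<Rightarrow> ennreal) \<Rightarrow> ('a \<Rightarrow> complex) set" where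
  "X_space M \<rho> = {f. f \<in> borel_measurable M \<and> \<rho> (\<lambda>x. ennreal (cmod (f x))) < \<infinity>}"

definition X_norm :: "(('a \<Rightarrow> ennreal) \<Rightarrow> ennreal) \<Rightarrow> ('a \<Rightarrow> complex) \<Rightarrow> real" where
  "X_norm \<rho> f = enn2real (\<rho> (\<lambda>x. ennreal (cmod (f x))))"

definition X_sub :: "'a measure \<Rightarrow> (('a \<Rightarrow> ennreal) \<Rightarrow> ennreal) \<Rightarrow> 'a set \<Rightarrow> ('a \<Rightarrow> complex) set" where
  "X_sub M \<rho> \<Omega> = {f \<in> X_space M \<rho>. AE x in M. x \<notin> \<Omega> \<longrightarrow> f x = 0}"

definition dual_X :: "'a measure \<Rightarrow> (('a \<Rightarrow> ennreal) \<Rightarrow> ennreal) \<Rightarrow> (('a \<Rightarrow> complex) \<Rightarrow> complex) set" where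
  "dual_X M \<rho> = {\<phi>. (\<forall>f\<in>X_space M \<rho>. \<forall>h\<in>X_space M \<rho>. \<forall>c::complex.
                        \<phi> (\<lambda>x. f x + c * h x) = \<phi> f + c * \<phi> h) \<and>
                     (\<exists>C. \<forall>f\<in>X_space M \<rho>. cmod (\<phi> f) \<le> C * X_norm \<rho> f)}"

definition dual_norm :: "'a measure \<Rightarrow> (('a \<Rightarrow> ennreal) \<Rightarrow> ennreal) \<Rightarrow> (('a \<Rightarrow> complex) \<Rightarrow> complex) \<Rightarrow> real" where
  "dual_norm M \<rho> \<phi> = Sup {cmod (\<phi> f) | f. f \<in> X_space M \<rho> \<and> X_norm \<rho> f \<le> 1}"

definition bidual_X :: "'a measure \<Rightarrow> (('a \<Rightarrow> ennreal) \<Rightarrow> ennreal)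
     \<Rightarrow> ((('a \<Rightarrow> complex) \<Rightarrow> complex) \<Rightarrow> complex) set" where
  "bidual_X M \<rho> = {\<Phi>. (\<forall>\<phi>\<in>dual_X M \<rho>. \<forall>\<psi>\<in>dual_X M \<rho>. \<forall>c::complex.
                        \<Phi> (\<lambda>f. \<phi> f + c * \<psi> f) = \<Phi> \<phi> + c * \<Phi> \<psi>) \<and>
                      (\<exists>C. \<forall>\<phi>\<in>dual_X M \<rho>. cmod (\<Phi> \<phi>) \<le> C * dual_norm M \<rho> \<phi>)}"

definition reflexive_X :: "'a measure \<Rightarrow> (('a \<Rightarrow> ennreal) \<Rightarrow> ennreal) \<Rightarrow> bool" where
  "reflexive_X M \<rho> \<longleftrightarrow>
     (\<forall>\<Phi>\<in>bidual_X M \<rho>. \<exists>f\<in>X_space M \<rho>. \<forall>\<phi>\<in>dual_X M \<rho>. \<Phi> \<phi> = \<phi> f)"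

text \<open>Luxemburg representation on [0, l], l = measure of the space.\<close>
definition rho_bar :: "'a measure \<Rightarrow> (('a \<Rightarrow> ennreal) \<Rightarrow> ennreal) \<Rightarrow> (real \<Rightarrow> ennreal) \<Rightarrow> ennreal" where
  "rho_bar M \<rho> g = (INF f \<in> {f \<in> borel_measurable M.
        distrib_fun M f = distrib_fun (lebesgue_on {0..measure M (space M)}) g}. \<rho> f)"

definition dilation :: "real \<Rightarrow> real \<Rightarrow> (real \<Rightarrow> ennreal) \<Rightarrow> (real \<Rightarrow> ennreal)" where
  "dilation l s g = (\<lambda>t. if t / s \<le> l then g (t / s) else 0)"

definition boyd_h :: "'a measure \<Rightarrow> (('a \<Rightarrow> ennreal) \<Rightarrow> ennreal) \<Rightarrow> real \<Rightarrow> real" where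
  "boyd_h M \<rho> s = enn2real (SUP g \<in> {g \<in> borel_measurable (lebesgue_on {0..measure M (space M)}).
                                  rho_bar M \<rho> g \<le> 1}.
                      rho_bar M \<rho> (dilation (measure M (space M)) s g))"

definition lower_boyd :: "'a measure \<Rightarrow> (('a \<Rightarrow> ennreal) \<Rightarrow> ennreal) \<Rightarrow> real" where
  "lower_boyd M \<rho> = Lim (at_right 0) (\<lambda>s. ln (boyd_h M \<rho> s) / ln s)"

definition upper_boyd :: "'a measure \<Rightarrow> (('a \<Rightarrow> ennreal) \<Rightarrow> ennreal) \<Rightarrow> real" where
  "upper_boyd M \<rho> = Lim at_top (\<lambda>s. ln (boyd_h M \<rho> s) / ln s)"

definition fundamental_fun :: "'a measure \<Rightarrow> (('a \<Rightarrow> ennreal) \<Rightarrow> ennreal) \<Rightarrow> real \<Rightarrow> real" where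
  "fundamental_fun M \<rho> t = enn2real (\<rho> (indicator (SOME E. E \<in> sets M \<and> emeasure M E = ennreal t)))"

definition zippin_M :: "'a measure \<Rightarrow> (('a \<Rightarrow> ennreal) \<Rightarrow> ennreal) \<Rightarrow> real \<Rightarrow> real" where
  "zippin_M M \<rho> s = Sup {fundamental_fun M \<rho> (s * t) / fundamental_fun M \<rho> t | t.
                          0 < t \<and> t \<le> measure M (space M) \<and> s * t \<le> measure M (space M)}"

definition lower_zippin :: "'a measure \<Rightarrow> (('a \<Rightarrow> ennreal) \<Rightarrow> ennreal) \<Rightarrow> real" where
  "lower_zippin M \<rho> = Lim (at_right 0) (\<lambda>s. ln (zippin_M M \<rho> s) / ln s)"

definition upper_zippin :: "'a measure \<Rightarrow> (('a \<Rightarrow> ennreal) \<Rightarrow> ennreal) \<Rightarrow> real" where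
  "upper_zippin M \<rho> = Lim at_top (\<lambda>s. ln (zippin_M M \<rho> s) / ln s)"

definition nontrivial_boyd :: "'a measure \<Rightarrow> (('a \<Rightarrow> ennreal) \<Rightarrow> ennreal) \<Rightarrow> bool" where
  "nontrivial_boyd M \<rho> \<longleftrightarrow> 0 < lower_boyd M \<rho> \<and> lower_boyd M \<rho> \<le> upper_boyd M \<rho> \<and> upper_boyd M \<rho> < 1"

definition fundamental_type :: "'a measure \<Rightarrow> (('a \<Rightarrow> ennreal) \<Rightarrow> ennreal) \<Rightarrow> bool" where
  "fundamental_type M \<rho> \<longleftrightarrow> lower_boyd M \<rho> = lower_zippin M \<rho> \<and> upper_boyd M \<rho> = upper_zippin M \<rho>"

definition bounded_linear_on_X :: "'a measure \<Rightarrow> (('a \<Rightarrow> ennreal) \<Rightarrow> ennreal) \<Rightarrow> 'a set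
     \<Rightarrow> (('a \<Rightarrow> complex) \<Rightarrow> ('a \<Rightarrow> complex)) \<Rightarrow> bool" where
  "bounded_linear_on_X M \<rho> \<Omega> R \<longleftrightarrow>
     (\<forall>f\<in>X_sub M \<rho> \<Omega>. R f \<in> X_sub M \<rho> \<Omega>) \<and>
     (\<forall>f\<in>X_sub M \<rho> \<Omega>. \<forall>h\<in>X_sub M \<rho> \<Omega>. \<forall>c::complex.
         AE x in M. R (\<lambda>y. f y + c * h y) x = R f x + c * R h x) \<and>
     (\<exists>C. \<forall>f\<in>X_sub M \<rho> \<Omega>. X_norm \<rho> (R f) \<le> C * X_norm \<rho> f)"

definition right_invertible_in :: "'a measure \<Rightarrow> (('a \<Rightarrow> ennreal) \<Rightarrow> ennreal) \<Rightarrow> 'a set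
     \<Rightarrow> (('a \<Rightarrow> complex) \<Rightarrow> ('a \<Rightarrow> complex)) \<Rightarrow> bool" where
  "right_invertible_in M \<rho> \<Omega> A \<longleftrightarrow>
     (\<exists>R. bounded_linear_on_X M \<rho> \<Omega> R \<and> (\<forall>f\<in>X_sub M \<rho> \<Omega>. AE x in M. A (R f) x = f x))"

definition left_invertible_in :: "'a measure \<Rightarrow> (('a \<Rightarrow> ennreal) \<Rightarrow> ennreal) \<Rightarrow> 'a set
     \<Rightarrow> (('a \<Rightarrow> complex) \<Rightarrow> ('a \<Rightarrow> complex)) \<Rightarrow> bool" where
  "left_invertible_in M \<rho> \<Omega> A \<longleftrightarrow>
     (\<exists>R. bounded_linear_on_X M \<rho> \<Omega> R \<and> (\<forall>f\<in>X_sub M \<rho> \<Omega>. AE x in M. R (A f) x = f x))"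

end

theory Submission
  imports Defs
begin

text \<open>
  At a limit point of Y the derivative of \<alpha> is 1, so condition (iii) says that |a| and |b| differ
  there and does not involve the Boyd indices. The space therefore only has to be rearrangement
  invariant over a nonatomic measure: if \<tau> pulls sets back to sets of at most K times their
  measure, then composition with \<tau> has norm at most K.

  Necessity. Near a fixed point with derivative 1 and |a| = |b|, long pieces of orbits are almost
  measure preserving. On such a piece a tent function, corrected by the cocycle of b/a, is an
  almost null vector of A, and a bounded cocycle along the piece has only large preimages under A.
  So A is neither left nor right invertible on any invariant set accumulating at that point.

  Sufficiency. All but finitely many components of \<Phi> - \<Lambda> lie in a neighbourhood of Y' where
  | |a| - |b| | is bounded below and the derivative of \<alpha> is close to 1; on the union of these, A is
  two-sided invertible by a Neumann series in W or in its inverse. On \<Lambda> the operator is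
  multiplication by a - b. At a point of Y that is isolated in Y and belongs to the closure of
  \<Gamma> - \<Phi> the derivative is again 1, and invertibility on the adjacent component rules out
  |a| = |b| there, so |a - b| is bounded below almost everywhere on \<Lambda>. The finitely many
  remaining components are covered by (i).
\<close>

section \<open>Composition operators on rearrangement-invariant spaces\<close>

text \<open>Rearrangement invariance compares norms only up to whole-number factors here, because
  level sets are cut into finitely many pieces. Rounding the bound for a single application of the
  shift could ruin a Neumann series whose ratio is barely below 1. So the measure of preimages is
  estimated for the n-th iterate, by \<kappa>^n, and rounding then costs a factor 2 uniformly in n.
  For the test functions constant factors are harmless, since an orbit piece of length 3n gains a
  factor 1/n. The orientation enters through the dynamics. Cut at a fixed point, the shift becomes
  an increasing map of an open parameter interval. Hence orbits of moved points are strictly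
  monotone in the parameter and never return, and a moved point stays in its component of \<Phi> -
  \<Lambda>. The first fact provides disjoint orbit pieces of any length, the second makes every
  component an invariant set, on which A can be studied separately.\<close>

lemma vimage_mult_indicator_UN:
  fixes k :: "'a \<Rightarrow> ennreal"
  assumes y: "y \<noteq> 0" and L: "\<And>y. L y \<subseteq> k -` {y}"
  shows "(\<lambda>x. k x * indicator (\<Union>z\<in>range k. L z) x) -` {y} = L y"
    and "(\<lambda>x. k x * indicator (UNIV - (\<Union>z\<in>range k. L z)) x) -` {y} = k -` {y} - L y"
proof -
  \<comment> \<open>Level sets of different values are disjoint, so the only piece that can contain
    x is the one for the value \<open>k x\<close>.\<close>
  have 1: "x \<in> (\<Union>z\<in>range k. L z) \<longleftrightarrow> x \<in> L (k x)" for x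
  proof
    assume "x \<in> (\<Union>z\<in>range k. L z)"
    then obtain z where z: "x \<in> L z" by blast
    then have "k x = z" using L[of z] by blast
    then show "x \<in> L (k x)" using z by simp
  qed blast
  have 2: "x \<in> L y \<Longrightarrow> k x = y" for x using L[of y] by blast
  show "(\<lambda>x. k x * indicator (\<Union>z\<in>range k. L z) x) -` {y} = L y"
  proof (rule set_eqI)
    fix x show "x \<in> (\<lambda>x. k x * indicator (\<Union>z\<in>range k. L z) x) -` {y} \<longleftrightarrow> x \<in> L y"
      using y 2[of x] unfolding vimage_def mem_Collect_eq indicator_def 1 by (cases "k x = y") auto
  qed
  show "(\<lambda>x. k x * indicator (UNIV - (\<Union>z\<in>range k. L z)) x) -` {y} = k -` {y} - L y"
  proof (rule set_eqI)
    fix x show "x \<in> (\<lambda>x. k x * indicator (UNIV - (\<Union>z\<in>range k. L z)) x) -` {y} \<longleftrightarrow> x \<in> k -` {y} - L y"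
      using y 2[of x] unfolding vimage_def mem_Collect_eq indicator_def Diff_iff 1 by (cases "k x = y") auto
  qed
qed

text \<open>Of arc length only finiteness and the intermediate value form of nonatomicity are kept.
  The latter allows a level set to be cut into pieces of prescribed measure.\<close>

locale ri_norm =
  fixes M :: "'a measure" and \<rho> :: "('a \<Rightarrow> ennreal) \<Rightarrow> ennreal"
  assumes ri: "ri_space M \<rho>"
    and space_M [simp]: "space M = UNIV"
    and finite_M: "emeasure M UNIV < \<infinity>"
    and nonatomic: "\<And>E c. E \<in> sets M \<Longrightarrow> c \<le> emeasure M E \<Longrightarrow>
                      \<exists>E'\<in>sets M. E' \<subseteq> E \<and> emeasure M E' = c"
begin

lemma bfn: "banach_function_norm M \<rho>"
  using ri by (simp add: ri_space_def)

lemmas bfn_axioms = bfn[unfolded banach_function_norm_def]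

lemma rho_zero_iff: "f \<in> borel_measurable M \<Longrightarrow> \<rho> f = 0 \<longleftrightarrow> (AE x in M. f x = 0)"
  using bfn_axioms[THEN conjunct1] by blast

lemma rho_cmult: "f \<in> borel_measurable M \<Longrightarrow> c \<ge> 0 \<Longrightarrow> \<rho> (\<lambda>x. ennreal c * f x) = ennreal c * \<rho> f"
  using bfn_axioms[THEN conjunct2, THEN conjunct1] by blast

lemma rho_add:
  "f \<in> borel_measurable M \<Longrightarrow> h \<in> borel_measurable M \<Longrightarrow> \<rho> (\<lambda>x. f x + h x) \<le> \<rho> f + \<rho> h"
  using bfn_axioms[THEN conjunct2, THEN conjunct2, THEN conjunct1] by blast

lemma rho_mono_AE:
  "f \<in> borel_measurable M \<Longrightarrow> h \<in> borel_measurable M \<Longrightarrow> (AE x in M. h x \<le> f x) \<Longrightarrow> \<rho> h \<le> \<rho> f"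
  using bfn_axioms[THEN conjunct2, THEN conjunct2, THEN conjunct2, THEN conjunct1] by blast

lemma rho_Fatou:
  assumes "\<And>n. F n \<in> borel_measurable M" "f \<in> borel_measurable M"
    "AE x in M. incseq (\<lambda>n. F n x) \<and> (\<lambda>n. F n x) \<longlonglongrightarrow> f x"
  shows "\<rho> f = (SUP n. \<rho> (F n))"
  using bfn_axioms[THEN conjunct2, THEN conjunct2, THEN conjunct2, THEN conjunct2, THEN conjunct1] assms by blast

lemma rho_equidistributed:
  "f \<in> borel_measurable M \<Longrightarrow> h \<in> borel_measurable M \<Longrightarrow> distrib_fun M f = distrib_fun M h \<Longrightarrow> \<rho> f = \<rho> h"
  using ri unfolding ri_space_def rearrangement_invariant_def by blast

lemma emeasure_finite: "emeasure M E < \<infinity>"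
proof -
  have "emeasure M E \<le> emeasure M (space M)" by (rule emeasure_space)
  then show ?thesis using finite_M by (simp add: le_less_trans)
qed

lemma rho_indicator_finite: "E \<in> sets M \<Longrightarrow> \<rho> (indicator E) < \<infinity>"
  using bfn_axioms[THEN conjunct2, THEN conjunct2, THEN conjunct2, THEN conjunct2, THEN conjunct2, THEN conjunct1] emeasure_finite by blast

lemma rho_indicator_pos: "E \<in> sets M \<Longrightarrow> emeasure M E > 0 \<Longrightarrow> \<rho> (indicator E) > 0"
proof -
  assume E: "E \<in> sets M" and p: "emeasure M E > 0"
  have "\<not> (AE x in M. indicator E x = (0::ennreal))"
  proof
    assume "AE x in M. indicator E x = (0::ennreal)"
    then have "AE x in M. x \<notin> E" by (rule eventually_mono) (auto simp: indicator_def split: if_splits)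
    with p E show False by (metis AE_iff_null_sets null_setsD1 less_irrefl)
  qed
  then show ?thesis using rho_zero_iff[of "indicator E"] E
    by (auto simp: zero_less_iff_neq_zero)
qed

lemma nn_integral_le_rho:
  "\<exists>C::real. \<forall>f\<in>borel_measurable M. (\<integral>\<^sup>+x. f x \<partial>M) \<le> ennreal C * \<rho> f"
proof -
  have "UNIV \<in> sets M" using sets.top[of M] by simp
  moreover have "emeasure M UNIV < \<infinity>" by (rule emeasure_finite)
  ultimately have "\<exists>C::real. \<forall>f\<in>borel_measurable M. (\<integral>\<^sup>+x\<in>UNIV. f x \<partial>M) \<le> ennreal C * \<rho> f"
    using bfn_axioms[THEN conjunct2, THEN conjunct2, THEN conjunct2, THEN conjunct2, THEN conjunct2, THEN conjunct2] by blast
  then show ?thesis by simp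
qed

text \<open>The embedding of X into L^1 over a finite measure; it later turns convergence in norm of
  a series into convergence almost everywhere.\<close>

lemma AE_finite_of_rho_finite:
  assumes f: "f \<in> borel_measurable M" and "\<rho> f < \<infinity>"
  shows "AE x in M. f x < \<infinity>"
proof -
  obtain C :: real where "(\<integral>\<^sup>+x. f x \<partial>M) \<le> ennreal C * \<rho> f" using nn_integral_le_rho f by blast
  also have "\<dots> < \<infinity>" using assms by (simp add: ennreal_mult_less_top)
  finally have "(\<integral>\<^sup>+x. f x \<partial>M) \<noteq> \<infinity>" by simp
  from nn_integral_PInf_AE[OF f this] show ?thesis by (simp add: top.not_eq_extremum)
qed

lemma rho_zero: "\<rho> (\<lambda>x. 0) = 0"
  by (subst rho_zero_iff) auto

lemma rho_sum:
  assumes "finite I" "\<And>i. i \<in> I \<Longrightarrow> F i \<in> borel_measurable M"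
  shows "\<rho> (\<lambda>x. \<Sum>i\<in>I. F i x) \<le> (\<Sum>i\<in>I. \<rho> (F i))"
  using assms
proof (induction I rule: finite_induct)
  case empty then show ?case by (simp add: rho_zero)
next
  case (insert i I)
  have "\<rho> (\<lambda>x. F i x + (\<Sum>j\<in>I. F j x)) \<le> \<rho> (F i) + \<rho> (\<lambda>x. \<Sum>j\<in>I. F j x)"
    by (rule rho_add) (use insert in auto)
  also have "\<dots> \<le> \<rho> (F i) + (\<Sum>j\<in>I. \<rho> (F j))"
    by (rule add_left_mono) (use insert in auto)
  finally show ?case using insert by simp
qed

text \<open>The partial sums increase to the series, so the Fatou property carries the finite
  triangle inequality over.\<close>

lemma rho_suminf:
  assumes "\<And>i. F i \<in> borel_measurable M"
  shows "\<rho> (\<lambda>x. \<Sum>i. F i x) \<le> (\<Sum>i. \<rho> (F i))"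
proof -
  have "\<rho> (\<lambda>x. \<Sum>i. F i x) = (SUP n. \<rho> (\<lambda>x. \<Sum>i<n. F i x))"
  proof (rule rho_Fatou)
    show "AE x in M. incseq (\<lambda>n. \<Sum>i<n. F i x) \<and> (\<lambda>n. \<Sum>i<n. F i x) \<longlonglongrightarrow> (\<Sum>i. F i x)"
    proof (rule AE_I2, rule conjI)
      fix x
      show "incseq (\<lambda>n. \<Sum>i<n. F i x)" by (intro incseq_SucI) simp
      show "(\<lambda>n. \<Sum>i<n. F i x) \<longlonglongrightarrow> (\<Sum>i. F i x)"
        using summable_LIMSEQ[of "\<lambda>i. F i x"] by simp
    qed
  qed (use assms in auto)
  also have "\<dots> \<le> (\<Sum>i. \<rho> (F i))"
  proof (rule SUP_least)
    fix n
    have "\<rho> (\<lambda>x. \<Sum>i<n. F i x) \<le> (\<Sum>i<n. \<rho> (F i))" by (rule rho_sum) (use assms in auto)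
    also have "\<dots> \<le> (\<Sum>i. \<rho> (F i))" by (rule sum_le_suminf) auto
    finally show "\<rho> (\<lambda>x. \<Sum>i<n. F i x) \<le> (\<Sum>i. \<rho> (F i))" .
  qed
  finally show ?thesis .
qed

text \<open>The distribution function at t is a finite sum of the measures of the level sets above
  t. The value 0 is never above t, so its level set may be ignored.\<close>

lemma distrib_fun_simple_eq:
  assumes f: "simple_function M f" and h: "simple_function M h"
    and eq: "\<And>y. y \<noteq> 0 \<Longrightarrow> emeasure M (f -` {y}) = emeasure M (h -` {y})"
  shows "distrib_fun M f = distrib_fun M (h :: 'a \<Rightarrow> ennreal)"
proof
  fix t
  define R where "R = {y \<in> range f \<union> range h. t < y}"
  have finR: "finite R" using simple_functionD(1)[OF f] simple_functionD(1)[OF h]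
    by (auto simp: R_def)
  have *: "distrib_fun M k t = (\<Sum>y\<in>R. emeasure M (k -` {y}))"
    if k: "simple_function M k" and r: "range k \<subseteq> range f \<union> range h" for k :: "'a \<Rightarrow> ennreal"
  proof -
    have e: "{x \<in> space M. t < k x} = (\<Union>y\<in>R. k -` {y})" using r by (force simp: R_def)
    show ?thesis unfolding distrib_fun_def e
    proof (rule sum_emeasure[symmetric])
      show "(\<lambda>y. k -` {y}) ` R \<subseteq> sets M" using simple_functionD(2)[OF k] by auto
    qed (auto simp: disjoint_family_on_def finR)
  qed
  have "distrib_fun M f t = (\<Sum>y\<in>R. emeasure M (f -` {y}))" by (rule *[OF f]) auto
  also have "\<dots> = (\<Sum>y\<in>R. emeasure M (h -` {y}))"
    by (rule sum.cong[OF refl], rule eq) (auto simp: R_def)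
  also have "\<dots> = distrib_fun M h t" by (rule *[OF h, symmetric]) auto
  finally show "distrib_fun M f t = distrib_fun M h t" .
qed

text \<open>Each level set of h is split into K pieces that fit into the corresponding level set of f.\<close>

lemma rho_le_of_level_sets:
  assumes "simple_function M f" "simple_function M h"
    and "\<And>y. y \<noteq> 0 \<Longrightarrow> emeasure M (h -` {y}) \<le> of_nat K * emeasure M (f -` {y})"
  shows "\<rho> h \<le> of_nat K * \<rho> f"
  using assms
proof (induction K arbitrary: h)
  case 0
  have "\<rho> h = \<rho> (\<lambda>x. 0)"
  proof (rule rho_equidistributed)
    show "distrib_fun M h = distrib_fun M (\<lambda>x. 0)"
    proof (rule distrib_fun_simple_eq)
      fix y :: ennreal assume "y \<noteq> 0"
      then have "(\<lambda>x. 0) -` {y} = ({}::'a set)" by auto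
      with 0(3)[OF \<open>y \<noteq> 0\<close>] show "emeasure M (h -` {y}) = emeasure M ((\<lambda>x. 0) -` {y})" by simp
    qed (use 0 in auto)
  qed (use 0 in \<open>auto intro: borel_measurable_simple_function\<close>)
  then show ?case by (simp add: rho_zero)
next
  case (Suc K)
  note [measurable] = borel_measurable_simple_function[OF Suc.prems(1)]
    borel_measurable_simple_function[OF Suc.prems(2)]
  let ?m = "\<lambda>y. min (emeasure M (h -` {y})) (emeasure M (f -` {y}))"
  have lf: "f -` {y} \<in> sets M" and lh: "h -` {y} \<in> sets M" for y
    using simple_functionD(2)[OF Suc.prems(1)] simple_functionD(2)[OF Suc.prems(2)] by auto
  have "\<exists>H. \<forall>y. H y \<in> sets M \<and> H y \<subseteq> h -` {y} \<and> emeasure M (H y) = ?m y"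
    
  proof (intro choice allI)
    fix y
    show "\<exists>H. H \<in> sets M \<and> H \<subseteq> h -` {y} \<and> emeasure M H = ?m y"
      using nonatomic[OF lh min.cobounded1, of y] by blast
  qed
  then obtain H where H: "\<And>y. H y \<in> sets M" "\<And>y. H y \<subseteq> h -` {y}" "\<And>y. emeasure M (H y) = ?m y"
    by blast
  have "\<exists>F. \<forall>y. F y \<in> sets M \<and> F y \<subseteq> f -` {y} \<and> emeasure M (F y) = ?m y"
    
  proof (intro choice allI)
    fix y
    show "\<exists>F. F \<in> sets M \<and> F \<subseteq> f -` {y} \<and> emeasure M F = ?m y"
      using nonatomic[OF lf min.cobounded2, of y] by blast
  qed
  then obtain F where F: "\<And>y. F y \<in> sets M" "\<And>y. F y \<subseteq> f -` {y}" "\<And>y. emeasure M (F y) = ?m y"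
    by blast
  define HH where "HH = (\<Union>y\<in>range h. H y)"
  define FF where "FF = (\<Union>y\<in>range f. F y)"
  have HH: "HH \<in> sets M" unfolding HH_def
    by (rule sets.finite_UN) (use simple_functionD(1)[OF Suc.prems(2)] H(1) in simp_all)
  have FF: "FF \<in> sets M" unfolding FF_def
    by (rule sets.finite_UN) (use simple_functionD(1)[OF Suc.prems(1)] F(1) in simp_all)
  have [measurable]: "HH \<in> sets M" "FF \<in> sets M" by (fact HH FF)+
  define h1 where "h1 = (\<lambda>x. h x * indicator HH x)"
  define h2 where "h2 = (\<lambda>x. h x * indicator (UNIV - HH) x)"
  define f1 where "f1 = (\<lambda>x. f x * indicator FF x)"
  have s: "simple_function M h1" "simple_function M h2" "simple_function M f1"
    unfolding h1_def h2_def f1_def using Suc.prems HH FF sets.compl_sets[OF HH]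
    by (auto intro!: simple_function_mult simple_function_indicator)
  have lev: "h1 -` {y} = H y" "f1 -` {y} = F y" "h2 -` {y} = h -` {y} - H y" if "y \<noteq> 0" for y
    unfolding h1_def f1_def h2_def HH_def FF_def
    by (rule vimage_mult_indicator_UN[OF that H(2)] vimage_mult_indicator_UN[OF that F(2)])+
  \<comment> \<open>The cut-off functions have nonzero level sets of equal measure
    \<open>?m y\<close>, so they are equimeasurable. The remainder \<open>h2\<close> satisfies the
    induction hypothesis with one piece fewer.\<close>
  have "\<rho> h1 = \<rho> f1"
  proof (rule rho_equidistributed)
    show "distrib_fun M h1 = distrib_fun M f1"
      by (rule distrib_fun_simple_eq[OF s(1,3)]) (simp add: lev H F)
  qed (use s in \<open>auto intro: borel_measurable_simple_function\<close>)
  also have "\<dots> \<le> \<rho> f"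
    by (rule rho_mono_AE) (use s in \<open>auto simp: f1_def indicator_def\<close>)
  finally have 1: "\<rho> h1 \<le> \<rho> f" .
  have 2: "\<rho> h2 \<le> of_nat K * \<rho> f"
  proof (rule Suc.IH[OF Suc.prems(1) s(2)])
    fix y :: ennreal assume y: "y \<noteq> 0"
    have "emeasure M (h2 -` {y}) = emeasure M (h -` {y}) - ?m y"
      unfolding lev(3)[OF y] using H(1,2) lh emeasure_finite[of "H y"] H(3)[of y]
      by (subst emeasure_Diff) (auto simp: less_top)
    also have "\<dots> \<le> of_nat K * emeasure M (f -` {y})"
    proof (cases "emeasure M (h -` {y}) \<le> emeasure M (f -` {y})")
      case True then show ?thesis
        using emeasure_finite[of "h -` {y}"] by (simp add: min_absorb1)
    next
      case False
      then have "?m y = emeasure M (f -` {y})" by (simp add: min_absorb2)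
      moreover have "emeasure M (h -` {y}) \<le> emeasure M (f -` {y}) + of_nat K * emeasure M (f -` {y})"
        using Suc.prems(3)[OF y] by (simp add: algebra_simps)
      ultimately show ?thesis
        using emeasure_finite[of "f -` {y}"]
        by (auto simp: ennreal_minus_le_iff)
    qed
    finally show "emeasure M (h2 -` {y}) \<le> of_nat K * emeasure M (f -` {y})" .
  qed
  have "h = (\<lambda>x. h1 x + h2 x)" by (auto simp: h1_def h2_def indicator_def)
  then have "\<rho> h \<le> \<rho> h1 + \<rho> h2"
    using rho_add[of h1 h2] s by (auto intro: borel_measurable_simple_function)
  also have "\<dots> \<le> \<rho> f + of_nat K * \<rho> f" by (rule add_mono[OF 1 2])
  finally show ?case by (simp add: algebra_simps)
qed

text \<open>For a simple function the nonzero level sets of the composition are preimages of level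
  sets, so the measure bound is the level-set comparison; increasing simple approximations and the
  Fatou property give the rest. The factor is a natural number because it counts pieces.\<close>

lemma rho_comp_le:
  assumes T [measurable]: "T \<in> measurable M M" and F [measurable]: "F \<in> sets M"
    and K: "\<And>E. E \<in> sets M \<Longrightarrow> emeasure M (F \<inter> T -` E) \<le> of_nat K * emeasure M E"
    and f [measurable]: "f \<in> borel_measurable M"
  shows "\<rho> (\<lambda>x. indicator F x * f (T x)) \<le> of_nat K * \<rho> f"
proof -
  obtain s where s: "\<And>i. simple_function M (s i)" "incseq s" "\<And>i x. s i x < top"
      "\<And>x. (SUP i. s i x) = f x"
    using borel_measurable_implies_simple_function_sequence'[OF f] by blast
  have sm [measurable]: "s i \<in> borel_measurable M" for i
    using s(1) by (rule borel_measurable_simple_function)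
  have lim: "(\<lambda>i. s i x) \<longlonglongrightarrow> f x" for x
    unfolding s(4)[symmetric] by (rule LIMSEQ_SUP) (use s(2) in \<open>auto simp: incseq_def le_fun_def\<close>)
  have "\<rho> (\<lambda>x. indicator F x * f (T x)) = (SUP i. \<rho> (\<lambda>x. indicator F x * s i (T x)))"
  proof (rule rho_Fatou)
    show "AE x in M. incseq (\<lambda>i. indicator F x * s i (T x)) \<and>
        (\<lambda>i. indicator F x * s i (T x)) \<longlonglongrightarrow> indicator F x * f (T x)"
    proof (rule AE_I2, rule conjI)
      fix x
      show "incseq (\<lambda>i. indicator F x * s i (T x))"
        using s(2) by (auto simp: incseq_def le_fun_def intro!: mult_left_mono)
      show "(\<lambda>i. indicator F x * s i (T x)) \<longlonglongrightarrow> indicator F x * f (T x)"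
        using lim[of "T x"] by (auto simp: indicator_def)
    qed
  qed auto
  also have "\<dots> \<le> of_nat K * \<rho> f"
  proof (rule SUP_least)
    fix i
    have "\<rho> (\<lambda>x. indicator F x * s i (T x)) \<le> of_nat K * \<rho> (s i)"
    proof (rule rho_le_of_level_sets[OF s(1)])
      have "simple_function M (\<lambda>x. s i (T x))"
        using simple_function_comp[OF T s(1)] by (simp add: comp_def)
      then show "simple_function M (\<lambda>x. indicator F x * s i (T x))"
        by (intro simple_function_mult simple_function_indicator F)
      fix y :: ennreal assume "y \<noteq> 0"
      then have "(\<lambda>x. indicator F x * s i (T x)) -` {y} = F \<inter> T -` (s i -` {y})"
        by (auto simp: indicator_def split: if_splits)
      moreover have "s i -` {y} \<in> sets M" using simple_functionD(2)[OF s(1)] by auto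
      ultimately show "emeasure M ((\<lambda>x. indicator F x * s i (T x)) -` {y})
          \<le> of_nat K * emeasure M (s i -` {y})" using K by simp
    qed
    also have "\<dots> \<le> of_nat K * \<rho> f"
      by (intro mult_left_mono rho_mono_AE) (auto simp: s(4)[symmetric] intro!: SUP_upper)
    finally show "\<rho> (\<lambda>x. indicator F x * s i (T x)) \<le> of_nat K * \<rho> f" .
  qed
  finally show ?thesis .
qed

end

section \<open>Norms of complex functions and Neumann series\<close>

context ri_norm
begin

text \<open>Taking values in \<open>ennreal\<close>, it obeys monotonicity and the triangle
  inequality for all measurable functions, without prior membership in the space.\<close>

definition nrm :: "('a \<Rightarrow> complex) \<Rightarrow> ennreal" where
  "nrm f = \<rho> (\<lambda>x. ennreal (cmod (f x)))"

abbreviation XS :: "'a set \<Rightarrow> ('a \<Rightarrow> complex) set" where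
  "XS \<equiv> X_sub M \<rho>"

lemma X_sub_iff:
  "f \<in> XS \<Omega> \<longleftrightarrow> f \<in> borel_measurable M \<and> nrm f < \<infinity> \<and> (AE x in M. x \<notin> \<Omega> \<longrightarrow> f x = 0)"
  by (simp add: X_sub_def X_space_def nrm_def)

lemma nrm_eq_X_norm: "nrm f < \<infinity> \<Longrightarrow> nrm f = ennreal (X_norm \<rho> f)"
  by (simp add: X_norm_def nrm_def)

lemma nrm_mono_AE:
  assumes "f \<in> borel_measurable M" "h \<in> borel_measurable M" "AE x in M. cmod (h x) \<le> cmod (f x)"
  shows "nrm h \<le> nrm f"
  unfolding nrm_def
  by (rule rho_mono_AE) (use assms in \<open>auto elim!: eventually_mono intro!: ennreal_leI\<close>)

lemma nrm_cong_AE: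
  assumes "f \<in> borel_measurable M" "h \<in> borel_measurable M" "AE x in M. h x = f x"
  shows "nrm h = nrm f"
  by (rule antisym; rule nrm_mono_AE) (use assms in \<open>auto elim!: eventually_mono\<close>)

lemma nrm_add:
  assumes [measurable]: "f \<in> borel_measurable M" "h \<in> borel_measurable M"
  shows "nrm (\<lambda>x. f x + h x) \<le> nrm f + nrm h"
proof -
  have "nrm (\<lambda>x. f x + h x) \<le> \<rho> (\<lambda>x. ennreal (cmod (f x)) + ennreal (cmod (h x)))"
    unfolding nrm_def
    by (rule rho_mono_AE) (auto simp: norm_triangle_ineq simp flip: ennreal_plus intro!: ennreal_leI)
  also have "\<dots> \<le> nrm f + nrm h" unfolding nrm_def by (rule rho_add) auto
  finally show ?thesis .
qed

lemma nrm_le_cmult: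
  assumes [measurable]: "f \<in> borel_measurable M" "h \<in> borel_measurable M" and c: "c \<ge> 0"
    and le: "AE x in M. cmod (h x) \<le> c * cmod (f x)"
  shows "nrm h \<le> ennreal c * nrm f"
proof -
  have "nrm h \<le> \<rho> (\<lambda>x. ennreal c * ennreal (cmod (f x)))"
    unfolding nrm_def
  proof (rule rho_mono_AE)
    show "AE x in M. ennreal (cmod (h x)) \<le> ennreal c * ennreal (cmod (f x))"
      using le by (rule eventually_mono) (use c in \<open>simp add: ennreal_leI flip: ennreal_mult\<close>)
  qed auto
  also have "\<dots> = ennreal c * nrm f" unfolding nrm_def by (rule rho_cmult) (use c in auto)
  finally show ?thesis .
qed

lemma bounded_linear_on_XD:
  assumes "bounded_linear_on_X M \<rho> \<Omega> R"
  shows "f \<in> XS \<Omega> \<Longrightarrow> R f \<in> XS \<Omega>"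
    and "f \<in> XS \<Omega> \<Longrightarrow> h \<in> XS \<Omega> \<Longrightarrow>
           AE x in M. R (\<lambda>y. f y + c * h y) x = R f x + c * R h x"
  using assms unfolding bounded_linear_on_X_def by simp_all

lemma bounded_linear_on_X_bound:
  assumes "bounded_linear_on_X M \<rho> \<Omega> R"
  obtains C where "C > 0" "\<And>f. f \<in> XS \<Omega> \<Longrightarrow> nrm (R f) \<le> ennreal C * nrm f"
proof -
  obtain C where C: "\<And>f. f \<in> XS \<Omega> \<Longrightarrow> X_norm \<rho> (R f) \<le> C * X_norm \<rho> f"
    and R: "\<And>f. f \<in> XS \<Omega> \<Longrightarrow> R f \<in> XS \<Omega>"
    using assms unfolding bounded_linear_on_X_def by blast
  show ?thesis
  \<comment> \<open>The constant in the definition of boundedness may be zero or negative; a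
    positive one can be divided by later.\<close>
  proof (rule that[of "max C 1"])
    fix f assume f: "f \<in> XS \<Omega>"
    have fin: "nrm f < \<infinity>" "nrm (R f) < \<infinity>" using f R[OF f] by (auto simp: X_sub_iff)
    have "X_norm \<rho> (R f) \<le> max C 1 * X_norm \<rho> f"
      using C[OF f] by (rule order_trans) (auto simp: X_norm_def intro!: mult_right_mono)
    then show "nrm (R f) \<le> ennreal (max C 1) * nrm f"
      unfolding nrm_eq_X_norm[OF fin(1)] nrm_eq_X_norm[OF fin(2)]
      by (subst ennreal_mult[symmetric]) (auto simp: X_norm_def intro!: ennreal_leI)
  qed simp
qed

lemma bounded_linear_on_XI:
  assumes "\<And>f. f \<in> XS \<Omega> \<Longrightarrow> R f \<in> borel_measurable M"
    and "\<And>f. f \<in> XS \<Omega> \<Longrightarrow> AE x in M. x \<notin> \<Omega> \<longrightarrow> R f x = 0"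
    and lin: "\<And>f h c. f \<in> XS \<Omega> \<Longrightarrow> h \<in> XS \<Omega> \<Longrightarrow>
           AE x in M. R (\<lambda>y. f y + c * h y) x = R f x + c * R h x"
    and C: "C \<ge> 0" "\<And>f. f \<in> XS \<Omega> \<Longrightarrow> nrm (R f) \<le> ennreal C * nrm f"
  shows "bounded_linear_on_X M \<rho> \<Omega> R"
proof -
  have fin: "nrm (R f) < \<infinity>" if "f \<in> XS \<Omega>" for f
    using C(2)[OF that] that
    by (auto simp: X_sub_iff ennreal_mult_less_top intro: le_less_trans)
  have R: "R f \<in> XS \<Omega>" if "f \<in> XS \<Omega>" for f
    using assms(1,2) fin that by (auto simp: X_sub_iff)
  have "X_norm \<rho> (R f) \<le> C * X_norm \<rho> f" if f: "f \<in> XS \<Omega>" for f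
  proof -
    have 1: "nrm f < \<infinity>" using f by (simp add: X_sub_iff)
    have "ennreal (X_norm \<rho> (R f)) \<le> ennreal C * ennreal (X_norm \<rho> f)"
      using C(2)[OF f] nrm_eq_X_norm[OF fin[OF f]] nrm_eq_X_norm[OF 1] by simp
    also have "\<dots> = ennreal (C * X_norm \<rho> f)"
      using C by (simp add: ennreal_mult X_norm_def)
    finally show ?thesis using C by (simp add: X_norm_def)
  qed
  then show ?thesis unfolding bounded_linear_on_X_def using R lin by blast
qed

lemma ennreal_of_nat_ceiling_le: "c \<ge> 0 \<Longrightarrow> ennreal c \<le> of_nat (nat \<lceil>c\<rceil>)"
  by (metis ennreal_leI ennreal_of_nat_eq_real_of_nat of_nat_ceiling)

text \<open>The inverse of I - U, where U f is w times f after \<tau>, is the sum of the powers of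
  U, and the n-th power has norm at most 2(q\<kappa>)^n. The measure hypothesis speaks of all
  iterates, so that the rounding to an integer happens once per power and is not compounded.\<close>

lemma neumann_inverse:
  fixes w :: "'a \<Rightarrow> complex" and \<tau> :: "'a \<Rightarrow> 'a" and q \<kappa> :: real
  assumes \<tau> [measurable]: "\<tau> \<in> measurable M M" and w [measurable]: "w \<in> borel_measurable M"
    and \<Omega> [measurable]: "\<Omega> \<in> sets M" and \<tau>\<Omega>: "\<And>x. x \<in> \<Omega> \<Longrightarrow> \<tau> x \<in> \<Omega>"
    and q: "0 \<le> q" "\<And>x. x \<in> \<Omega> \<Longrightarrow> cmod (w x) \<le> q"
    and \<kappa>: "1 \<le> \<kappa>" "q * \<kappa> < 1"
    and meas: "\<And>n E. E \<in> sets M \<Longrightarrow> emeasure M (\<Omega> \<inter> (\<tau> ^^ n) -` E) \<le> ennreal (\<kappa> ^ n) * emeasure M E"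
  obtains R where "bounded_linear_on_X M \<rho> \<Omega> R"
    and "\<And>f. f \<in> XS \<Omega> \<Longrightarrow> AE x in M. x \<in> \<Omega> \<longrightarrow> R f x - w x * R f (\<tau> x) = f x"
    and "\<And>f h. f \<in> XS \<Omega> \<Longrightarrow> (\<And>x. x \<in> \<Omega> \<Longrightarrow> h x = f x - w x * f (\<tau> x)) \<Longrightarrow>
            AE x in M. R h x = f x"
proof -
  have pow_m [measurable]: "(\<tau> ^^ n) \<in> measurable M M" for n
    by (rule measurable_compose_n) (rule \<tau>)
  have pow\<Omega>: "x \<in> \<Omega> \<Longrightarrow> (\<tau> ^^ n) x \<in> \<Omega>" for n x by (induction n) (auto simp: \<tau>\<Omega>)
  define W where "W n x = (\<Prod>k<n. w ((\<tau> ^^ k) x))" for n x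
  have W_m [measurable]: "W n \<in> borel_measurable M" for n unfolding W_def by measurable
  have W_le: "cmod (W n x) \<le> q ^ n" if "x \<in> \<Omega>" for n x
  proof -
    have "cmod (W n x) = (\<Prod>k<n. cmod (w ((\<tau> ^^ k) x)))" by (simp add: W_def prod_norm)
    also have "\<dots> \<le> (\<Prod>k<n. q)" by (rule prod_mono) (use that q pow\<Omega> in auto)
    finally show ?thesis by simp
  qed
  \<comment> \<open>\<open>t f n\<close> is the n-th power of the weighted composition operator
    applied to f, cut off outside \<Omega>; \<open>W n\<close> collects the weights along the
    orbit.\<close>
  define t where "t f n x = (indicator \<Omega> x * W n x * f ((\<tau> ^^ n) x) :: complex)" for f n x
  have t_m [measurable]: "t f n \<in> borel_measurable M" if [measurable]: "f \<in> borel_measurable M" for f n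
    unfolding t_def by measurable
  have t_Suc: "t f (Suc n) x = w x * t f n (\<tau> x)" if "x \<in> \<Omega>" for f n x
    using that \<tau>\<Omega>[OF that] unfolding t_def W_def
    by (simp add: prod.lessThan_Suc_shift funpow_swap1 del: funpow.simps(2) prod.lessThan_Suc)
      (simp add: funpow_swap1)
  define R where "R f x = (\<Sum>n. t f n x)" for f x
  \<comment> \<open>The series of moduli is kept in \<open>ennreal\<close>, where it always
    converges. Its finite norm shows that the series for \<open>R f\<close> converges absolutely
    almost everywhere, and it dominates \<open>R f\<close>.\<close>
  define H where "H f x = (\<Sum>n. ennreal (cmod (t f n x)))" for f x
  define C where "C = 2 / (1 - q * \<kappa>)"
  have C: "C \<ge> 0" using \<kappa> by (simp add: C_def)
  have nt: "nrm (t f n) \<le> ennreal (2 * (q * \<kappa>) ^ n) * nrm f"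
    if f [measurable]: "f \<in> borel_measurable M" for f n
  proof -
    let ?K = "nat \<lceil>\<kappa> ^ n\<rceil>"
    have "nrm (t f n) \<le> ennreal (q ^ n) * nrm (\<lambda>x. indicator \<Omega> x * f ((\<tau> ^^ n) x))"
    proof (rule nrm_le_cmult)
      show "AE x in M. cmod (t f n x) \<le> q ^ n * cmod (indicator \<Omega> x * f ((\<tau> ^^ n) x))"
        by (rule AE_I2) (auto simp: t_def norm_mult indicator_def W_le intro!: mult_right_mono)
    qed (use q in auto)
    also have "nrm (\<lambda>x. indicator \<Omega> x * f ((\<tau> ^^ n) x))
        = \<rho> (\<lambda>x. indicator \<Omega> x * ennreal (cmod (f ((\<tau> ^^ n) x))))"
      unfolding nrm_def by (rule arg_cong[of _ _ \<rho>]) (auto simp: indicator_def)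
    also have "\<dots> \<le> of_nat ?K * \<rho> (\<lambda>x. ennreal (cmod (f x)))"
    proof (rule rho_comp_le[OF pow_m \<Omega>])
      fix E assume E: "E \<in> sets M"
      have "ennreal (\<kappa> ^ n) \<le> of_nat ?K" using \<kappa> by (intro ennreal_of_nat_ceiling_le) simp
      then show "emeasure M (\<Omega> \<inter> (\<tau> ^^ n) -` E) \<le> of_nat ?K * emeasure M E"
        using meas[OF E, of n] by (meson mult_right_mono order_trans zero_le)
    qed auto
    also have "ennreal (q ^ n) * (of_nat ?K * \<rho> (\<lambda>x. ennreal (cmod (f x))))
        = ennreal (q ^ n * ?K) * nrm f"
      using q by (simp add: nrm_def ennreal_mult ennreal_of_nat_eq_real_of_nat mult.assoc)
    also have "\<dots> \<le> ennreal (2 * (q * \<kappa>) ^ n) * nrm f"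
    proof (intro mult_right_mono ennreal_leI)
      \<comment> \<open>For a number z at least 1, rounding up gives at most z + 1, hence at most
        2z.\<close>
      have "1 \<le> \<kappa> ^ n" using \<kappa> by simp
      then have "real ?K \<le> 2 * \<kappa> ^ n" by linarith
      then have "q ^ n * real ?K \<le> q ^ n * (2 * \<kappa> ^ n)" using q by (intro mult_left_mono) auto
      then show "q ^ n * real ?K \<le> 2 * (q * \<kappa>) ^ n" by (simp add: power_mult_distrib mult_ac)
    qed simp
    finally show ?thesis by (meson mult_left_mono order_trans zero_le)
  qed
  have \<rho>H: "\<rho> (H f) \<le> ennreal C * nrm f" if f [measurable]: "f \<in> borel_measurable M" for f
  proof -
    have "\<rho> (H f) \<le> (\<Sum>n. nrm (t f n))"
      unfolding H_def nrm_def by (rule rho_suminf) auto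
    also have "\<dots> \<le> (\<Sum>n. ennreal (2 * (q * \<kappa>) ^ n) * nrm f)"
      by (rule suminf_le) (auto intro: nt)
    also have "\<dots> = (\<Sum>n. ennreal (2 * (q * \<kappa>) ^ n)) * nrm f" by simp
    also have "(\<Sum>n. ennreal (2 * (q * \<kappa>) ^ n)) = ennreal C"
    proof -
      have "(\<lambda>n. 2 * (q * \<kappa>) ^ n) sums (2 * (1 / (1 - q * \<kappa>)))"
        using q \<kappa> by (intro sums_mult geometric_sums) auto
      then show ?thesis using q \<kappa> unfolding C_def
        by (subst suminf_ennreal_eq) auto
    qed
    finally show ?thesis .
  qed
  have H_m: "H f \<in> borel_measurable M" if [measurable]: "f \<in> borel_measurable M" for f
    unfolding H_def by measurable
  have sm: "AE x in M. summable (\<lambda>n. cmod (t f n x))" if f: "f \<in> XS \<Omega>" for f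
  proof -
    have fm: "f \<in> borel_measurable M" and fin: "nrm f < \<infinity>" using f by (auto simp: X_sub_iff)
    have "\<rho> (H f) < \<infinity>" using \<rho>H[OF fm] fin by (auto simp: ennreal_mult_less_top intro: le_less_trans)
    then have "AE x in M. H f x < \<infinity>" by (rule AE_finite_of_rho_finite[OF H_m[OF fm]])
    then show ?thesis
      by (rule eventually_mono) (auto simp: H_def intro!: summable_suminf_not_top)
  qed
  have R_m: "R f \<in> borel_measurable M" if [measurable]: "f \<in> borel_measurable M" for f
    unfolding R_def by measurable
  have R_off: "x \<notin> \<Omega> \<Longrightarrow> R f x = 0" for f x by (simp add: R_def t_def)
  have nR: "nrm (R f) \<le> ennreal C * nrm f" if f: "f \<in> XS \<Omega>" for f
  proof -
    have fm [measurable]: "f \<in> borel_measurable M" using f by (simp add: X_sub_iff)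
    have "nrm (R f) \<le> \<rho> (H f)"
      unfolding nrm_def
    proof (rule rho_mono_AE)
      show "AE x in M. ennreal (cmod (R f x)) \<le> H f x"
        using sm[OF f]
      proof (rule eventually_mono)
        fix x assume s: "summable (\<lambda>n. cmod (t f n x))"
        then show "ennreal (cmod (R f x)) \<le> H f x"
          unfolding R_def H_def by (subst suminf_ennreal2) (auto intro!: ennreal_leI summable_norm)
      qed
    qed (use H_m[OF fm] R_m[OF fm] in auto)
    also have "\<dots> \<le> ennreal C * nrm f" by (rule \<rho>H[OF fm])
    finally show ?thesis .
  qed
  show ?thesis
  proof (rule that[of R])
    show "bounded_linear_on_X M \<rho> \<Omega> R"
    proof (rule bounded_linear_on_XI[where C = C])
      fix f h c assume f: "f \<in> XS \<Omega>" and h: "h \<in> XS \<Omega>"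
      show "AE x in M. R (\<lambda>y. f y + c * h y) x = R f x + c * R h x"
        using sm[OF f] sm[OF h]
      proof eventually_elim
        fix x assume s: "summable (\<lambda>n. cmod (t f n x))" "summable (\<lambda>n. cmod (t h n x))"
        have "t (\<lambda>y. f y + c * h y) n x = t f n x + c * t h n x" for n
          by (simp add: t_def algebra_simps)
        then show "R (\<lambda>y. f y + c * h y) x = R f x + c * R h x"
          unfolding R_def using summable_norm_cancel[OF s(1)] summable_norm_cancel[OF s(2)]
          by (simp add: suminf_add[symmetric] suminf_mult summable_mult)
      qed
    qed (use R_m R_off nR C in \<open>auto simp: X_sub_iff\<close>)
    fix f assume f: "f \<in> XS \<Omega>"
    show "AE x in M. x \<in> \<Omega> \<longrightarrow> R f x - w x * R f (\<tau> x) = f x"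
    proof (rule eventually_mono[OF sm[OF f]], rule impI)
      fix x assume s: "summable (\<lambda>n. cmod (t f n x))" and x: "x \<in> \<Omega>"
      have s': "summable (\<lambda>n. t f n x)" using s by (rule summable_norm_cancel)
      then have "summable (\<lambda>n. t f (Suc n) x)" by (rule summable_Suc_iff[THEN iffD2])
      then have s2: "summable (\<lambda>n. w x * t f n (\<tau> x))" by (simp add: t_Suc x)
      have "(\<Sum>n. t f (Suc n) x) = w x * R f (\<tau> x)"
      \<comment> \<open>Summability is known at x, not at \<open>\<tau> x\<close>. It can be
        transferred to \<open>\<tau> x\<close> by dividing by \<open>w x\<close>; if that weight is
        0, both sides vanish.\<close>
      proof (cases "w x = 0")
        case False
        then have "summable (\<lambda>n. t f n (\<tau> x))" using s2 by (simp add: summable_cmult_iff)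
        then show ?thesis by (simp add: t_Suc x R_def suminf_mult)
      qed (simp add: t_Suc x)
      moreover have "R f x = t f 0 x + (\<Sum>n. t f (Suc n) x)"
        unfolding R_def using suminf_split_head[OF s'] by simp
      ultimately show "R f x - w x * R f (\<tau> x) = f x" by (simp add: t_def W_def x)
    qed
    fix h assume h: "\<And>x. x \<in> \<Omega> \<Longrightarrow> h x = f x - w x * f (\<tau> x)"
    have off: "AE x in M. x \<notin> \<Omega> \<longrightarrow> f x = 0" using f by (simp add: X_sub_iff)
    show "AE x in M. R h x = f x"
      using sm[OF f] off
    proof eventually_elim
      fix x assume s: "summable (\<lambda>n. cmod (t f n x))" and o: "x \<notin> \<Omega> \<longrightarrow> f x = 0"
      show "R h x = f x"
      proof (cases "x \<in> \<Omega>")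
        case True
        have "t h n x = t f n x - t f (Suc n) x" for n
          using pow\<Omega>[OF True, of n] by (simp add: t_def W_def h algebra_simps)
        \<comment> \<open>The series for h telescopes, and its remainder tends to 0 because the
          terms for f are summable.\<close>
        then have "(\<lambda>n. t h n x) sums (t f 0 x - 0)"
          using telescope_sums'[OF summable_LIMSEQ_zero[OF summable_norm_cancel[OF s]]] by simp
        then show ?thesis using True by (simp add: R_def sums_unique[symmetric] t_def W_def)
      qed (use o R_off in auto)
    qed
  qed
qed

end

section \<open>Invertibility on invariant sets\<close>

lemma (in ri_norm) X_sub_mono: "f \<in> XS \<Omega>' \<Longrightarrow> \<Omega>' \<subseteq> \<Omega> \<Longrightarrow> f \<in> XS \<Omega>"
  by (auto simp: X_sub_iff elim!: eventually_mono)

lemma (in ri_norm) X_sub_indicator: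
  assumes "f \<in> XS \<Omega>" "\<Omega>' \<in> sets M"
  shows "(\<lambda>x. indicator \<Omega>' x * f x) \<in> XS \<Omega>'"
    and "nrm (\<lambda>x. indicator \<Omega>' x * f x) \<le> nrm f"
proof -
  have [measurable]: "f \<in> borel_measurable M" "\<Omega>' \<in> sets M" using assms by (auto simp: X_sub_iff)
  show 1: "nrm (\<lambda>x. indicator \<Omega>' x * f x) \<le> nrm f"
    by (rule nrm_mono_AE) (auto simp: norm_mult indicator_def)
  show "(\<lambda>x. indicator \<Omega>' x * f x) \<in> XS \<Omega>'"
    using assms(1) le_less_trans[OF 1] by (auto simp: X_sub_iff)
qed

locale shift_space = ri_norm M \<rho> for M :: "'a measure" and \<rho> +
  fixes G :: "'a set" and T S :: "'a \<Rightarrow> 'a" and d :: "'a \<Rightarrow> real" and a b :: "'a \<Rightarrow> complex"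
  assumes G [measurable]: "G \<in> sets M" and null_G: "emeasure M (- G) = 0"
    and T [measurable]: "T \<in> measurable M M" and S [measurable]: "S \<in> measurable M M"
    and TS [simp]: "T (S x) = x" and ST [simp]: "S (T x) = x" and TG [simp]: "T x \<in> G \<longleftrightarrow> x \<in> G"
    and a [measurable]: "a \<in> borel_measurable M" and b [measurable]: "b \<in> borel_measurable M"
    and ab_bound: "\<exists>B. \<forall>x\<in>G. cmod (a x) \<le> B \<and> cmod (b x) \<le> B"
    and d_bound: "\<exists>\<kappa>\<ge>1. \<forall>x\<in>G. d x \<le> \<kappa> \<and> 1 \<le> \<kappa> * d x"
    and emeasure_up: "\<And>E \<kappa>. E \<in> sets M \<Longrightarrow> E \<subseteq> G \<Longrightarrow> \<kappa> \<ge> 0 \<Longrightarrow> (\<And>x. x \<in> E \<Longrightarrow> d x \<le> \<kappa>) \<Longrightarrow>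
           emeasure M (S -` E) \<le> ennreal \<kappa> * emeasure M E"
    and emeasure_low: "\<And>E \<kappa>. E \<in> sets M \<Longrightarrow> E \<subseteq> G \<Longrightarrow> \<kappa> \<ge> 0 \<Longrightarrow> (\<And>x. x \<in> E \<Longrightarrow> 1 \<le> \<kappa> * d x) \<Longrightarrow>
           emeasure M E \<le> ennreal \<kappa> * emeasure M (S -` E)"
begin

definition op :: "('a \<Rightarrow> complex) \<Rightarrow> 'a \<Rightarrow> complex" where
  "op f = (\<lambda>x. if x \<in> G then a x * f x - b x * f (T x) else 0)"

abbreviation right_inv :: "'a set \<Rightarrow> bool" where
  "right_inv \<Omega> \<equiv> right_invertible_in M \<rho> \<Omega> op"

abbreviation left_inv :: "'a set \<Rightarrow> bool" where
  "left_inv \<Omega> \<equiv> left_invertible_in M \<rho> \<Omega> op"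

definition inv_set :: "'a set \<Rightarrow> bool" where
  "inv_set \<Omega> \<longleftrightarrow> \<Omega> \<in> sets M \<and> \<Omega> \<subseteq> G \<and> (\<forall>x. T x \<in> \<Omega> \<longleftrightarrow> x \<in> \<Omega>)"

lemma inv_setD:
  assumes "inv_set \<Omega>"
  shows "\<Omega> \<in> sets M" "\<Omega> \<subseteq> G" "T x \<in> \<Omega> \<longleftrightarrow> x \<in> \<Omega>" "S x \<in> \<Omega> \<longleftrightarrow> x \<in> \<Omega>"
proof -
  show "\<Omega> \<in> sets M" "\<Omega> \<subseteq> G" and T\<Omega>: "T x \<in> \<Omega> \<longleftrightarrow> x \<in> \<Omega>" for x
    using assms by (simp_all add: inv_set_def)
  show "S x \<in> \<Omega> \<longleftrightarrow> x \<in> \<Omega>" using T\<Omega>[of "S x"] by simp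
qed

lemma SG [simp]: "S x \<in> G \<longleftrightarrow> x \<in> G"
  using TG[of "S x"] by simp

lemma T_pow_G [simp]: "(T ^^ n) x \<in> G \<longleftrightarrow> x \<in> G"
  by (induction n) auto

lemma S_pow_G [simp]: "(S ^^ n) x \<in> G \<longleftrightarrow> x \<in> G"
  by (induction n) auto

lemma T_pow_S_pow [simp]: "(T ^^ n) ((S ^^ n) x) = x"
  by (induction n arbitrary: x) (simp_all add: funpow_swap1)

lemma S_pow_T_pow [simp]: "(S ^^ n) ((T ^^ n) x) = x"
  by (induction n arbitrary: x) (simp_all add: funpow_swap1)

lemma T_pow_inv: "inv_set \<Omega> \<Longrightarrow> (T ^^ n) x \<in> \<Omega> \<longleftrightarrow> x \<in> \<Omega>"
  by (induction n) (auto simp: inv_setD)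

lemma S_pow_inv: "inv_set \<Omega> \<Longrightarrow> (S ^^ n) x \<in> \<Omega> \<longleftrightarrow> x \<in> \<Omega>"
  by (induction n) (auto simp: inv_setD)

lemma T_pow_measurable [measurable]: "(T ^^ n) \<in> measurable M M"
  by (rule measurable_compose_n) (rule T)

lemma S_pow_measurable [measurable]: "(S ^^ n) \<in> measurable M M"
  by (rule measurable_compose_n) (rule S)

lemma vimage_sets: "f \<in> measurable M M \<Longrightarrow> E \<in> sets M \<Longrightarrow> f -` E \<in> sets M"
  using measurable_sets[of f M M E] by simp

text \<open>One-step estimates are multiplied along the orbit. The derivative is controlled only at
  the first n orbit points of B, which is all that is available near a fixed point.\<close>

lemma emeasure_le_T_image:
  assumes B: "B \<in> sets M" "B \<subseteq> G" and \<kappa>: "\<kappa> \<ge> 0"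
    and d: "\<And>x j. x \<in> B \<Longrightarrow> j < n \<Longrightarrow> 1 \<le> \<kappa> * d ((T ^^ j) x)"
  shows "emeasure M B \<le> ennreal (\<kappa> ^ n) * emeasure M ((S ^^ n) -` B)"
  using d
proof (induction n)
  case 0 then show ?case by simp
next
  case (Suc n)
  let ?E = "(S ^^ n) -` B"
  have "emeasure M ?E \<le> ennreal \<kappa> * emeasure M (S -` ?E)"
  proof (rule emeasure_low)
    show "?E \<in> sets M" by (rule vimage_sets[OF S_pow_measurable B(1)])
    show "?E \<subseteq> G" using B(2) S_pow_G by blast
    fix x assume "x \<in> ?E"
    then show "1 \<le> \<kappa> * d x" using Suc.prems[of "(S ^^ n) x" n] by simp
  qed fact
  moreover have "S -` ?E = (S ^^ Suc n) -` B" by (auto simp: funpow_swap1)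
  ultimately have *: "emeasure M ?E \<le> ennreal \<kappa> * emeasure M ((S ^^ Suc n) -` B)" by simp
  have "emeasure M B \<le> ennreal (\<kappa> ^ n) * emeasure M ?E" using Suc by simp
  also have "\<dots> \<le> ennreal (\<kappa> ^ n) * (ennreal \<kappa> * emeasure M ((S ^^ Suc n) -` B))"
    by (rule mult_left_mono[OF *]) simp
  finally show ?case using \<kappa> by (simp add: ennreal_mult mult_ac del: funpow.simps)
qed

lemma emeasure_T_image_le:
  assumes B: "B \<in> sets M" "B \<subseteq> G" and \<kappa>: "\<kappa> \<ge> 0"
    and d: "\<And>x j. x \<in> B \<Longrightarrow> j < n \<Longrightarrow> d ((T ^^ j) x) \<le> \<kappa>"
  shows "emeasure M ((S ^^ n) -` B) \<le> ennreal (\<kappa> ^ n) * emeasure M B"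
  using d
proof (induction n)
  case 0 then show ?case by simp
next
  case (Suc n)
  let ?E = "(S ^^ n) -` B"
  have "emeasure M (S -` ?E) \<le> ennreal \<kappa> * emeasure M ?E"
  proof (rule emeasure_up)
    show "?E \<in> sets M" by (rule vimage_sets[OF S_pow_measurable B(1)])
    show "?E \<subseteq> G" using B(2) S_pow_G by blast
    fix x assume "x \<in> ?E"
    then show "d x \<le> \<kappa>" using Suc.prems[of "(S ^^ n) x" n] by simp
  qed fact
  moreover have "S -` ?E = (S ^^ Suc n) -` B" by (auto simp: funpow_swap1)
  ultimately have *: "emeasure M ((S ^^ Suc n) -` B) \<le> ennreal \<kappa> * emeasure M ?E" by simp
  also have "\<dots> \<le> ennreal \<kappa> * (ennreal (\<kappa> ^ n) * emeasure M B)"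
    by (rule mult_left_mono) (use Suc in simp_all)
  finally show ?case using \<kappa> by (simp add: ennreal_mult mult_ac del: funpow.simps)
qed

text \<open>The n-th image of the part of F that T^n sends into E lies inside E.\<close>

lemma emeasure_T_pow_vimage:
  assumes F: "F \<in> sets M" "F \<subseteq> G" and \<kappa>: "\<kappa> \<ge> 0"
    and d: "\<And>x j. x \<in> F \<Longrightarrow> j < n \<Longrightarrow> 1 \<le> \<kappa> * d ((T ^^ j) x)" and E: "E \<in> sets M"
  shows "emeasure M (F \<inter> (T ^^ n) -` E) \<le> ennreal (\<kappa> ^ n) * emeasure M E"
proof -
  let ?B = "F \<inter> (T ^^ n) -` E"
  have "emeasure M ?B \<le> ennreal (\<kappa> ^ n) * emeasure M ((S ^^ n) -` ?B)"
    by (rule emeasure_le_T_image) (use F \<kappa> d vimage_sets[OF T_pow_measurable E] in auto)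
  also have "\<dots> \<le> ennreal (\<kappa> ^ n) * emeasure M E"
    by (intro mult_left_mono emeasure_mono E) auto
  finally show ?thesis .
qed

lemma emeasure_S_pow_vimage:
  assumes F: "F \<in> sets M" "F \<subseteq> G" and \<kappa>: "\<kappa> \<ge> 0"
    and d: "\<And>x j. x \<in> F \<Longrightarrow> j < n \<Longrightarrow> d ((T ^^ j) ((S ^^ n) x)) \<le> \<kappa>" and E: "E \<in> sets M"
  shows "emeasure M (F \<inter> (S ^^ n) -` E) \<le> ennreal (\<kappa> ^ n) * emeasure M E"
proof -
  let ?B = "F \<inter> (S ^^ n) -` E"
  \<comment> \<open>This is S^n applied to \<open>?B\<close>; it lies in E, and T^n takes it back to
    \<open>?B\<close>.\<close>
  let ?E' = "(T ^^ n) -` ?B"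
  have B: "?B \<in> sets M" using F vimage_sets[OF S_pow_measurable E] by auto
  have "emeasure M ((S ^^ n) -` ?E') \<le> ennreal (\<kappa> ^ n) * emeasure M ?E'"
  proof (rule emeasure_T_image_le)
    show "?E' \<in> sets M" by (rule vimage_sets[OF T_pow_measurable B])
    show "?E' \<subseteq> G" using F T_pow_G by blast
    fix x j assume "x \<in> ?E'" "j < n"
    then show "d ((T ^^ j) x) \<le> \<kappa>" using d[of "(T ^^ n) x" j] by simp
  qed fact
  also have "\<dots> \<le> ennreal (\<kappa> ^ n) * emeasure M E"
    by (intro mult_left_mono emeasure_mono E) auto
  also have "(S ^^ n) -` ?E' = ?B" by auto
  finally show ?thesis .
qed

lemma global_bound:
  obtains \<kappa> where "\<kappa> \<ge> 1" "\<And>E. E \<in> sets M \<Longrightarrow> emeasure M (G \<inter> T -` E) \<le> ennreal \<kappa> * emeasure M E"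
    "\<And>E. E \<in> sets M \<Longrightarrow> emeasure M (G \<inter> S -` E) \<le> ennreal \<kappa> * emeasure M E"
proof -
  obtain \<kappa> where \<kappa>: "\<kappa> \<ge> 1" "\<And>x. x \<in> G \<Longrightarrow> d x \<le> \<kappa>" "\<And>x. x \<in> G \<Longrightarrow> 1 \<le> \<kappa> * d x"
    using d_bound by blast
  show ?thesis
    by (rule that[of \<kappa>])
      (use \<kappa> emeasure_T_pow_vimage[of G \<kappa> 1] emeasure_S_pow_vimage[of G \<kappa> 1] G in auto)
qed

lemma AE_G: "AE x in M. x \<in> G"
proof -
  have "- G \<in> null_sets M" using null_G sets.compl_sets[OF G] by (simp add: null_sets_def Compl_eq_Diff_UNIV)
  then show ?thesis by (rule AE_I') auto
qed

text \<open>Preimages of null sets are null. This makes composition compatible with the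
  identification of functions that agree almost everywhere.\<close>

lemma AE_comp:
  assumes f: "f \<in> measurable M M" and P: "AE x in M. P x"
    and le: "\<And>E. E \<in> sets M \<Longrightarrow> emeasure M (G \<inter> f -` E) \<le> ennreal \<kappa> * emeasure M E"
  shows "AE x in M. P (f x)"
proof -
  obtain N where N: "N \<in> null_sets M" "{x. \<not> P x} \<subseteq> N"
    using P by (auto simp: eventually_ae_filter)
  have "emeasure M (G \<inter> f -` N) = 0" using le[of N] N by (auto simp: null_sets_def)
  moreover have "G \<inter> f -` N \<in> sets M" using vimage_sets[OF f, of N] N by auto
  ultimately have "AE x in M. x \<notin> G \<inter> f -` N" by (intro AE_not_in) (simp add: null_sets_def)
  from AE_G this show ?thesis by eventually_elim (use N(2) in auto)
qed

lemma AE_T: "AE x in M. P x \<Longrightarrow> AE x in M. P (T x)"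
  by (rule global_bound) (rule AE_comp[OF T])

lemma AE_T_pow: "AE x in M. P x \<Longrightarrow> AE x in M. P ((T ^^ n) x)"
proof (induction n)
  case (Suc n)
  from AE_T[OF Suc.IH[OF Suc.prems]] show ?case by (simp add: funpow_swap1)
qed simp

lemma nrm_comp_le:
  assumes [measurable]: "\<tau> \<in> measurable M M" "F \<in> sets M" "f \<in> borel_measurable M"
    and le: "\<And>E. E \<in> sets M \<Longrightarrow> emeasure M (F \<inter> \<tau> -` E) \<le> ennreal \<kappa> * emeasure M E" and \<kappa>: "\<kappa> \<ge> 0"
  shows "nrm (\<lambda>x. indicator F x * f (\<tau> x)) \<le> of_nat (nat \<lceil>\<kappa>\<rceil>) * nrm f"
proof -
  have "nrm (\<lambda>x. indicator F x * f (\<tau> x)) = \<rho> (\<lambda>x. indicator F x * ennreal (cmod (f (\<tau> x))))"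
    unfolding nrm_def by (rule arg_cong[of _ _ \<rho>]) (auto simp: indicator_def)
  also have "\<dots> \<le> of_nat (nat \<lceil>\<kappa>\<rceil>) * \<rho> (\<lambda>x. ennreal (cmod (f x)))"
  proof (rule rho_comp_le)
    fix E assume E: "E \<in> sets M"
    show "emeasure M (F \<inter> \<tau> -` E) \<le> of_nat (nat \<lceil>\<kappa>\<rceil>) * emeasure M E"
      using le[OF E] ennreal_of_nat_ceiling_le[OF \<kappa>] by (meson mult_right_mono order_trans zero_le)
  qed auto
  finally show ?thesis by (simp add: nrm_def)
qed

lemma op_measurable:
  assumes [measurable]: "f \<in> borel_measurable M"
  shows "op f \<in> borel_measurable M"
  unfolding op_def by measurable

lemma op_X_sub:
  assumes f: "f \<in> XS \<Omega>" and \<Omega>: "inv_set \<Omega>"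
  shows "op f \<in> XS \<Omega>"
proof -
  obtain \<kappa> where \<kappa>: "\<kappa> \<ge> 1" "\<And>E. E \<in> sets M \<Longrightarrow> emeasure M (G \<inter> T -` E) \<le> ennreal \<kappa> * emeasure M E"
    using global_bound by metis
  obtain B where B: "\<And>x. x \<in> G \<Longrightarrow> cmod (a x) \<le> B" "\<And>x. x \<in> G \<Longrightarrow> cmod (b x) \<le> B"
    using ab_bound by blast
  have fm [measurable]: "f \<in> borel_measurable M" and fin: "nrm f < \<infinity>" using f by (auto simp: X_sub_iff)
  let ?B = "max B 0"
  have 1: "nrm (\<lambda>x. indicator G x * f (T x)) \<le> of_nat (nat \<lceil>\<kappa>\<rceil>) * nrm f"
    by (rule nrm_comp_le) (use \<kappa> in auto)
  have "op f = (\<lambda>x. indicator G x * a x * f x + (- indicator G x * b x * f (T x)))"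
    by (auto simp: op_def indicator_def)
  then have "nrm (op f) \<le> nrm (\<lambda>x. indicator G x * a x * f x) + nrm (\<lambda>x. - indicator G x * b x * f (T x))"
    using nrm_add[of "\<lambda>x. indicator G x * a x * f x" "\<lambda>x. - indicator G x * b x * f (T x)"] by simp
  also have "\<dots> \<le> ennreal ?B * nrm f + ennreal ?B * nrm (\<lambda>x. indicator G x * f (T x))"
    by (intro add_mono nrm_le_cmult)
      (auto simp: norm_mult indicator_def B intro!: mult_right_mono max.coboundedI1)
  also have "\<dots> \<le> ennreal ?B * nrm f + ennreal ?B * (of_nat (nat \<lceil>\<kappa>\<rceil>) * nrm f)"
    by (intro add_left_mono mult_left_mono 1) simp
  also have "\<dots> < \<infinity>" using fin by (simp add: ennreal_mult_less_top of_nat_less_top)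
  finally have "nrm (op f) < \<infinity>" .
  moreover have "AE x in M. x \<notin> \<Omega> \<longrightarrow> op f x = 0"
  proof -
    have "AE x in M. x \<notin> \<Omega> \<longrightarrow> f x = 0" using f by (simp add: X_sub_iff)
    with AE_T[OF this] show ?thesis
      by eventually_elim (simp add: op_def inv_setD[OF \<Omega>])
  qed
  ultimately show ?thesis using op_measurable[OF fm] by (simp add: X_sub_iff)
qed

section \<open>Restriction to invariant sets and gluing\<close>

lemma bounded_linear_on_X_restrict:
  assumes R: "bounded_linear_on_X M \<rho> \<Omega> R" and \<Omega>' [measurable]: "\<Omega>' \<in> sets M" and le: "\<Omega>' \<subseteq> \<Omega>"
  shows "bounded_linear_on_X M \<rho> \<Omega>' (\<lambda>f x. indicator \<Omega>' x * R f x)"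
proof -
  obtain C where C: "C > 0" "\<And>f. f \<in> XS \<Omega> \<Longrightarrow> nrm (R f) \<le> ennreal C * nrm f"
    using bounded_linear_on_X_bound[OF R] by blast
  note RX = bounded_linear_on_XD(1)[OF R X_sub_mono[OF _ le]]
  show ?thesis
  proof (rule bounded_linear_on_XI[where C = C])
    fix f assume f: "f \<in> XS \<Omega>'"
    show "(\<lambda>x. indicator \<Omega>' x * R f x) \<in> borel_measurable M" using RX[OF f] by (auto simp: X_sub_iff)
    show "AE x in M. x \<notin> \<Omega>' \<longrightarrow> indicator \<Omega>' x * R f x = 0" by simp
    show "nrm (\<lambda>x. indicator \<Omega>' x * R f x) \<le> ennreal C * nrm f"
      using X_sub_indicator(2)[OF RX[OF f] \<Omega>'] C(2)[OF X_sub_mono[OF f le]] by (rule order_trans)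
  next
    fix f h c assume "f \<in> XS \<Omega>'" "h \<in> XS \<Omega>'"
    from bounded_linear_on_XD(2)[OF R X_sub_mono[OF this(1) le] X_sub_mono[OF this(2) le], of c]
    show "AE x in M. indicator \<Omega>' x * R (\<lambda>y. f y + c * h y) x
        = indicator \<Omega>' x * R f x + c * (indicator \<Omega>' x * R h x)"
      by (rule eventually_mono) (simp add: algebra_simps)
  qed (use C in auto)
qed

text \<open>Multiplication by the indicator of an invariant set commutes with the operator, so the
  compression of a right inverse is again a right inverse.\<close>

lemma right_invertible_restrict:
  assumes "right_inv \<Omega>" and \<Omega>': "inv_set \<Omega>'" "\<Omega>' \<subseteq> \<Omega>"
  shows "right_inv \<Omega>'"
proof -
  obtain R where R: "bounded_linear_on_X M \<rho> \<Omega> R" "\<And>f. f \<in> XS \<Omega> \<Longrightarrow> AE x in M. op (R f) x = f x"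
    using assms(1) unfolding right_invertible_in_def by blast
  have "AE x in M. op (\<lambda>x. indicator \<Omega>' x * R f x) x = f x" if f: "f \<in> XS \<Omega>'" for f
  proof -
    have "AE x in M. x \<notin> \<Omega>' \<longrightarrow> f x = 0" using f by (simp add: X_sub_iff)
    with R(2)[OF X_sub_mono[OF f \<Omega>'(2)]] show ?thesis
      by eventually_elim (auto simp: op_def indicator_def inv_setD(3)[OF \<Omega>'(1)] split: if_splits)
  qed
  then show ?thesis unfolding right_invertible_in_def
    using bounded_linear_on_X_restrict[OF R(1) inv_setD(1)[OF \<Omega>'(1)] \<Omega>'(2)] by blast
qed

lemma left_invertible_restrict:
  assumes "left_inv \<Omega>" and \<Omega>': "inv_set \<Omega>'" "\<Omega>' \<subseteq> \<Omega>"
  shows "left_inv \<Omega>'"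
proof -
  obtain R where R: "bounded_linear_on_X M \<rho> \<Omega> R" "\<And>f. f \<in> XS \<Omega> \<Longrightarrow> AE x in M. R (op f) x = f x"
    using assms(1) unfolding left_invertible_in_def by blast
  have "AE x in M. indicator \<Omega>' x * R (op f) x = f x" if f: "f \<in> XS \<Omega>'" for f
  proof -
    have "AE x in M. x \<notin> \<Omega>' \<longrightarrow> f x = 0" using f by (simp add: X_sub_iff)
    with R(2)[OF X_sub_mono[OF f \<Omega>'(2)]] show ?thesis
      by eventually_elim (auto simp: indicator_def)
  qed
  then show ?thesis unfolding left_invertible_in_def
    using bounded_linear_on_X_restrict[OF R(1) inv_setD(1)[OF \<Omega>'(1)] \<Omega>'(2)] by blast
qed

text \<open>The block-diagonal operator: each block sees and changes only the part of f on its own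
  set.\<close>

lemma bounded_linear_on_X_glue:
  assumes R1: "bounded_linear_on_X M \<rho> \<Omega>1 R1" and R2: "bounded_linear_on_X M \<rho> \<Omega>2 R2"
    and m [measurable]: "\<Omega>1 \<in> sets M" "\<Omega>2 \<in> sets M"
  shows "bounded_linear_on_X M \<rho> (\<Omega>1 \<union> \<Omega>2)
     (\<lambda>f x. indicator \<Omega>1 x * R1 (\<lambda>y. indicator \<Omega>1 y * f y) x
          + indicator \<Omega>2 x * R2 (\<lambda>y. indicator \<Omega>2 y * f y) x)"
proof -
  have piece: "AE x in M. indicator \<Omega> x * R (\<lambda>y. indicator \<Omega> y * (f y + c * h y)) x =
        indicator \<Omega> x * R (\<lambda>y. indicator \<Omega> y * f y) x + c * (indicator \<Omega> x * R (\<lambda>y. indicator \<Omega> y * h y) x)"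
    if "f \<in> XS \<Omega>'" "h \<in> XS \<Omega>'" "bounded_linear_on_X M \<rho> \<Omega> R" "\<Omega> \<in> sets M"
    for f h c R \<Omega> \<Omega>'
  proof -
    have "AE x in M. R (\<lambda>y. indicator \<Omega> y * f y + c * (indicator \<Omega> y * h y)) x =
        R (\<lambda>y. indicator \<Omega> y * f y) x + c * R (\<lambda>y. indicator \<Omega> y * h y) x"
      by (rule bounded_linear_on_XD(2)[OF that(3) X_sub_indicator(1)[OF that(1,4)]
            X_sub_indicator(1)[OF that(2,4)]])
    moreover have "(\<lambda>y. indicator \<Omega> y * (f y + c * h y)) = (\<lambda>y. indicator \<Omega> y * f y + c * (indicator \<Omega> y * h y))"
      by (simp add: algebra_simps)
    ultimately show ?thesis by (auto elim!: eventually_mono simp: indicator_def)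
  qed
  obtain C1 where C1: "C1 > 0" "\<And>f. f \<in> XS \<Omega>1 \<Longrightarrow> nrm (R1 f) \<le> ennreal C1 * nrm f"
    using bounded_linear_on_X_bound[OF R1] by blast
  obtain C2 where C2: "C2 > 0" "\<And>f. f \<in> XS \<Omega>2 \<Longrightarrow> nrm (R2 f) \<le> ennreal C2 * nrm f"
    using bounded_linear_on_X_bound[OF R2] by blast
  note X1 = bounded_linear_on_XD(1)[OF R1] and X2 = bounded_linear_on_XD(1)[OF R2]
  show ?thesis
  proof (rule bounded_linear_on_XI[where C = "C1 + C2"])
    fix f assume f: "f \<in> XS (\<Omega>1 \<union> \<Omega>2)"
    let ?f1 = "\<lambda>y. indicator \<Omega>1 y * f y" and ?f2 = "\<lambda>y. indicator \<Omega>2 y * f y"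
    note f1 = X_sub_indicator[OF f m(1)] and f2 = X_sub_indicator[OF f m(2)]
    have [measurable]: "R1 ?f1 \<in> borel_measurable M" "R2 ?f2 \<in> borel_measurable M"
      using X1[OF f1(1)] X2[OF f2(1)] by (auto simp: X_sub_iff)
    show "(\<lambda>x. indicator \<Omega>1 x * R1 ?f1 x + indicator \<Omega>2 x * R2 ?f2 x) \<in> borel_measurable M"
      by measurable
    have "nrm (\<lambda>x. indicator \<Omega>1 x * R1 ?f1 x + indicator \<Omega>2 x * R2 ?f2 x)
        \<le> nrm (\<lambda>x. indicator \<Omega>1 x * R1 ?f1 x) + nrm (\<lambda>x. indicator \<Omega>2 x * R2 ?f2 x)"
      by (rule nrm_add) auto
    also have "\<dots> \<le> nrm (R1 ?f1) + nrm (R2 ?f2)"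
      by (intro add_mono X_sub_indicator(2)[OF X1[OF f1(1)] m(1)] X_sub_indicator(2)[OF X2[OF f2(1)] m(2)])
    also have "\<dots> \<le> ennreal C1 * nrm ?f1 + ennreal C2 * nrm ?f2"
      by (intro add_mono C1(2) C2(2) f1(1) f2(1))
    also have "\<dots> \<le> ennreal C1 * nrm f + ennreal C2 * nrm f"
      by (intro add_mono mult_left_mono f1(2) f2(2)) auto
    also have "\<dots> = ennreal (C1 + C2) * nrm f"
      using C1 C2 by (simp add: ennreal_plus distrib_right)
    finally show "nrm (\<lambda>x. indicator \<Omega>1 x * R1 ?f1 x + indicator \<Omega>2 x * R2 ?f2 x) \<le> ennreal (C1 + C2) * nrm f" .
  next
    fix f h c assume f: "f \<in> XS (\<Omega>1 \<union> \<Omega>2)" and h: "h \<in> XS (\<Omega>1 \<union> \<Omega>2)"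
    show "AE x in M. indicator \<Omega>1 x * R1 (\<lambda>y. indicator \<Omega>1 y * (f y + c * h y)) x
          + indicator \<Omega>2 x * R2 (\<lambda>y. indicator \<Omega>2 y * (f y + c * h y)) x =
        indicator \<Omega>1 x * R1 (\<lambda>y. indicator \<Omega>1 y * f y) x + indicator \<Omega>2 x * R2 (\<lambda>y. indicator \<Omega>2 y * f y) x +
        c * (indicator \<Omega>1 x * R1 (\<lambda>y. indicator \<Omega>1 y * h y) x + indicator \<Omega>2 x * R2 (\<lambda>y. indicator \<Omega>2 y * h y) x)"
      using piece[OF f h R1 m(1), of c] piece[OF f h R2 m(2), of c]
      by eventually_elim (simp add: algebra_simps)
  qed (use C1 C2 in auto)
qed

lemma right_invertible_union:
  assumes 1: "right_inv \<Omega>1" "inv_set \<Omega>1"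
    and 2: "right_inv \<Omega>2" "inv_set \<Omega>2" and disj: "\<Omega>1 \<inter> \<Omega>2 = {}"
  shows "right_inv (\<Omega>1 \<union> \<Omega>2)"
proof -
  obtain R1 where R1: "bounded_linear_on_X M \<rho> \<Omega>1 R1" "\<And>f. f \<in> XS \<Omega>1 \<Longrightarrow> AE x in M. op (R1 f) x = f x"
    using 1(1) unfolding right_invertible_in_def by blast
  obtain R2 where R2: "bounded_linear_on_X M \<rho> \<Omega>2 R2" "\<And>f. f \<in> XS \<Omega>2 \<Longrightarrow> AE x in M. op (R2 f) x = f x"
    using 2(1) unfolding right_invertible_in_def by blast
  note m = inv_setD(1)[OF 1(2)] inv_setD(1)[OF 2(2)]
  show ?thesis unfolding right_invertible_in_def
  proof (intro exI conjI ballI)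
    show "bounded_linear_on_X M \<rho> (\<Omega>1 \<union> \<Omega>2)
     (\<lambda>f x. indicator \<Omega>1 x * R1 (\<lambda>y. indicator \<Omega>1 y * f y) x
          + indicator \<Omega>2 x * R2 (\<lambda>y. indicator \<Omega>2 y * f y) x)"
      by (rule bounded_linear_on_X_glue[OF R1(1) R2(1) m])
    fix f assume f: "f \<in> XS (\<Omega>1 \<union> \<Omega>2)"
    have off: "AE x in M. x \<notin> \<Omega>1 \<union> \<Omega>2 \<longrightarrow> f x = 0" using f by (simp add: X_sub_iff)
    show "AE x in M. op (\<lambda>x. indicator \<Omega>1 x * R1 (\<lambda>y. indicator \<Omega>1 y * f y) x
          + indicator \<Omega>2 x * R2 (\<lambda>y. indicator \<Omega>2 y * f y) x) x = f x"
      using R1(2)[OF X_sub_indicator(1)[OF f m(1)]] R2(2)[OF X_sub_indicator(1)[OF f m(2)]] off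
    proof eventually_elim
      case (elim x)
      consider "x \<in> \<Omega>1" "x \<notin> \<Omega>2" | "x \<in> \<Omega>2" "x \<notin> \<Omega>1" | "x \<notin> \<Omega>1" "x \<notin> \<Omega>2" using disj by blast
      then show ?case
        using elim inv_setD(2)[OF 1(2)] inv_setD(2)[OF 2(2)]
        by cases (auto simp: op_def inv_setD(3)[OF 1(2)] inv_setD(3)[OF 2(2)] split: if_splits)
    qed
  qed
qed

lemma op_indicator:
  assumes "inv_set \<Omega>"
  shows "(\<lambda>x. indicator \<Omega> x * op f x) = op (\<lambda>x. indicator \<Omega> x * f x)"
  by (rule ext) (auto simp: op_def indicator_def inv_setD(3)[OF assms])

lemma left_invertible_union:
  assumes 1: "left_inv \<Omega>1" "inv_set \<Omega>1"
    and 2: "left_inv \<Omega>2" "inv_set \<Omega>2" and disj: "\<Omega>1 \<inter> \<Omega>2 = {}"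
  shows "left_inv (\<Omega>1 \<union> \<Omega>2)"
proof -
  obtain R1 where R1: "bounded_linear_on_X M \<rho> \<Omega>1 R1" "\<And>f. f \<in> XS \<Omega>1 \<Longrightarrow> AE x in M. R1 (op f) x = f x"
    using 1(1) unfolding left_invertible_in_def by blast
  obtain R2 where R2: "bounded_linear_on_X M \<rho> \<Omega>2 R2" "\<And>f. f \<in> XS \<Omega>2 \<Longrightarrow> AE x in M. R2 (op f) x = f x"
    using 2(1) unfolding left_invertible_in_def by blast
  note m = inv_setD(1)[OF 1(2)] inv_setD(1)[OF 2(2)]
  show ?thesis unfolding left_invertible_in_def
  proof (intro exI conjI ballI)
    show "bounded_linear_on_X M \<rho> (\<Omega>1 \<union> \<Omega>2)
     (\<lambda>f x. indicator \<Omega>1 x * R1 (\<lambda>y. indicator \<Omega>1 y * f y) x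
          + indicator \<Omega>2 x * R2 (\<lambda>y. indicator \<Omega>2 y * f y) x)"
      by (rule bounded_linear_on_X_glue[OF R1(1) R2(1) m])
    fix f assume f: "f \<in> XS (\<Omega>1 \<union> \<Omega>2)"
    have off: "AE x in M. x \<notin> \<Omega>1 \<union> \<Omega>2 \<longrightarrow> f x = 0" using f by (simp add: X_sub_iff)
    show "AE x in M. indicator \<Omega>1 x * R1 (\<lambda>y. indicator \<Omega>1 y * op f y) x
          + indicator \<Omega>2 x * R2 (\<lambda>y. indicator \<Omega>2 y * op f y) x = f x"
      using R1(2)[OF X_sub_indicator(1)[OF f m(1)]] R2(2)[OF X_sub_indicator(1)[OF f m(2)]] off
      unfolding op_indicator[OF 1(2)] op_indicator[OF 2(2)]
    proof eventually_elim
      case (elim x)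
      consider "x \<in> \<Omega>1" "x \<notin> \<Omega>2" | "x \<in> \<Omega>2" "x \<notin> \<Omega>1" | "x \<notin> \<Omega>1" "x \<notin> \<Omega>2" using disj by blast
      then show ?case using elim by cases auto
    qed
  qed
qed

lemma invertible_empty: "right_inv {}" "left_inv {}"
proof -
  have b: "bounded_linear_on_X M \<rho> {} (\<lambda>f x. 0)"
    by (rule bounded_linear_on_XI[where C = 0]) (auto simp: nrm_def rho_zero)
  have "AE x in M. f x = 0" if "f \<in> XS {}" for f using that by (simp add: X_sub_iff)
  then have "AE x in M. 0 = f x" if "f \<in> XS {}" for f
    using that by (auto elim!: eventually_mono)
  moreover have "op (\<lambda>x. 0) = (\<lambda>x. 0)" by (rule ext) (simp add: op_def)
  ultimately show "right_inv {}" "left_inv {}"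
    unfolding right_invertible_in_def left_invertible_in_def using b
    by (auto intro!: exI[of _ "\<lambda>f x. 0"])
qed

lemma inv_set_Union: "finite I \<Longrightarrow> (\<And>\<Omega>. \<Omega> \<in> I \<Longrightarrow> inv_set \<Omega>) \<Longrightarrow> inv_set (\<Union>I)"
  by (auto simp: inv_set_def)

lemma invertible_Union:
  assumes "finite I" "\<And>\<Omega>. \<Omega> \<in> I \<Longrightarrow> inv_set \<Omega>" "pairwise disjnt I"
  shows "(\<And>\<Omega>. \<Omega> \<in> I \<Longrightarrow> right_inv \<Omega>) \<Longrightarrow> right_inv (\<Union>I)"
    and "(\<And>\<Omega>. \<Omega> \<in> I \<Longrightarrow> left_inv \<Omega>) \<Longrightarrow> left_inv (\<Union>I)"
proof -
  have "((\<forall>\<Omega>\<in>I. right_inv \<Omega>) \<longrightarrow> right_inv (\<Union>I)) \<and>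
        ((\<forall>\<Omega>\<in>I. left_inv \<Omega>) \<longrightarrow> left_inv (\<Union>I))"
    using assms
  proof (induction I rule: finite_induct)
    case empty then show ?case by (simp add: invertible_empty)
  next
    case (insert \<Omega> I)
    have d: "\<Omega> \<inter> \<Union>I = {}"
      using insert by (auto simp: pairwise_insert disjnt_def)
    have i: "inv_set \<Omega>" "inv_set (\<Union>I)" using insert by (auto intro: inv_set_Union)
    have p: "pairwise disjnt I" using insert by (simp add: pairwise_insert)
    have IH: "((\<forall>\<Omega>\<in>I. right_inv \<Omega>) \<longrightarrow> right_inv (\<Union>I))"
       "((\<forall>\<Omega>\<in>I. left_inv \<Omega>) \<longrightarrow> left_inv (\<Union>I))"
      using insert.IH insert.prems(1) p by auto
    show ?case
      using IH right_invertible_union[OF _ i(1) _ i(2) d] left_invertible_union[OF _ i(1) _ i(2) d]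
      by auto
  qed
  then show "(\<And>\<Omega>. \<Omega> \<in> I \<Longrightarrow> right_inv \<Omega>) \<Longrightarrow> right_inv (\<Union>I)"
    and "(\<And>\<Omega>. \<Omega> \<in> I \<Longrightarrow> left_inv \<Omega>) \<Longrightarrow> left_inv (\<Union>I)"
    by blast+
qed

end

section \<open>Two-sided inverses by Neumann series\<close>

lemma (in ri_norm) bounded_linear_on_X_comp:
  assumes R: "bounded_linear_on_X M \<rho> \<Omega> R"
    and L: "\<And>f. f \<in> XS \<Omega> \<Longrightarrow> L f \<in> borel_measurable M"
      "\<And>f x. f \<in> XS \<Omega> \<Longrightarrow> x \<notin> \<Omega> \<Longrightarrow> L f x = 0"
      "\<And>f. f \<in> XS \<Omega> \<Longrightarrow> nrm (L f) \<le> ennreal K * nrm f"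
    and lin: "\<And>f h c. L (\<lambda>y. f y + c * h y) = (\<lambda>y. L f y + c * L h y)" and K: "K \<ge> 0"
  shows "bounded_linear_on_X M \<rho> \<Omega> (\<lambda>f. R (L f))" "\<And>f. f \<in> XS \<Omega> \<Longrightarrow> L f \<in> XS \<Omega>"
proof -
  show LX: "L f \<in> XS \<Omega>" if f: "f \<in> XS \<Omega>" for f
    using L[OF f] f le_less_trans[OF L(3)[OF f], of \<infinity>]
    by (auto simp: X_sub_iff ennreal_mult_less_top)
  obtain C where C: "C > 0" "\<And>f. f \<in> XS \<Omega> \<Longrightarrow> nrm (R f) \<le> ennreal C * nrm f"
    using bounded_linear_on_X_bound[OF R] by blast
  show "bounded_linear_on_X M \<rho> \<Omega> (\<lambda>f. R (L f))"
  proof (rule bounded_linear_on_XI[where C = "C * K"])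
    fix f assume f: "f \<in> XS \<Omega>"
    note RL = bounded_linear_on_XD(1)[OF R LX[OF f]]
    show "R (L f) \<in> borel_measurable M" "AE x in M. x \<notin> \<Omega> \<longrightarrow> R (L f) x = 0"
      using RL by (auto simp: X_sub_iff)
    have "nrm (R (L f)) \<le> ennreal C * nrm (L f)" by (rule C(2)[OF LX[OF f]])
    also have "\<dots> \<le> ennreal C * (ennreal K * nrm f)" by (rule mult_left_mono[OF L(3)[OF f]]) simp
    also have "\<dots> = ennreal (C * K) * nrm f" using C K by (simp add: ennreal_mult mult.assoc)
    finally show "nrm (R (L f)) \<le> ennreal (C * K) * nrm f" .
  next
    fix f h c assume "f \<in> XS \<Omega>" "h \<in> XS \<Omega>"
    then show "AE x in M. R (L (\<lambda>y. f y + c * h y)) x = R (L f) x + c * R (L h) x"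
      unfolding lin by (intro bounded_linear_on_XD(2)[OF R] LX)
  qed (use C K in auto)
qed

context shift_space
begin

text \<open>Common frame for the two dominant cases: the operator is an invertible factor times I -
  U, with U the weighted composition by w and \<tau>, and L inverts the factor. Then R after L
  inverts on both sides; \<open>factor\<close> is used for the left inverse and \<open>solve\<close>
  for the right one.\<close>

lemma invertible_of_neumann:
  fixes w :: "'a \<Rightarrow> complex"
  assumes \<Omega>: "inv_set \<Omega>" and \<tau>: "\<tau> \<in> measurable M M" "w \<in> borel_measurable M" "\<And>x. x \<in> \<Omega> \<Longrightarrow> \<tau> x \<in> \<Omega>"
    and q: "0 \<le> q" "\<And>x. x \<in> \<Omega> \<Longrightarrow> cmod (w x) \<le> q" and \<kappa>: "1 \<le> \<kappa>" "q * \<kappa> < 1"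
    and meas: "\<And>n E. E \<in> sets M \<Longrightarrow> emeasure M (\<Omega> \<inter> (\<tau> ^^ n) -` E) \<le> ennreal (\<kappa> ^ n) * emeasure M E"
    and L: "\<And>f. f \<in> borel_measurable M \<Longrightarrow> L f \<in> borel_measurable M" "\<And>f x. x \<notin> \<Omega> \<Longrightarrow> L f x = 0"
      "\<And>f. f \<in> XS \<Omega> \<Longrightarrow> nrm (L f) \<le> ennreal K * nrm f" "K \<ge> 0"
      "\<And>f h c. L (\<lambda>y. f y + c * h y) = (\<lambda>y. L f y + c * L h y)"
    and factor: "\<And>f x. x \<in> \<Omega> \<Longrightarrow> L (op f) x = f x - w x * f (\<tau> x)"
    and solve: "\<And>v f. AE x in M. x \<in> \<Omega> \<longrightarrow> v x - w x * v (\<tau> x) = L f x \<Longrightarrow> AE x in M. x \<in> \<Omega> \<longrightarrow> op v x = f x"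
  shows "right_inv \<Omega> \<and> left_inv \<Omega>"
proof -
  obtain R where R: "bounded_linear_on_X M \<rho> \<Omega> R"
    "\<And>f. f \<in> XS \<Omega> \<Longrightarrow> AE x in M. x \<in> \<Omega> \<longrightarrow> R f x - w x * R f (\<tau> x) = f x"
    "\<And>f h. f \<in> XS \<Omega> \<Longrightarrow> (\<And>x. x \<in> \<Omega> \<Longrightarrow> h x = f x - w x * f (\<tau> x)) \<Longrightarrow> AE x in M. R h x = f x"
    by (rule neumann_inverse[OF \<tau>(1,2) inv_setD(1)[OF \<Omega>] \<tau>(3) q \<kappa> meas]) blast+
  have Lm: "L f \<in> borel_measurable M" if "f \<in> XS \<Omega>" for f using that L(1) by (simp add: X_sub_iff)
  have bl: "bounded_linear_on_X M \<rho> \<Omega> (\<lambda>f. R (L f))"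
    by (rule bounded_linear_on_X_comp(1)[OF R(1), of L K]) (use Lm L in auto)
  have LX: "L f \<in> XS \<Omega>" if "f \<in> XS \<Omega>" for f
    by (rule bounded_linear_on_X_comp(2)[OF R(1), of L K]) (use Lm L that in auto)
  have "right_inv \<Omega>"
    unfolding right_invertible_in_def
  proof (intro exI conjI ballI)
    fix f assume f: "f \<in> XS \<Omega>"
    have off: "AE x in M. x \<notin> \<Omega> \<longrightarrow> f x = 0" using f by (simp add: X_sub_iff)
    have off': "AE x in M. x \<notin> \<Omega> \<longrightarrow> R (L f) x = 0"
      using bounded_linear_on_XD(1)[OF bl f] by (simp add: X_sub_iff)
    show "AE x in M. op (R (L f)) x = f x"
      using solve[OF R(2)[OF LX[OF f]]] off off' AE_T[OF off']
      by eventually_elim (auto simp: op_def inv_setD(3)[OF \<Omega>])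
  qed (rule bl)
  moreover have "left_inv \<Omega>"
    unfolding left_invertible_in_def using bl R(3) factor by blast
  ultimately show ?thesis by blast
qed

text \<open>Dividing by a leaves I - (b/a)W. Each application of the shift enlarges measures of
  preimages by at most \<kappa>, and the weight q compensates for it.\<close>

lemma invertible_dominant_a:
  assumes \<Omega>: "inv_set \<Omega>" and c: "c > 0" "\<And>x. x \<in> \<Omega> \<Longrightarrow> c \<le> cmod (a x)"
    and q: "0 \<le> q" "\<And>x. x \<in> \<Omega> \<Longrightarrow> cmod (b x) \<le> q * cmod (a x)"
    and \<kappa>: "\<kappa> \<ge> 1" "q * \<kappa> < 1" "\<And>x. x \<in> \<Omega> \<Longrightarrow> 1 \<le> \<kappa> * d x"
  shows "right_inv \<Omega> \<and> left_inv \<Omega>"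
proof -
  note m [measurable] = inv_setD(1)[OF \<Omega>]
  have a0: "a x \<noteq> 0" if "x \<in> \<Omega>" for x using c(1) c(2)[OF that] by auto
  have wq: "cmod (b x / a x) \<le> q" if "x \<in> \<Omega>" for x
    using q(2)[OF that] a0[OF that] by (simp add: norm_divide field_simps)
  define L where "L f = (\<lambda>x. indicator \<Omega> x * (f x / a x))" for f
  have L_bound: "nrm (L f) \<le> ennreal (1 / c) * nrm f" if f: "f \<in> XS \<Omega>" for f
  proof (rule nrm_le_cmult)
    show "AE x in M. cmod (L f x) \<le> 1 / c * cmod (f x)"
      by (rule AE_I2) (use c in \<open>auto simp: L_def norm_divide indicator_def intro!: divide_left_mono mult_pos_pos a0\<close>)
  qed (use c f in \<open>auto simp: X_sub_iff L_def\<close>)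
  show ?thesis
  proof (rule invertible_of_neumann[OF \<Omega> T, of "\<lambda>x. b x / a x" q \<kappa> L "1 / c"])
    fix n E assume "E \<in> sets M"
    then show "emeasure M (\<Omega> \<inter> (T ^^ n) -` E) \<le> ennreal (\<kappa> ^ n) * emeasure M E"
      by (intro emeasure_T_pow_vimage) (use \<Omega> \<kappa> in \<open>auto simp: T_pow_inv inv_setD\<close>)
  next
    fix f x assume x: "x \<in> \<Omega>"
    then show "L (op f) x = f x - b x / a x * f (T x)"
      using a0[OF x] inv_setD(2)[OF \<Omega>] by (auto simp: L_def op_def diff_divide_distrib)
  next
    fix v f assume "AE x in M. x \<in> \<Omega> \<longrightarrow> v x - b x / a x * v (T x) = L f x"
    then show "AE x in M. x \<in> \<Omega> \<longrightarrow> op v x = f x"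
    proof (rule eventually_mono, intro impI)
      fix x assume "x \<in> \<Omega> \<longrightarrow> v x - b x / a x * v (T x) = L f x" and x: "x \<in> \<Omega>"
      then have "v x - b x / a x * v (T x) = f x / a x" by (simp add: L_def)
      then have "a x * (v x - b x / a x * v (T x)) = a x * (f x / a x)" by simp
      then show "op v x = f x" using a0[OF x] x inv_setD(2)[OF \<Omega>] by (auto simp: op_def algebra_simps)
    qed
  qed (use q \<kappa> c wq L_bound in \<open>auto simp: L_def inv_setD(3)[OF \<Omega>] algebra_simps add_divide_distrib\<close>)
qed

text \<open>Solving the equation for the value of v at \<open>T x\<close> and evaluating at
  \<open>S x\<close> gives v = (a/b)(Sx) v(Sx) - (f/b)(Sx). So the series runs in the inverse shift,
  and L contains the minus sign and the shift by S.\<close>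

lemma invertible_dominant_b:
  assumes \<Omega>: "inv_set \<Omega>" and c: "c > 0" "\<And>x. x \<in> \<Omega> \<Longrightarrow> c \<le> cmod (b x)"
    and q: "0 \<le> q" "\<And>x. x \<in> \<Omega> \<Longrightarrow> cmod (a x) \<le> q * cmod (b x)"
    and \<kappa>: "\<kappa> \<ge> 1" "q * \<kappa> < 1" "\<And>x. x \<in> \<Omega> \<Longrightarrow> d x \<le> \<kappa>"
  shows "right_inv \<Omega> \<and> left_inv \<Omega>"
proof -
  note m [measurable] = inv_setD(1)[OF \<Omega>]
  have b0: "b x \<noteq> 0" if "x \<in> \<Omega>" for x using c(1) c(2)[OF that] by auto
  have pow: "emeasure M (\<Omega> \<inter> (S ^^ n) -` E) \<le> ennreal (\<kappa> ^ n) * emeasure M E"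
    if "E \<in> sets M" for n E
    by (rule emeasure_S_pow_vimage) (use that \<Omega> \<kappa> in \<open>auto simp: T_pow_inv S_pow_inv inv_setD\<close>)
  define L where "L f = (\<lambda>x. indicator \<Omega> x * (- (f (S x) / b (S x))))" for f
  have L_bound: "nrm (L f) \<le> ennreal (1 / c * real (nat \<lceil>\<kappa>\<rceil>)) * nrm f" if f: "f \<in> XS \<Omega>" for f
  proof -
    have fm [measurable]: "f \<in> borel_measurable M" using f by (simp add: X_sub_iff)
    have "nrm (L f) \<le> ennreal (1 / c) * nrm (\<lambda>x. indicator \<Omega> x * f (S x))"
    proof (rule nrm_le_cmult)
      show "AE x in M. cmod (L f x) \<le> 1 / c * cmod (indicator \<Omega> x * f (S x))"
      proof (rule AE_I2)
        fix x
        have "cmod (f (S x)) / cmod (b (S x)) \<le> cmod (f (S x)) / c" if "x \<in> \<Omega>"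
          using c(1) c(2)[of "S x"] that by (intro divide_left_mono) (auto simp: inv_setD[OF \<Omega>] b0)
        then show "cmod (L f x) \<le> 1 / c * cmod (indicator \<Omega> x * f (S x))"
          by (simp add: L_def norm_divide indicator_def)
      qed
    qed (use c in \<open>auto simp: L_def\<close>)
    also have "\<dots> \<le> ennreal (1 / c) * (of_nat (nat \<lceil>\<kappa>\<rceil>) * nrm f)"
      using pow[of _ 1] \<kappa> by (intro mult_left_mono nrm_comp_le) auto
    also have "\<dots> = ennreal (1 / c * real (nat \<lceil>\<kappa>\<rceil>)) * nrm f"
      using c ennreal_mult[of "1 / c" "real (nat \<lceil>\<kappa>\<rceil>)"]
      by (simp add: ennreal_of_nat_eq_real_of_nat mult.assoc)
    finally show ?thesis .
  qed
  have wq: "cmod (a (S x) / b (S x)) \<le> q" if "x \<in> \<Omega>" for x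
    using q(2)[of "S x"] b0[of "S x"] that by (simp add: inv_setD(4)[OF \<Omega>] norm_divide field_simps)
  show ?thesis
  proof (rule invertible_of_neumann[OF \<Omega> S, of "\<lambda>x. a (S x) / b (S x)" q \<kappa> L "1 / c * real (nat \<lceil>\<kappa>\<rceil>)"])
    fix f x assume x: "x \<in> \<Omega>"
    then have "S x \<in> \<Omega>" "S x \<in> G" using inv_setD[OF \<Omega>] by auto
    then show "L (op f) x = f x - a (S x) / b (S x) * f (S x)"
      using x b0[of "S x"] by (simp add: L_def op_def diff_divide_distrib)
  next
    fix v f assume "AE x in M. x \<in> \<Omega> \<longrightarrow> v x - a (S x) / b (S x) * v (S x) = L f x"
    \<comment> \<open>The equation produced by the Neumann series lives at the shifted point; read
      at \<open>T x\<close> it is the desired equation at x.\<close>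
    from AE_T[OF this] show "AE x in M. x \<in> \<Omega> \<longrightarrow> op v x = f x"
    proof (rule eventually_mono, intro impI)
      fix x assume "T x \<in> \<Omega> \<longrightarrow> v (T x) - a (S (T x)) / b (S (T x)) * v (S (T x)) = L f (T x)" and x: "x \<in> \<Omega>"
      then have "v (T x) - a x / b x * v x = - (f x / b x)" by (simp add: L_def inv_setD(3)[OF \<Omega>])
      then have "- b x * (v (T x) - a x / b x * v x) = b x * (f x / b x)" by simp
      then show "op v x = f x" using b0[OF x] x inv_setD(2)[OF \<Omega>] by (auto simp: op_def algebra_simps)
    qed
  qed (use q \<kappa> c wq pow L_bound in \<open>auto simp: L_def inv_setD(4)[OF \<Omega>] algebra_simps add_divide_distrib\<close>)
qed

lemma invertible_fixed:
  assumes \<Omega>: "inv_set \<Omega>" and fixT: "\<And>x. x \<in> \<Omega> \<Longrightarrow> T x = x" and c: "c > 0"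
    and ab: "AE x in M. x \<in> \<Omega> \<longrightarrow> c \<le> cmod (a x - b x)"
  shows "right_inv \<Omega>" "left_inv \<Omega>"
proof -
  note m [measurable] = inv_setD(1)[OF \<Omega>]
  let ?R = "\<lambda>f x. indicator \<Omega> x * (f x / (a x - b x))"
  have bl: "bounded_linear_on_X M \<rho> \<Omega> ?R"
  proof (rule bounded_linear_on_XI[where C = "1 / c"])
    fix f assume f: "f \<in> XS \<Omega>"
    then have [measurable]: "f \<in> borel_measurable M" by (simp add: X_sub_iff)
    show "?R f \<in> borel_measurable M" by measurable
    show "nrm (?R f) \<le> ennreal (1 / c) * nrm f"
    proof (rule nrm_le_cmult)
      show "AE x in M. cmod (?R f x) \<le> 1 / c * cmod (f x)"
        using ab
      proof (rule eventually_mono)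
        fix x assume "x \<in> \<Omega> \<longrightarrow> c \<le> cmod (a x - b x)"
        then have "cmod (f x) / cmod (a x - b x) \<le> cmod (f x) / c" if "x \<in> \<Omega>"
          using c that by (intro divide_left_mono mult_pos_pos) auto
        then show "cmod (?R f x) \<le> 1 / c * cmod (f x)"
          using c by (simp add: norm_divide indicator_def)
      qed
    qed (use c in auto)
  qed (use c in \<open>auto simp: algebra_simps add_divide_distrib\<close>)
  have "AE x in M. op (?R f) x = f x \<and> ?R (op f) x = f x" if f: "f \<in> XS \<Omega>" for f
  proof -
    have off: "AE x in M. x \<notin> \<Omega> \<longrightarrow> f x = 0" using f by (simp add: X_sub_iff)
    from ab off show ?thesis
    proof eventually_elim
      case (elim x)
      show ?case
      proof (cases "x \<in> \<Omega>")
        case True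
        then have "a x - b x \<noteq> 0" using elim c by auto
        moreover have "x \<in> G" using True inv_setD(2)[OF \<Omega>] by blast
        ultimately show ?thesis using True fixT[OF True]
          by (simp add: op_def left_diff_distrib[symmetric] diff_divide_distrib[symmetric])
      qed (use elim in \<open>auto simp: op_def inv_setD(3)[OF \<Omega>]\<close>)
    qed
  qed
  then show "right_inv \<Omega>" "left_inv \<Omega>"
    unfolding right_invertible_in_def left_invertible_in_def using bl
    by (auto intro!: exI[of _ ?R] elim!: eventually_mono)
qed

section \<open>Obstructions to one-sided invertibility\<close>

lemma left_invertible_bound:
  assumes "left_inv \<Omega>" and \<Omega>: "inv_set \<Omega>"
  obtains C where "C > 0" "\<And>f. f \<in> XS \<Omega> \<Longrightarrow> nrm f \<le> ennreal C * nrm (op f)"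
proof -
  obtain R where R: "bounded_linear_on_X M \<rho> \<Omega> R" "\<And>f. f \<in> XS \<Omega> \<Longrightarrow> AE x in M. R (op f) x = f x"
    using assms(1) unfolding left_invertible_in_def by blast
  obtain C where C: "C > 0" "\<And>f. f \<in> XS \<Omega> \<Longrightarrow> nrm (R f) \<le> ennreal C * nrm f"
    using bounded_linear_on_X_bound[OF R(1)] by blast
  show ?thesis
  proof (rule that[OF C(1)])
    fix f assume f: "f \<in> XS \<Omega>"
    have "nrm (R (op f)) = nrm f"
      by (rule nrm_cong_AE[OF _ _ R(2)[OF f]])
        (use f bounded_linear_on_XD(1)[OF R(1) op_X_sub[OF f \<Omega>]] in \<open>auto simp: X_sub_iff\<close>)
    with C(2)[OF op_X_sub[OF f \<Omega>]] show "nrm f \<le> ennreal C * nrm (op f)" by simp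
  qed
qed

lemma right_invertible_bound:
  assumes "right_inv \<Omega>"
  obtains C where "C > 0"
    "\<And>f. f \<in> XS \<Omega> \<Longrightarrow> \<exists>v\<in>XS \<Omega>. nrm v \<le> ennreal C * nrm f \<and> (AE x in M. op v x = f x)"
proof -
  obtain R where R: "bounded_linear_on_X M \<rho> \<Omega> R" "\<And>f. f \<in> XS \<Omega> \<Longrightarrow> AE x in M. op (R f) x = f x"
    using assms(1) unfolding right_invertible_in_def by blast
  obtain C where C: "C > 0" "\<And>f. f \<in> XS \<Omega> \<Longrightarrow> nrm (R f) \<le> ennreal C * nrm f"
    using bounded_linear_on_X_bound[OF R(1)] by blast
  show ?thesis by (rule that[OF C(1)]) (use R C bounded_linear_on_XD(1)[OF R(1)] in blast)
qed

lemma nrm_indicator: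
  assumes D: "D \<in> sets M"
  shows "nrm (indicator D) < \<infinity>" "emeasure M D > 0 \<Longrightarrow> nrm (indicator D) > 0"
    "D \<subseteq> \<Omega> \<Longrightarrow> indicator D \<in> XS \<Omega>"
proof -
  have "nrm (indicator D) = \<rho> (indicator D)"
    unfolding nrm_def by (rule arg_cong[of _ _ \<rho>]) (auto simp: indicator_def)
  then show 1: "nrm (indicator D) < \<infinity>" "emeasure M D > 0 \<Longrightarrow> nrm (indicator D) > 0"
    using rho_indicator_finite[OF D] rho_indicator_pos[OF D] by auto
  show "D \<subseteq> \<Omega> \<Longrightarrow> indicator D \<in> XS \<Omega>"
    using 1 D by (auto simp: X_sub_iff indicator_def)
qed

lemma ennreal_mult_self_less:
  fixes z :: ennreal
  assumes "z \<le> ennreal c * z" "0 < z" "z < \<infinity>" "0 \<le> c"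
  shows "1 \<le> c"
proof -
  obtain r where r: "z = ennreal r" "r > 0" using assms(2,3)
    by (cases z) (auto simp: less_top)
  have "ennreal r \<le> ennreal (c * r)" using assms r by (simp add: ennreal_mult)
  then have "r \<le> c * r" using r assms by (simp add: ennreal_le_iff)
  then show ?thesis using r by simp
qed

lemma not_left_invertibleI:
  assumes \<Omega>: "inv_set \<Omega>"
    and test: "\<And>\<epsilon>. \<epsilon> > 0 \<Longrightarrow> \<exists>f\<in>XS \<Omega>. 0 < nrm f \<and> nrm (op f) \<le> ennreal \<epsilon> * nrm f"
  shows "\<not> left_inv \<Omega>"
proof
  assume "left_inv \<Omega>"
  then obtain C where C: "C > 0" "\<And>f. f \<in> XS \<Omega> \<Longrightarrow> nrm f \<le> ennreal C * nrm (op f)"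
    using left_invertible_bound[OF _ \<Omega>] by blast
  obtain f where f: "f \<in> XS \<Omega>" "0 < nrm f" "nrm (op f) \<le> ennreal (1 / (2 * C)) * nrm f"
    using test[of "1 / (2 * C)"] C(1) by auto
  have "nrm f \<le> ennreal C * (ennreal (1 / (2 * C)) * nrm f)"
    using C(2)[OF f(1)] mult_left_mono[OF f(3), of "ennreal C"] by (rule order_trans) simp
  also have "\<dots> = ennreal (1 / 2) * nrm f"
    using C(1) by (simp add: mult.assoc[symmetric] ennreal_mult[symmetric])
  finally have "(1::real) \<le> 1 / 2"
    by (rule ennreal_mult_self_less) (use f in \<open>auto simp: X_sub_iff\<close>)
  then show False by simp
qed

text \<open>A bounded right inverse would give f a preimage of norm at most CB\<mu>, while every
  preimage has norm at least \<mu>/\<epsilon>. The gauge \<mu> is separate from the norm of f, so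
  that the norm of a part of an orbit block can serve for it.\<close>

lemma not_right_invertibleI:
  assumes B: "B \<ge> 0"
    and test: "\<And>\<epsilon>. \<epsilon> > 0 \<Longrightarrow> \<exists>f\<in>XS \<Omega>. \<exists>\<mu>. 0 < \<mu> \<and> \<mu> < \<infinity> \<and> nrm f \<le> ennreal B * \<mu> \<and>
      (\<forall>v\<in>XS \<Omega>. (AE x in M. op v x = f x) \<longrightarrow> \<mu> \<le> ennreal \<epsilon> * nrm v)"
  shows "\<not> right_inv \<Omega>"
proof
  assume "right_inv \<Omega>"
  then obtain C where C: "C > 0" "\<And>f. f \<in> XS \<Omega> \<Longrightarrow>
      \<exists>v\<in>XS \<Omega>. nrm v \<le> ennreal C * nrm f \<and> (AE x in M. op v x = f x)"
    using right_invertible_bound by blast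
  \<comment> \<open>Chosen so that e times CB is at most 1/2; adding 1 to B keeps the denominator
    positive when B is 0.\<close>
  define e where "e = 1 / (2 * C * (B + 1))"
  have "C * B + C > 0" using B C(1) by (simp add: add_nonneg_pos)
  then have e: "e > 0" "e * (C * B) \<le> 1 / 2" using B C(1) by (simp_all add: e_def field_simps)
  obtain f \<mu> where f: "f \<in> XS \<Omega>" "0 < \<mu>" "\<mu> < \<infinity>" "nrm f \<le> ennreal B * \<mu>"
    "\<And>v. v \<in> XS \<Omega> \<Longrightarrow> AE x in M. op v x = f x \<Longrightarrow> \<mu> \<le> ennreal e * nrm v"
    using test[OF e(1)] by blast
  obtain v where v: "v \<in> XS \<Omega>" "nrm v \<le> ennreal C * nrm f" "AE x in M. op v x = f x"
    using C(2)[OF f(1)] by blast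
  have "\<mu> \<le> ennreal e * nrm v" by (rule f(5)[OF v(1,3)])
  also have "\<dots> \<le> ennreal e * (ennreal C * (ennreal B * \<mu>))"
    by (intro mult_left_mono order_trans[OF v(2)] f(4)) auto
  also have "\<dots> = ennreal (e * (C * B)) * \<mu>"
    using e(1) C(1) B by (subst ennreal_mult, simp, simp)+ (simp only: mult.assoc)
  finally have "1 \<le> e * (C * B)"
    by (rule ennreal_mult_self_less) (use f e(1) C(1) B in auto)
  then show False using e(2) by simp
qed

text \<open>One indicator refutes both sides: its image is small and all its preimages are large,
  with gauge equal to its own norm.\<close>

lemma not_invertible_indicator:
  assumes \<Omega>: "inv_set \<Omega>"
    and test: "\<And>\<epsilon>. \<epsilon> > 0 \<Longrightarrow> \<exists>D\<in>sets M. D \<subseteq> \<Omega> \<and> emeasure M D > 0 \<and>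
      nrm (op (indicator D)) \<le> ennreal \<epsilon> * nrm (indicator D) \<and>
      (\<forall>v\<in>XS \<Omega>. (AE x in M. op v x = indicator D x) \<longrightarrow> nrm (indicator D) \<le> ennreal \<epsilon> * nrm v)"
  shows "\<not> right_inv \<Omega> \<and> \<not> left_inv \<Omega>"
proof -
  have "\<not> left_inv \<Omega>"
    by (rule not_left_invertibleI[OF \<Omega>]) (use test nrm_indicator in blast)
  moreover have "\<not> right_inv \<Omega>"
  proof (rule not_right_invertibleI[of 1])
    fix \<epsilon> :: real assume "\<epsilon> > 0"
    from test[OF this] obtain D where D: "D \<in> sets M" "D \<subseteq> \<Omega>" "emeasure M D > 0"
      "\<And>v. v \<in> XS \<Omega> \<Longrightarrow> AE x in M. op v x = indicator D x \<Longrightarrow> nrm (indicator D) \<le> ennreal \<epsilon> * nrm v" by blast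
    then show "\<exists>f\<in>XS \<Omega>. \<exists>\<mu>. 0 < \<mu> \<and> \<mu> < \<infinity> \<and> nrm f \<le> ennreal 1 * \<mu> \<and>
      (\<forall>v\<in>XS \<Omega>. (AE x in M. op v x = f x) \<longrightarrow> \<mu> \<le> ennreal \<epsilon> * nrm v)"
      using nrm_indicator[OF D(1)]
      by (intro bexI[of _ "indicator D"] exI[of _ "nrm (indicator D)"]) auto
  qed simp
  ultimately show ?thesis by blast
qed

lemma not_invertible_fixed:
  assumes \<Omega>: "inv_set \<Omega>"
    and D: "\<And>\<epsilon>. \<epsilon> > 0 \<Longrightarrow> \<exists>D\<in>sets M. D \<subseteq> \<Omega> \<and> emeasure M D > 0 \<and> (\<forall>x\<in>D. T x = x \<and> cmod (a x - b x) \<le> \<epsilon>)"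
  shows "\<not> right_inv \<Omega> \<and> \<not> left_inv \<Omega>"
proof -
  have "\<exists>D\<in>sets M. D \<subseteq> \<Omega> \<and> emeasure M D > 0 \<and>
      nrm (op (indicator D)) \<le> ennreal \<epsilon> * nrm (indicator D) \<and>
      (\<forall>v\<in>XS \<Omega>. (AE x in M. op v x = indicator D x) \<longrightarrow> nrm (indicator D) \<le> ennreal \<epsilon> * nrm v)"
    if \<epsilon>: "\<epsilon> > 0" for \<epsilon>
  proof -
    obtain D where D: "D \<in> sets M" "D \<subseteq> \<Omega>" "emeasure M D > 0" "\<And>x. x \<in> D \<Longrightarrow> T x = x"
      "\<And>x. x \<in> D \<Longrightarrow> cmod (a x - b x) \<le> \<epsilon>" using D[OF \<epsilon>] by blast
    note [measurable] = D(1)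
    have TD: "T x \<in> D \<longleftrightarrow> x \<in> D" for x using D(4) ST by metis
    have "nrm (op (indicator D)) \<le> ennreal \<epsilon> * nrm (indicator D)"
    proof (rule nrm_le_cmult)
      show "AE x in M. cmod (op (indicator D) x) \<le> \<epsilon> * cmod (indicator D x)"
        by (rule AE_I2) (use D(5) \<epsilon> in \<open>auto simp: op_def indicator_def TD\<close>)
    qed (use \<epsilon> op_measurable in auto)
    moreover have "nrm (indicator D) \<le> ennreal \<epsilon> * nrm v"
      if v: "v \<in> XS \<Omega>" and eq: "AE x in M. op v x = indicator D x" for v
    proof (rule nrm_le_cmult)
      show "AE x in M. cmod (indicator D x) \<le> \<epsilon> * cmod (v x)"
        using eq
      proof (rule eventually_mono)
        fix x assume e: "op v x = indicator D x"
        show "cmod (indicator D x) \<le> \<epsilon> * cmod (v x)"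
        proof (cases "x \<in> D")
          case True
          then have "x \<in> G" using D(2) inv_setD(2)[OF \<Omega>] by blast
          then have "(a x - b x) * v x = 1" using e True D(4)[OF True] by (simp add: op_def algebra_simps)
          then have "cmod (a x - b x) * cmod (v x) = 1" by (metis norm_mult norm_one)
          moreover have "cmod (a x - b x) * cmod (v x) \<le> \<epsilon> * cmod (v x)"
            by (intro mult_right_mono D(5)[OF True]) simp
          ultimately show ?thesis using True by simp
        qed (use \<epsilon> in simp)
      qed
    qed (use \<epsilon> v in \<open>auto simp: X_sub_iff\<close>)
    ultimately show ?thesis using D by blast
  qed
  then show ?thesis by (rule not_invertible_indicator[OF \<Omega>])
qed

text \<open>The image of the indicator of D lives on D and on the preimage of D under T. On the
  latter the coefficient b matters at the points \<open>S x\<close> with x in D, which is why it is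
  required to be small there too.\<close>

lemma not_invertible_zero:
  assumes \<Omega>: "inv_set \<Omega>"
    and D: "\<And>\<epsilon>. \<epsilon> > 0 \<Longrightarrow> \<exists>D\<in>sets M. D \<subseteq> \<Omega> \<and> emeasure M D > 0 \<and>
        (\<forall>x\<in>D. cmod (a x) \<le> \<epsilon> \<and> cmod (b x) \<le> \<epsilon> \<and> cmod (b (S x)) \<le> \<epsilon>)"
  shows "\<not> right_inv \<Omega> \<and> \<not> left_inv \<Omega>"
proof -
  obtain \<kappa> where \<kappa>: "\<kappa> \<ge> 1" "\<And>E. E \<in> sets M \<Longrightarrow> emeasure M (G \<inter> T -` E) \<le> ennreal \<kappa> * emeasure M E"
    using global_bound by metis
  define K where "K = real (nat \<lceil>\<kappa>\<rceil>)"
  have K: "1 + K > 0" "K \<ge> 0" by (simp_all add: K_def)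
  \<comment> \<open>The modulus of v plus that of its shift: a single function that dominates both
    terms of the operator, with norm at most 1 + K times that of v.\<close>
  let ?u = "\<lambda>v x. complex_of_real (cmod (v x) + cmod (indicator G x * v (T x)))"
  have nu: "ennreal (\<epsilon> / (1 + K)) * nrm (?u v) \<le> ennreal \<epsilon> * nrm v"
    if \<epsilon>: "\<epsilon> > 0" and [measurable]: "v \<in> borel_measurable M" for \<epsilon> v
  proof -
    have n2: "nrm (\<lambda>x. complex_of_real (cmod (h x))) = nrm h" for h by (simp add: nrm_def)
    have "nrm (?u v) \<le> nrm v + nrm (\<lambda>x. indicator G x * v (T x))"
      using nrm_add[of "\<lambda>x. complex_of_real (cmod (v x))" "\<lambda>x. complex_of_real (cmod (indicator G x * v (T x)))"]
      unfolding n2 by simp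
    also have "\<dots> \<le> nrm v + ennreal K * nrm v"
      using nrm_comp_le[OF T G _ \<kappa>(2), of v] \<kappa>(1)
      by (intro add_left_mono) (simp add: K_def ennreal_of_nat_eq_real_of_nat)
    also have "\<dots> = ennreal (1 + K) * nrm v" using K by (simp add: ennreal_plus distrib_right)
    finally have "ennreal (\<epsilon> / (1 + K)) * nrm (?u v) \<le> ennreal (\<epsilon> / (1 + K)) * (ennreal (1 + K) * nrm v)"
      by (rule mult_left_mono) simp
    also have "\<dots> = ennreal (\<epsilon> / (1 + K) * (1 + K)) * nrm v"
      using K \<epsilon> by (subst ennreal_mult) (auto simp: mult.assoc)
    also have "\<epsilon> / (1 + K) * (1 + K) = \<epsilon>" using K by simp
    finally show ?thesis .
  qed
  have "\<exists>D\<in>sets M. D \<subseteq> \<Omega> \<and> emeasure M D > 0 \<and>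
      nrm (op (indicator D)) \<le> ennreal \<epsilon> * nrm (indicator D) \<and>
      (\<forall>v\<in>XS \<Omega>. (AE x in M. op v x = indicator D x) \<longrightarrow> nrm (indicator D) \<le> ennreal \<epsilon> * nrm v)"
    if \<epsilon>: "\<epsilon> > 0" for \<epsilon>
  proof -
    define e where "e = \<epsilon> / (1 + K)"
    have e: "e > 0" using \<epsilon> K by (simp add: e_def)
    obtain D where D: "D \<in> sets M" "D \<subseteq> \<Omega>" "emeasure M D > 0" "\<And>x. x \<in> D \<Longrightarrow> cmod (a x) \<le> e"
      "\<And>x. x \<in> D \<Longrightarrow> cmod (b x) \<le> e" "\<And>x. x \<in> D \<Longrightarrow> cmod (b (S x)) \<le> e"
      using D[OF e] by auto
    note [measurable] = D(1)
    have "nrm (op (indicator D)) \<le> ennreal e * nrm (?u (indicator D))"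
    proof (rule nrm_le_cmult)
      show "AE x in M. cmod (op (indicator D) x) \<le> e * cmod (?u (indicator D) x)"
      proof (rule AE_I2)
        fix x
        have 1: "cmod (b x) \<le> e" if "T x \<in> D" using D(6)[OF that] by simp
        \<comment> \<open>D may meet its own preimage; there both terms contribute, and
          \<open>?u\<close> takes the value 2.\<close>
        have "cmod (a x - b x) \<le> e * 2" if "x \<in> D" "T x \<in> D"
          using norm_triangle_ineq4[of "a x" "b x"] 1 D(4)[of x] that by simp
        then show "cmod (op (indicator D) x) \<le> e * cmod (?u (indicator D) x)"
          using 1 D(4)[of x] e by (auto simp: op_def indicator_def)
      qed
    qed (use e op_measurable in auto)
    then have left: "nrm (op (indicator D)) \<le> ennreal \<epsilon> * nrm (indicator D)"
      using nu[OF \<epsilon>, of "indicator D"] unfolding e_def by (auto intro: order_trans)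
    have "nrm (indicator D) \<le> ennreal \<epsilon> * nrm v"
      if v: "v \<in> XS \<Omega>" and eq: "AE x in M. op v x = indicator D x" for v
    proof -
      have [measurable]: "v \<in> borel_measurable M" using v by (simp add: X_sub_iff)
      have "nrm (indicator D) \<le> ennreal e * nrm (?u v)"
      proof (rule nrm_le_cmult)
        show "AE x in M. cmod (indicator D x) \<le> e * cmod (?u v x)"
          using eq
        proof (rule eventually_mono)
          fix x assume eq: "op v x = indicator D x"
          show "cmod (indicator D x) \<le> e * cmod (?u v x)"
          proof (cases "x \<in> D")
            case True
            then have xG: "x \<in> G" using D(2) inv_setD(2)[OF \<Omega>] by blast
            then have "a x * v x - b x * v (T x) = 1" using eq True by (simp add: op_def)
            then have "1 \<le> cmod (a x) * cmod (v x) + cmod (b x) * cmod (v (T x))"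
              by (metis norm_mult norm_one norm_triangle_ineq4)
            also have "\<dots> \<le> e * cmod (v x) + e * cmod (v (T x))"
              by (intro add_mono mult_right_mono D(4,5)[OF True]) auto
            finally show ?thesis using True xG
              by (simp only: norm_of_real) (simp add: distrib_left)
          qed (use e in simp)
        qed
      qed (use e in auto)
      also have "\<dots> \<le> ennreal \<epsilon> * nrm v" unfolding e_def by (rule nu[OF \<epsilon>]) measurable
      finally show ?thesis .
    qed
    then show ?thesis using left D by blast
  qed
  then show ?thesis by (rule not_invertible_indicator[OF \<Omega>])
qed

end

section \<open>Almost null vectors along orbits\<close>

text \<open>The first 3n images of D form the block. The ratio l is so close to 1 that the product
  of up to 3n quotients |b/a|, or of as many derivatives, stays between 1/2 and 2. Disjointness
  includes the index 3n, one image past the block, so that a step out of the end of the block does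
  not re-enter it.\<close>

locale orbit_block = shift_space M \<rho> G T S d a b
  for M :: "'a measure" and \<rho> G T S d a b +
  fixes \<Omega> D :: "'a set" and n :: nat and l A0 :: real
  assumes \<Omega>: "inv_set \<Omega>" and D: "D \<in> sets M" "D \<subseteq> \<Omega>" "emeasure M D > 0"
    and n: "n > 0" and l: "l \<ge> 1" "l ^ (3 * n) \<le> 2" and A0: "A0 \<ge> 0"
    and disj: "\<And>x j k. x \<in> D \<Longrightarrow> j \<le> 3 * n \<Longrightarrow> k \<le> 3 * n \<Longrightarrow> j \<noteq> k \<Longrightarrow> (S ^^ k) ((T ^^ j) x) \<notin> D"
    and coeff: "\<And>x k. x \<in> D \<Longrightarrow> k < 3 * n \<Longrightarrow> a ((T ^^ k) x) \<noteq> 0 \<and> cmod (a ((T ^^ k) x)) \<le> A0 \<and>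
        cmod (a ((T ^^ k) x)) \<le> l * cmod (b ((T ^^ k) x)) \<and> cmod (b ((T ^^ k) x)) \<le> l * cmod (a ((T ^^ k) x))"
    and deriv: "\<And>x k. x \<in> D \<Longrightarrow> k < 3 * n \<Longrightarrow> d ((T ^^ k) x) \<le> l \<and> 1 \<le> l * d ((T ^^ k) x)"
begin

text \<open>This is the image of D under T^k, written as a preimage under S^k so that measurability
  is immediate.\<close>

definition E :: "nat \<Rightarrow> 'a set" where "E k = (S ^^ k) -` D"

definition EE :: "nat set \<Rightarrow> 'a set" where "EE I = (\<Union>k\<in>I. E k)"

text \<open>The cocycle of b/a: along the orbit of x the null vectors of the operator are the
  multiples of 1/P k x.\<close>

definition P :: "nat \<Rightarrow> 'a \<Rightarrow> complex" where
  "P k x = (\<Prod>m<k. b ((T ^^ m) x) / a ((T ^^ m) x))"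

lemma E_sets [measurable]: "E k \<in> sets M"
  unfolding E_def by (rule vimage_sets[OF S_pow_measurable D(1)])

lemma EE_sets [measurable]: "EE I \<in> sets M"
  unfolding EE_def by (rule sets.countable_UN') auto

lemma E_iff: "x \<in> E k \<longleftrightarrow> (\<exists>y\<in>D. x = (T ^^ k) y)"
  unfolding E_def by (auto, metis T_pow_S_pow)

lemma EE_iff: "x \<in> EE I \<longleftrightarrow> (\<exists>k\<in>I. \<exists>y\<in>D. x = (T ^^ k) y)"
  by (auto simp: EE_def E_iff)

lemma in_E_iff: "y \<in> D \<Longrightarrow> j \<le> 3 * n \<Longrightarrow> k \<le> 3 * n \<Longrightarrow> (T ^^ j) y \<in> E k \<longleftrightarrow> j = k"
  using disj[of y j k] by (auto simp: E_def)

lemma in_EE_iff: "y \<in> D \<Longrightarrow> j \<le> 3 * n \<Longrightarrow> I \<subseteq> {..3*n} \<Longrightarrow> (T ^^ j) y \<in> EE I \<longleftrightarrow> j \<in> I"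
  unfolding EE_def using in_E_iff[of y j] by auto

lemma D\<Omega>: "y \<in> D \<Longrightarrow> (T ^^ k) y \<in> \<Omega>"
  using D(2) T_pow_inv[OF \<Omega>] by blast

lemma DG: "y \<in> D \<Longrightarrow> (T ^^ k) y \<in> G"
  using D\<Omega> inv_setD(2)[OF \<Omega>] by blast

lemma EE_\<Omega>: "EE I \<subseteq> \<Omega>" "EE I \<subseteq> G"
  using D\<Omega> DG by (auto simp: EE_iff)

lemma b_nz: "x \<in> D \<Longrightarrow> k < 3 * n \<Longrightarrow> b ((T ^^ k) x) \<noteq> 0"
  using coeff[of x k] by auto

lemma P_bounds:
  assumes x: "x \<in> D" and k: "k \<le> 3 * n"
  shows "cmod (P k x) \<le> 2" "cmod (P k x) \<ge> 1 / 2" "P k x \<noteq> 0"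
proof -
  have lk: "l ^ k \<le> 2" using power_increasing[OF k l(1)] l(2) by simp
  have e: "cmod (P k x) = (\<Prod>m<k. cmod (b ((T ^^ m) x)) / cmod (a ((T ^^ m) x)))"
    by (simp add: P_def prod_norm[symmetric] norm_divide)
  have f: "cmod (b ((T ^^ m) x)) / cmod (a ((T ^^ m) x)) \<le> l \<and>
      1 / l \<le> cmod (b ((T ^^ m) x)) / cmod (a ((T ^^ m) x))" if "m < k" for m
    using coeff[OF x, of m] that k l(1) by (auto simp: divide_simps mult.commute)
  have "cmod (P k x) \<le> (\<Prod>m<k. l)" unfolding e by (rule prod_mono) (use f in auto)
  then show "cmod (P k x) \<le> 2" using lk by simp
  have "1 / 2 \<le> 1 / l ^ k" using lk l(1) by (intro divide_left_mono) auto
  also have "\<dots> = (\<Prod>m<k. 1 / l)" by (simp add: power_one_over)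
  also have "\<dots> \<le> cmod (P k x)" unfolding e by (rule prod_mono) (use f l(1) in auto)
  finally show "cmod (P k x) \<ge> 1 / 2" .
  then show "P k x \<noteq> 0" by auto
qed

lemma P_Suc: "P (Suc k) x = P k x * (b ((T ^^ k) x) / a ((T ^^ k) x))"
  by (simp add: P_def)

lemma P_measurable [measurable]: "P k \<in> borel_measurable M"
  unfolding P_def by measurable

text \<open>Assembles a function on the block from its values \<open>g k y\<close> at the points T^k
  y with y in D. At most one summand is nonzero, because the images of D are disjoint.\<close>

definition bump :: "(nat \<Rightarrow> 'a \<Rightarrow> complex) \<Rightarrow> 'a \<Rightarrow> complex" where
  "bump g = (\<lambda>x. \<Sum>k<3*n. indicator (E k) x * g k ((S ^^ k) x))"

lemma bump_measurable:
  assumes [measurable]: "\<And>k. g k \<in> borel_measurable M"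
  shows "bump g \<in> borel_measurable M"
  unfolding bump_def by measurable

lemma bump_on:
  assumes "y \<in> D" "j < 3 * n"
  shows "bump g ((T ^^ j) y) = g j y"
proof -
  have "bump g ((T ^^ j) y) = (\<Sum>k<3*n. if k = j then g j y else 0)"
    unfolding bump_def by (rule sum.cong) (use assms in \<open>auto simp: in_E_iff indicator_def\<close>)
  then show ?thesis using assms by simp
qed

lemma bump_off: "x \<notin> EE {..<3*n} \<Longrightarrow> bump g x = 0"
  unfolding bump_def by (rule sum.neutral) (auto simp: EE_def)

lemma bump_X_sub:
  assumes g: "\<And>k. g k \<in> borel_measurable M" and B: "B \<ge> 0"
    and le: "\<And>k x. x \<in> D \<Longrightarrow> k < 3 * n \<Longrightarrow> cmod (g k x) \<le> B"
  shows "bump g \<in> XS \<Omega>" "nrm (bump g) \<le> ennreal B * nrm (indicator (EE {..<3*n}))"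
proof -
  have 1: "cmod (bump g x) \<le> B * cmod (indicator (EE {..<3*n}) x)" for x
  proof (cases "x \<in> EE {..<3*n}")
    case True
    then obtain k y where "k < 3 * n" "y \<in> D" "x = (T ^^ k) y" by (auto simp: EE_iff)
    then show ?thesis using True le by (simp add: bump_on)
  qed (simp add: bump_off)
  show 2: "nrm (bump g) \<le> ennreal B * nrm (indicator (EE {..<3*n}))"
    by (rule nrm_le_cmult) (use bump_measurable[OF g] B 1 in auto)
  have "\<dots> < \<infinity>" using nrm_indicator(1)[OF EE_sets] by (simp add: ennreal_mult_less_top)
  then have "nrm (bump g) < \<infinity>" using 2 by (rule le_less_trans[rotated])
  moreover have "AE x in M. x \<notin> \<Omega> \<longrightarrow> bump g x = 0"
    by (rule AE_I2) (use EE_\<Omega>(1) in \<open>auto intro!: bump_off\<close>)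
  ultimately show "bump g \<in> XS \<Omega>" using bump_measurable[OF g] by (simp add: X_sub_iff)
qed

lemma ln2: "l ^ n \<le> 2"
  using power_increasing[of n "3 * n" l] l by simp

text \<open>Moving n steps inside the block changes measures by a factor of at most l^n, hence at
  most 2. Starting indices below 2n keep all points that are passed inside the block.\<close>

lemma nrm_comp_T:
  assumes f: "f \<in> borel_measurable M" and I: "I \<subseteq> {..<2*n}"
  shows "nrm (\<lambda>x. indicator (EE I) x * f ((T ^^ n) x)) \<le> 2 * nrm f"
proof -
  have "nrm (\<lambda>x. indicator (EE I) x * f ((T ^^ n) x)) \<le> of_nat (nat \<lceil>2::real\<rceil>) * nrm f"
  proof (rule nrm_comp_le[OF T_pow_measurable EE_sets f])
    fix F assume F: "F \<in> sets M"
    have "emeasure M (EE I \<inter> (T ^^ n) -` F) \<le> ennreal (l ^ n) * emeasure M F"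
    proof (rule emeasure_T_pow_vimage[OF EE_sets EE_\<Omega>(2) _ _ F])
      fix x j assume "x \<in> EE I" "j < n"
      then obtain k y where "k \<in> I" "y \<in> D" "x = (T ^^ k) y" by (auto simp: EE_iff)
      then show "1 \<le> l * d ((T ^^ j) x)"
        using deriv[of y "j + k"] I \<open>j < n\<close> by (auto simp: funpow_add)
    qed (use l in auto)
    also have "\<dots> \<le> ennreal 2 * emeasure M F"
      by (intro mult_right_mono ennreal_leI ln2) simp
    finally show "emeasure M (EE I \<inter> (T ^^ n) -` F) \<le> ennreal 2 * emeasure M F" .
  qed simp
  then show ?thesis by simp
qed

lemma nrm_comp_S:
  assumes f: "f \<in> borel_measurable M" and I: "I \<subseteq> {n..<3*n}"
  shows "nrm (\<lambda>x. indicator (EE I) x * f ((S ^^ n) x)) \<le> 2 * nrm f"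
proof -
  have "nrm (\<lambda>x. indicator (EE I) x * f ((S ^^ n) x)) \<le> of_nat (nat \<lceil>2::real\<rceil>) * nrm f"
  proof (rule nrm_comp_le[OF S_pow_measurable EE_sets f])
    fix F assume F: "F \<in> sets M"
    have "emeasure M (EE I \<inter> (S ^^ n) -` F) \<le> ennreal (l ^ n) * emeasure M F"
    proof (rule emeasure_S_pow_vimage[OF EE_sets EE_\<Omega>(2) _ _ F])
      fix x j assume "x \<in> EE I" "j < n"
      then obtain k y where k: "k \<in> I" "y \<in> D" "x = (T ^^ k) y" by (auto simp: EE_iff)
      then have "n \<le> k" "k < 3 * n" using I by auto
      have "x = (T ^^ n) ((T ^^ (k - n)) y)"
        using k \<open>n \<le> k\<close> by (metis comp_apply funpow_add le_add_diff_inverse)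
      then have "(T ^^ j) ((S ^^ n) x) = (T ^^ (j + (k - n))) y" by (simp add: funpow_add)
      then show "d ((T ^^ j) ((S ^^ n) x)) \<le> l"
        using deriv[of y "j + (k - n)"] k \<open>n \<le> k\<close> \<open>k < 3 * n\<close> \<open>j < n\<close> by simp
    qed (use l in auto)
    also have "\<dots> \<le> ennreal 2 * emeasure M F"
      by (intro mult_right_mono ennreal_leI ln2) simp
    finally show "emeasure M (EE I \<inter> (S ^^ n) -` F) \<le> ennreal 2 * emeasure M F" .
  qed simp
  then show ?thesis by simp
qed

section \<open>Comparable norms of the three thirds of a block\<close>

abbreviation "low \<equiv> EE {..<n}"
abbreviation "mid \<equiv> EE {n..<2*n}"
abbreviation "high \<equiv> EE {2*n..<3*n}"
abbreviation "block \<equiv> EE {..<3*n}"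

lemma nrm_low_le_mid: "nrm (indicator low) \<le> 2 * nrm (indicator mid)"
proof -
  have "(\<lambda>x. indicator low x * indicator mid ((T ^^ n) x) :: complex) = indicator low"
  proof
    fix x
    show "indicator low x * indicator mid ((T ^^ n) x) = (indicator low x :: complex)"
    proof (cases "x \<in> low")
      case True
      then obtain k y where "k < n" "y \<in> D" "x = (T ^^ k) y" by (auto simp: EE_iff)
      then have "(T ^^ n) x = (T ^^ (n + k)) y" by (simp add: funpow_add)
      then have "(T ^^ n) x \<in> mid"
        using \<open>k < n\<close> \<open>y \<in> D\<close> by (auto simp: EE_iff intro!: bexI[of _ "n + k"] bexI[of _ y])
      then show ?thesis by (simp add: indicator_def)
    qed simp
  qed
  then show ?thesis using nrm_comp_T[of "indicator mid" "{..<n}"] by simp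
qed

lemma indicator_S_shift:
  assumes "I \<subseteq> {n..}" "\<And>k. k \<in> I \<Longrightarrow> k - n \<in> J"
  shows "(\<lambda>x. indicator (EE I) x * indicator (EE J) ((S ^^ n) x) :: complex) = indicator (EE I)"
proof
  fix x
  show "indicator (EE I) x * indicator (EE J) ((S ^^ n) x) = (indicator (EE I) x :: complex)"
  proof (cases "x \<in> EE I")
    case True
    then obtain k y where k: "k \<in> I" "y \<in> D" "x = (T ^^ k) y" by (auto simp: EE_iff)
    then have "n \<le> k" using assms(1) by auto
    have "x = (T ^^ n) ((T ^^ (k - n)) y)"
      using k \<open>n \<le> k\<close> by (metis comp_apply funpow_add le_add_diff_inverse)
    then have "(S ^^ n) x = (T ^^ (k - n)) y" by simp
    then have "(S ^^ n) x \<in> EE J" using assms(2)[OF k(1)] k(2) by (auto simp: EE_iff)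
    then show ?thesis by (simp add: indicator_def)
  qed simp
qed

lemma nrm_mid_le_low: "nrm (indicator mid) \<le> 2 * nrm (indicator low)"
  using nrm_comp_S[of "indicator low" "{n..<2*n}"]
  by (subst indicator_S_shift[of "{n..<2*n}" "{..<n}", symmetric]) auto

lemma nrm_high_le_mid: "nrm (indicator high) \<le> 2 * nrm (indicator mid)"
  using nrm_comp_S[of "indicator mid" "{2*n..<3*n}"]
  by (subst indicator_S_shift[of "{2*n..<3*n}" "{n..<2*n}", symmetric]) auto

lemma nrm_block_le_mid: "nrm (indicator block) \<le> 5 * nrm (indicator mid)"
proof -
  have "nrm (indicator block) \<le> nrm (\<lambda>x. indicator low x + (indicator mid x + indicator high x))"
  proof (rule nrm_mono_AE)
    show "AE x in M. cmod (indicator block x) \<le> cmod (indicator low x + (indicator mid x + indicator high x))"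
    proof (rule AE_I2)
      fix x
      have "block = low \<union> (mid \<union> high)"
      proof -
        have "{..<3*n} = {..<n} \<union> ({n..<2*n} \<union> {2*n..<3*n})" by auto
        then show ?thesis unfolding EE_def by (simp only: UN_Un)
      qed
      then show "cmod (indicator block x) \<le> cmod (indicator low x + (indicator mid x + indicator high x))"
        by (auto simp: indicator_def)
    qed
  qed auto
  also have "\<dots> \<le> nrm (indicator low) + (nrm (indicator mid) + nrm (indicator high))"
    by (intro order_trans[OF nrm_add] add_left_mono nrm_add) auto
  also have "\<dots> \<le> 2 * nrm (indicator mid) + (nrm (indicator mid) + 2 * nrm (indicator mid))"
    by (intro add_mono nrm_low_le_mid nrm_high_le_mid order_refl)
  also have "\<dots> = (2 + 1 + 2) * nrm (indicator mid)" by (simp only: distrib_right mult_1 add.assoc)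
  finally show ?thesis by simp
qed

lemma emeasure_low_pos: "emeasure M low > 0"
proof -
  have "E 0 \<subseteq> low" using n unfolding EE_def by blast
  then have "D \<subseteq> low" by (simp add: E_def)
  then have "emeasure M D \<le> emeasure M low" by (rule emeasure_mono) simp
  then show ?thesis using D(3) by simp
qed

lemma nrm_low: "0 < nrm (indicator low)" "nrm (indicator low) < \<infinity>"
  using nrm_indicator(2)[OF EE_sets emeasure_low_pos] nrm_indicator(1)[OF EE_sets] by auto

lemma nrm_mid: "0 < nrm (indicator mid)" "nrm (indicator mid) < \<infinity>"
proof -
  have "nrm (indicator mid) \<noteq> 0"
  proof
    assume "nrm (indicator mid) = 0"
    then have "nrm (indicator low) \<le> 0" using nrm_low_le_mid by (metis mult_zero_right)
    then show False using nrm_low(1) by (metis not_less)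
  qed
  then show "0 < nrm (indicator mid)" by (metis zero_less_iff_neq_zero)
  show "nrm (indicator mid) < \<infinity>" by (rule nrm_indicator(1)[OF EE_sets])
qed

text \<open>The tent function along the orbit, corrected by the cocycle, is an almost null vector.\<close>

lemma left_test:
  "\<exists>f\<in>XS \<Omega>. 0 < nrm f \<and> nrm (op f) \<le> ennreal (20 * A0 / n) * nrm f"
proof -
  \<comment> \<open>The tent of slope 1 on 0..3n: zero at both ends, and at least n on the whole
    middle third.\<close>
  define w where "w k = (if 2 * k \<le> 3 * n then real k else real (3 * n) - real k)" for k
  have w0: "w 0 = 0" "w (3 * n) = 0" using n by (auto simp: w_def)
  have w_step: "\<bar>w k - w (Suc k)\<bar> \<le> 1" for k by (auto simp: w_def)
  have w_mid: "real n \<le> w k" if "n \<le> k" "k < 2 * n" for k using that by (auto simp: w_def)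
  have w_le: "\<bar>w k\<bar> \<le> 3 * n" if "k \<le> 3 * n" for k using that by (auto simp: w_def)
  define g where "g k x = complex_of_real (w k) / P k x" for k x
  have gm: "g k \<in> borel_measurable M" for k unfolding g_def by measurable
  let ?f = "bump g"
  have fX: "?f \<in> XS \<Omega>"
  proof (rule bump_X_sub(1)[where B = "3 * n * 2"])
    fix k x assume x: "x \<in> D" and k: "k < 3 * n"
    have "cmod (g k x) = \<bar>w k\<bar> / cmod (P k x)" by (simp add: g_def norm_divide)
    also have "\<dots> \<le> (3 * n) / (1 / 2)"
      using P_bounds[OF x, of k] w_le[of k] k by (intro frac_le) auto
    finally show "cmod (g k x) \<le> 3 * n * 2" by simp
  qed (use gm in auto)
  note fm [measurable] = bump_measurable[of g, OF gm]
  have f_on: "?f ((T ^^ k) y) = complex_of_real (w k) / P k y" if "y \<in> D" "k \<le> 3 * n" for y k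
  \<comment> \<open>The formula also holds one step past the block, where the function is 0 and so
    is the tent. This spares a separate treatment of the last point.\<close>
  proof (cases "k = 3 * n")
    case True
    have "(T ^^ k) y \<notin> EE {..<3*n}" using that True by (subst in_EE_iff) auto
    then show ?thesis using True w0 by (simp add: bump_off)
  qed (use that in \<open>simp add: bump_on g_def\<close>)
  have "nrm (op ?f) \<le> ennreal (2 * A0) * nrm (indicator block)"
  proof (rule nrm_le_cmult)
    show "AE x in M. cmod (op ?f x) \<le> 2 * A0 * cmod (indicator block x)"
    proof (rule AE_I2)
      fix x
      show "cmod (op ?f x) \<le> 2 * A0 * cmod (indicator block x)"
      proof (cases "x \<in> block")
        case True
        then obtain k y where k: "k < 3 * n" "y \<in> D" "x = (T ^^ k) y" by (auto simp: EE_iff)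
        have fx: "?f x = w k / P k y" "?f (T x) = w (Suc k) / P (Suc k) y"
          using f_on[OF k(2), of k] f_on[OF k(2), of "Suc k"] k by auto
        have nz: "a x \<noteq> 0" "b x \<noteq> 0" "P k y \<noteq> 0" and PS: "P (Suc k) y = P k y * (b x / a x)"
          using P_bounds(3)[OF k(2), of k] coeff[OF k(2,1)] b_nz[OF k(2,1)] k(1,3)
          by (simp_all add: P_Suc)
        \<comment> \<open>Dividing by the cocycle removes b: only the increment of the tent remains,
          which is at most 1, against a height of order n.\<close>
        have "a x * ?f x - b x * ?f (T x) = a x * (w k - w (Suc k)) / P k y"
          unfolding fx PS using nz by (simp add: field_simps)
        then have "cmod (op ?f x) = cmod (a x) * \<bar>w k - w (Suc k)\<bar> / cmod (P k y)"
          using DG[OF k(2)] k(3)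
          by (simp add: op_def norm_divide norm_mult flip: of_real_diff)
        also have "\<dots> \<le> A0 * 1 / (1 / 2)"
          using P_bounds(2)[OF k(2), of k] coeff[OF k(2,1)] k w_step[of k] A0
          by (intro frac_le mult_mono) auto
        finally show ?thesis using True by simp
      next
        case False
        \<comment> \<open>A point outside the block that is moved into it must land in its first
          set, where the tent vanishes.\<close>
        have "?f (T x) = 0"
        proof (cases "T x \<in> block")
          case True
          then obtain k y where k: "k < 3 * n" "y \<in> D" "T x = (T ^^ k) y" by (auto simp: EE_iff)
          show ?thesis
          proof (cases k)
            case 0 then show ?thesis using f_on[OF k(2), of k] k w0 by simp
          next
            case (Suc j)
            then have "x = (T ^^ j) y" using k(3) by (metis ST comp_apply funpow.simps(2))
            then show ?thesis using False k Suc by (auto simp: EE_iff)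
          qed
        qed (rule bump_off)
        then show ?thesis using False A0 by (simp add: op_def bump_off)
      qed
    qed
  qed (use A0 op_measurable fm in auto)
  also have "\<dots> \<le> ennreal (2 * A0) * (5 * nrm (indicator mid))"
    by (rule mult_left_mono[OF nrm_block_le_mid]) simp
  also have "\<dots> = ennreal (10 * A0) * nrm (indicator mid)"
  proof -
    have "ennreal (10 * A0) = ennreal (2 * A0) * ennreal 5"
      using A0 by (subst ennreal_mult[symmetric]) auto
    then show ?thesis by (simp add: mult.assoc)
  qed
  finally have 1: "nrm (op ?f) \<le> ennreal (10 * A0) * nrm (indicator mid)" .
  \<comment> \<open>The middle third measures the size of the test function: there the tent is at
    least n and the cocycle at most 2.\<close>
  have 2: "nrm (indicator mid) \<le> ennreal (2 / n) * nrm ?f"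
  proof (rule nrm_le_cmult)
    show "AE x in M. cmod (indicator mid x) \<le> 2 / n * cmod (?f x)"
    proof (rule AE_I2)
      fix x
      show "cmod (indicator mid x) \<le> 2 / n * cmod (?f x)"
      proof (cases "x \<in> mid")
        case True
        then obtain k y where k: "n \<le> k" "k < 2 * n" "y \<in> D" "x = (T ^^ k) y" by (auto simp: EE_iff)
        have "cmod (?f x) = w k / cmod (P k y)"
          using f_on[OF k(3), of k] k w_mid[of k] n by (simp add: norm_divide)
        also have "\<dots> \<ge> n / 2"
          using P_bounds(1)[OF k(3), of k] P_bounds(2)[OF k(3), of k] w_mid[of k] k by (intro frac_le) auto
        finally show ?thesis using True n by (simp add: field_simps)
      qed simp
    qed
  qed auto
  have "nrm (op ?f) \<le> ennreal (10 * A0) * (ennreal (2 / n) * nrm ?f)"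
    using 1 mult_left_mono[OF 2, of "ennreal (10 * A0)"] by (rule order_trans) simp
  also have "\<dots> = ennreal (10 * A0 * (2 / n)) * nrm ?f"
    using A0 by (subst ennreal_mult) (auto simp: mult.assoc)
  also have "10 * A0 * (2 / n) = 20 * A0 / n" by simp
  finally have "nrm (op ?f) \<le> ennreal (20 * A0 / n) * nrm ?f" .
  moreover have "nrm ?f \<noteq> 0" using 2 nrm_mid(1) by auto
  ultimately show ?thesis using fX by (auto simp: zero_less_iff_neq_zero)
qed

text \<open>Along an orbit the equation op v = f telescopes: the cocycle-corrected values of v
  drop by one at each step.\<close>

lemma right_test:
  "\<exists>f\<in>XS \<Omega>. nrm f \<le> ennreal (20 * A0) * nrm (indicator low) \<and>
      (\<forall>v\<in>XS \<Omega>. (AE x in M. op v x = f x) \<longrightarrow>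
        nrm (indicator low) \<le> ennreal (6 / n) * nrm v)"
proof -
  \<comment> \<open>Chosen so that multiplying the equation at the k-th orbit point by P k y and
    dividing by a leaves exactly 1 on the right.\<close>
  define g where "g k x = a ((T ^^ k) x) / P k x" for k x
  have gm: "g k \<in> borel_measurable M" for k unfolding g_def by measurable
  let ?f = "bump g"
  have "cmod (g k x) \<le> 2 * A0" if x: "x \<in> D" and k: "k < 3 * n" for x k
  proof -
    have "cmod (g k x) = cmod (a ((T ^^ k) x)) / cmod (P k x)" by (simp add: g_def norm_divide)
    also have "\<dots> \<le> A0 / (1 / 2)"
      using P_bounds[OF x, of k] coeff[OF x k] k A0 by (intro frac_le) auto
    finally show ?thesis by simp
  qed
  note fX = bump_X_sub[of g "2 * A0", OF gm _ this]
  have "nrm ?f \<le> ennreal (2 * A0) * nrm (indicator block)" using fX A0 by simp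
  also have "\<dots> \<le> ennreal (2 * A0) * (5 * (2 * nrm (indicator low)))"
    by (intro mult_left_mono order_trans[OF nrm_block_le_mid] nrm_mid_le_low) auto
  also have "\<dots> = ennreal (20 * A0) * nrm (indicator low)"
  proof -
    have "ennreal (20 * A0) = ennreal (2 * A0) * (ennreal 5 * ennreal 2)"
      using A0 by (simp add: ennreal_mult[symmetric] del: ennreal_numeral)
    then show ?thesis by (simp add: mult.assoc)
  qed
  finally have 1: "nrm ?f \<le> ennreal (20 * A0) * nrm (indicator low)" .
  have 2: "nrm (indicator low) \<le> ennreal (6 / n) * nrm v"
    if v: "v \<in> XS \<Omega>" and eq: "AE x in M. op v x = ?f x" for v
  proof -
    have [measurable]: "v \<in> borel_measurable M" using v by (simp add: X_sub_iff)
    \<comment> \<open>After n steps the telescoped equation bounds n by the values of v at x and at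
      T^n x. Their moduli are added into one function, whose norm is at most 3 times that of v; with
      the factor 2/n this gives 6/n.\<close>
    let ?u = "\<lambda>x. complex_of_real (cmod (v x)) + complex_of_real (cmod (indicator low x * v ((T ^^ n) x)))"
    have n2: "nrm (\<lambda>x. complex_of_real (cmod (h x))) = nrm h" for h by (simp add: nrm_def)
    \<comment> \<open>Countably many null sets are discarded together, so that the equation holds
      along the whole forward orbit of x.\<close>
    have "AE x in M. \<forall>k. op v ((T ^^ k) x) = ?f ((T ^^ k) x)"
      unfolding AE_all_countable using AE_T_pow[OF eq] by blast
    then have "AE x in M. cmod (indicator low x) \<le> 2 / n * cmod (?u x)"
    proof (rule eventually_mono)
      fix x assume eqx: "\<forall>k. op v ((T ^^ k) x) = ?f ((T ^^ k) x)"
      have u: "cmod (?u x) = cmod (v x) + cmod (indicator low x * v ((T ^^ n) x))"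
        by (simp flip: of_real_add)
      show "cmod (indicator low x) \<le> 2 / n * cmod (?u x)"
      proof (cases "x \<in> low")
        case True
        then obtain i y where i: "i < n" "y \<in> D" "x = (T ^^ i) y" by (auto simp: EE_iff)
        have step: "P (i + m) y * v ((T ^^ m) x) - P (i + Suc m) y * v ((T ^^ Suc m) x) = 1" if "m < n" for m
        proof -
          let ?k = "i + m"
          have k: "?k < 3 * n" using that i by simp
          have Tm: "(T ^^ m) x = (T ^^ ?k) y" 
            by (simp only: i(3) add.commute[of i m] funpow_add comp_apply)
          have "op v ((T ^^ m) x) = a ((T ^^ ?k) y) / P ?k y"
            using eqx[rule_format, of m] bump_on[OF i(2) k, of g] by (simp only: Tm g_def)
          then have "a ((T ^^ ?k) y) * v ((T ^^ m) x) - b ((T ^^ ?k) y) * v ((T ^^ Suc m) x) = a ((T ^^ ?k) y) / P ?k y"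
            using DG[OF i(2), of ?k] Tm by (simp add: op_def)
          then have "P ?k y / a ((T ^^ ?k) y) * (a ((T ^^ ?k) y) * v ((T ^^ m) x) - b ((T ^^ ?k) y) * v ((T ^^ Suc m) x)) = 1"
            using P_bounds(3)[OF i(2), of ?k] coeff[OF i(2) k] k by simp
          then show ?thesis
            using coeff[OF i(2) k] P_Suc[of ?k y] by (simp add: right_diff_distrib mult_ac)
        qed
        have "(\<Sum>m<n. P (i + m) y * v ((T ^^ m) x) - P (i + Suc m) y * v ((T ^^ Suc m) x)) = of_nat n"
          using step by simp
        then have "P i y * v x - P (i + n) y * v ((T ^^ n) x) = of_nat n"
          by (subst (asm) sum_lessThan_telescope') simp
        then have "real n = cmod (P i y * v x - P (i + n) y * v ((T ^^ n) x))"
          by (metis norm_of_nat)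
        also have "\<dots> \<le> cmod (P i y) * cmod (v x) + cmod (P (i + n) y) * cmod (v ((T ^^ n) x))"
          by (metis norm_mult norm_triangle_ineq4)
        also have "\<dots> \<le> 2 * cmod (v x) + 2 * cmod (v ((T ^^ n) x))"
          using P_bounds(1)[OF i(2)] i by (intro add_mono mult_right_mono) auto
        finally show ?thesis using True n unfolding u by (simp add: field_simps)
      qed simp
    qed
    then have "nrm (indicator low) \<le> ennreal (2 / n) * nrm ?u"
      by (intro nrm_le_cmult) auto
    also have "nrm ?u \<le> nrm v + nrm (\<lambda>x. indicator low x * v ((T ^^ n) x))"
      using nrm_add[of "\<lambda>x. complex_of_real (cmod (v x))" "\<lambda>x. complex_of_real (cmod (indicator low x * v ((T ^^ n) x)))"]
      unfolding n2 by simp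
    also have "\<dots> \<le> nrm v + 2 * nrm v"
      by (intro add_left_mono nrm_comp_T) auto
    also have "\<dots> = (1 + 2) * nrm v" by (simp only: distrib_right mult_1)
    also have "(1 + 2 :: ennreal) = ennreal 3" by simp
    finally have "nrm (indicator low) \<le> ennreal (2 / n) * (ennreal 3 * nrm v)"
      by (simp add: mult_left_mono)
    also have "\<dots> = ennreal (2 / n * 3) * nrm v" by (subst ennreal_mult) (auto simp: mult.assoc)
    finally show ?thesis by simp
  qed
  show ?thesis using 1 2 fX(1) A0 by auto
qed

end

context shift_space
begin

text \<open>The bound A0 on |a| is common to all block lengths, so the ratios 20 A0/n and 6/n become
  arbitrarily small.\<close>

lemma not_invertible_orbit:
  assumes \<Omega>: "inv_set \<Omega>" and A0: "A0 > 0"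
    and block: "\<And>n. n > 0 \<Longrightarrow> \<exists>D l. orbit_block M \<rho> G T S d a b \<Omega> D n l A0"
  shows "\<not> right_inv \<Omega> \<and> \<not> left_inv \<Omega>"
proof -
  have large: "\<exists>n>0. c / real n \<le> \<epsilon>" if "c > 0" "\<epsilon> > 0" for c \<epsilon>
  proof -
    obtain n :: nat where "c / \<epsilon> < n" using reals_Archimedean2 by blast
    moreover have "c / \<epsilon> > 0" using that by simp
    ultimately have "n > 0" by (cases n) auto
    moreover have "c / n \<le> \<epsilon>" using \<open>c / \<epsilon> < n\<close> \<open>n > 0\<close> that by (simp add: divide_simps mult.commute)
    ultimately show ?thesis by blast
  qed
  have "\<not> left_inv \<Omega>"
  proof (rule not_left_invertibleI[OF \<Omega>])
    fix \<epsilon> :: real assume "\<epsilon> > 0"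
    then obtain n where n: "n > 0" "20 * A0 / real n \<le> \<epsilon>" using large[of "20 * A0" \<epsilon>] A0 by auto
    then obtain D l where "orbit_block M \<rho> G T S d a b \<Omega> D n l A0" using block by blast
    then obtain f where "f \<in> XS \<Omega>" "0 < nrm f" "nrm (op f) \<le> ennreal (20 * A0 / n) * nrm f"
      using orbit_block.left_test by blast
    moreover have "ennreal (20 * A0 / n) * nrm f \<le> ennreal \<epsilon> * nrm f"
      by (intro mult_right_mono ennreal_leI n(2)) simp
    ultimately show "\<exists>f\<in>XS \<Omega>. 0 < nrm f \<and> nrm (op f) \<le> ennreal \<epsilon> * nrm f"
      by (blast intro: order_trans)
  qed
  moreover have "\<not> right_inv \<Omega>"
  proof (rule not_right_invertibleI[of "20 * A0"])
    fix \<epsilon> :: real assume "\<epsilon> > 0"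
    then obtain n where n: "n > 0" "6 / real n \<le> \<epsilon>" using large[of 6 \<epsilon>] by auto
    then obtain D l where "orbit_block M \<rho> G T S d a b \<Omega> D n l A0" using block by blast
    then interpret orbit_block M \<rho> G T S d a b \<Omega> D n l A0 .
    obtain f where f: "f \<in> XS \<Omega>" "nrm f \<le> ennreal (20 * A0) * nrm (indicator low)"
      "\<And>v. v \<in> XS \<Omega> \<Longrightarrow> AE x in M. op v x = f x \<Longrightarrow> nrm (indicator low) \<le> ennreal (6 / n) * nrm v"
      using right_test by blast
    have "ennreal (6 / real n) * nrm v \<le> ennreal \<epsilon> * nrm v" for v
      by (intro mult_right_mono ennreal_leI \<open>6 / real n \<le> \<epsilon>\<close>) simp
    then show "\<exists>f\<in>XS \<Omega>. \<exists>\<mu>. 0 < \<mu> \<and> \<mu> < \<infinity> \<and> nrm f \<le> ennreal (20 * A0) * \<mu> \<and>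
      (\<forall>v\<in>XS \<Omega>. (AE x in M. op v x = f x) \<longrightarrow> \<mu> \<le> ennreal \<epsilon> * nrm v)"
      using f nrm_low by (blast intro: order_trans)
  qed (use A0 in simp)
  ultimately show ?thesis by blast
qed

end

section \<open>Arc length and the diffeomorphism\<close>

text \<open>A lift h is obtained by inverting a path and is at first only continuous. Projecting the
  curve onto the direction v gives real functions with \<phi> after h equal to \<psi>. The
  derivative of \<phi> is nonzero, so the difference quotient of h is that of \<psi> divided by a
  slope of \<phi>.\<close>

lemma has_real_derivative_lift:
  fixes h :: "real \<Rightarrow> real" and g k :: "real \<Rightarrow> complex"
  assumes g: "(g has_vector_derivative v) (at (h s))" and v: "v \<noteq> 0"
    and k: "(k has_vector_derivative of_real r * v) (at s within A)"
    and eq: "\<And>x. x \<in> A \<Longrightarrow> g (h x) = k x" and s: "s \<in> A"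
    and h: "continuous (at s within A) h"
  shows "(h has_field_derivative r) (at s within A)"
proof -
  define \<phi> where "\<phi> y = Re (cnj v * g y)" for y
  define \<psi> where "\<psi> y = Re (cnj v * k y)" for y
  have vv: "cnj v * v = of_real ((cmod v)\<^sup>2)" by (metis complex_norm_square mult.commute)
  have "((\<lambda>y. cnj v * g y) has_vector_derivative cnj v * v) (at (h s))"
    by (rule has_vector_derivative_mult_right[OF g])
  then have "(\<phi> has_vector_derivative Re (cnj v * v)) (at (h s))"
    unfolding \<phi>_def by (rule bounded_linear.has_vector_derivative[OF bounded_linear_Re])
  then have \<phi>': "DERIV \<phi> (h s) :> (cmod v)\<^sup>2"
    by (simp only: vv Re_complex_of_real has_real_derivative_iff_has_vector_derivative)
  have "((\<lambda>y. cnj v * k y) has_vector_derivative cnj v * (of_real r * v)) (at s within A)"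
    by (rule has_vector_derivative_mult_right[OF k])
  then have "(\<psi> has_vector_derivative Re (cnj v * (of_real r * v))) (at s within A)"
    unfolding \<psi>_def by (rule bounded_linear.has_vector_derivative[OF bounded_linear_Re])
  moreover have "cnj v * (of_real r * v) = of_real (r * (cmod v)\<^sup>2)"
    using vv by (simp add: mult.left_commute)
  ultimately have \<psi>': "(\<psi> has_field_derivative r * (cmod v)\<^sup>2) (at s within A)"
    by (simp only: Re_complex_of_real has_real_derivative_iff_has_vector_derivative)
  \<comment> \<open>The Caratheodory form of the derivative keeps the slope defined even where
    \<open>h x = h s\<close>.\<close>
  obtain c where c: "\<And>z. \<phi> z - \<phi> (h s) = c z * (z - h s)" "isCont c (h s)" "c (h s) = (cmod v)\<^sup>2"
    using \<phi>' unfolding CARAT_DERIV by blast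
  have ch: "((\<lambda>x. c (h x)) \<longlongrightarrow> (cmod v)\<^sup>2) (at s within A)"
    using isCont_tendsto_compose[OF c(2), of h "at s within A"] h c(3) by (simp add: continuous_within)
  have nz: "(cmod v)\<^sup>2 \<noteq> 0" using v by simp
  have "((\<lambda>x. (\<psi> x - \<psi> s) / (x - s) / c (h x)) \<longlongrightarrow> r * (cmod v)\<^sup>2 / (cmod v)\<^sup>2) (at s within A)"
    using \<psi>' unfolding has_field_derivative_iff by (rule tendsto_divide[OF _ ch nz])
  moreover have "eventually (\<lambda>x. (\<psi> x - \<psi> s) / (x - s) / c (h x) = (h x - h s) / (x - s)) (at s within A)"
  proof -
    have "eventually (\<lambda>x. c (h x) \<noteq> 0) (at s within A)"
      using tendsto_imp_eventually_ne[OF ch nz] .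
    moreover have "eventually (\<lambda>x. x \<in> A) (at s within A)" by (simp add: eventually_at_filter)
    ultimately show ?thesis
    proof eventually_elim
      case (elim x)
      have "\<psi> x - \<psi> s = c (h x) * (h x - h s)"
        using c(1)[of "h x"] eq[OF elim(2)] eq[OF s] by (simp add: \<phi>_def \<psi>_def)
      then show ?case using elim by simp
    qed
  qed
  ultimately have "((\<lambda>x. (h x - h s) / (x - s)) \<longlongrightarrow> r * (cmod v)\<^sup>2 / (cmod v)\<^sup>2) (at s within A)"
    by (rule Lim_transform_eventually)
  then show ?thesis using nz by (simp add: has_field_derivative_iff)
qed

lemma simple_path_inj_interior:
  assumes "simple_path u" "x \<in> {0<..<1}" "y \<in> {0..1}" "u x = u y"
  shows "x = y"
  using assms unfolding simple_path_def loop_free_def by force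

text \<open>The open interval is not compact, and the ends of a closed curve coincide. Adding both
  ends to a relatively closed set makes it compact; its image is then closed and meets the open arc
  only in the image of the original set, since interior points are hit once.\<close>

lemma continuous_on_inverse_simple_path:
  fixes u :: "real \<Rightarrow> 'a::t2_space"
  assumes u: "simple_path u"
  shows "continuous_on (u ` {0<..<1}) (inv_into {0<..<1} u)"
proof (rule continuous_on_inverse_closed_map)
  have c: "continuous_on {0..1} u" using u by (simp add: simple_path_def path_def)
  show "continuous_on {0<..<1} u" by (rule continuous_on_subset[OF c]) auto
  have inj: "inj_on u {0<..<1}" using simple_path_inj_interior[OF u] by (auto simp: inj_on_def)
  show "inv_into {0<..<1} u (u x) = x" if "x \<in> {0<..<1}" for x
    by (rule inv_into_f_f[OF inj that])
  fix U :: "real set" assume "closedin (top_of_set {0<..<1}) U"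
  then obtain C where C: "closed C" "U = {0<..<1} \<inter> C" by (auto simp: closedin_closed)
  have "compact ((C \<inter> {0..1}) \<union> {0, 1})" 
    using closed_Int_compact[OF C(1) compact_Icc, of 0 1] by (intro compact_Un) auto
  moreover have "continuous_on ((C \<inter> {0..1}) \<union> {0, 1}) u" by (rule continuous_on_subset[OF c]) auto
  ultimately have cl: "closed (u ` ((C \<inter> {0..1}) \<union> {0, 1}))"
    by (intro compact_imp_closed compact_continuous_image)
  have "u ` U = u ` {0<..<1} \<inter> u ` ((C \<inter> {0..1}) \<union> {0, 1})"
  proof
    show "u ` U \<subseteq> u ` {0<..<1} \<inter> u ` ((C \<inter> {0..1}) \<union> {0, 1})" using C(2) by auto
    show "u ` {0<..<1} \<inter> u ` ((C \<inter> {0..1}) \<union> {0, 1}) \<subseteq> u ` U"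
    proof
      fix t assume "t \<in> u ` {0<..<1} \<inter> u ` ((C \<inter> {0..1}) \<union> {0, 1})"
      then obtain x y where xy: "x \<in> {0<..<1}" "t = u x" "y \<in> (C \<inter> {0..1}) \<union> {0, 1}" "t = u y" by blast
      then have "x = y" by (intro simple_path_inj_interior[OF u]) auto
      then show "t \<in> u ` U" using xy C(2) by auto
    qed
  qed
  then show "closedin (top_of_set (u ` {0<..<1})) (u ` U)" using cl by (auto simp: closedin_closed)
qed auto

lemma AE_lebesgue_finite: "finite N \<Longrightarrow> AE s::real in lebesgue. s \<notin> N"
  by (intro AE_not_in) (simp add: negligible_iff_null_sets[symmetric] negligible_finite)

section \<open>Arc length as a finite nonatomic measure\<close>

locale jordan_curve =
  fixes g :: "real \<Rightarrow> complex"
  assumes smooth: "smooth_jordan_curve g"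
begin

abbreviation "G \<equiv> path_image g"
abbreviation "g' s \<equiv> vector_derivative g (at s)"
abbreviation "M \<equiv> arc_measure g"

lemma simple: "simple_path g"
  using smooth by (simp add: smooth_jordan_curve_def)

lemma g_deriv: "s \<in> {0..1} \<Longrightarrow> (g has_vector_derivative g' s) (at s)"
  using smooth by (auto simp: smooth_jordan_curve_def C1_differentiable_on_eq vector_derivative_works)

lemma g'_cont: "continuous_on {0..1} g'"
  using smooth by (auto simp: smooth_jordan_curve_def C1_differentiable_on_eq)

lemma g'_nz: "s \<in> {0..1} \<Longrightarrow> g' s \<noteq> 0"
  using smooth by (auto simp: smooth_jordan_curve_def)

lemma g_cont: "continuous_on {0..1} g"
  using simple by (simp add: simple_path_def path_def)

lemma G_compact: "compact G"
  using simple by (intro compact_path_image) (simp add: simple_path_def)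

lemma G_borel: "G \<in> sets borel"
  using G_compact by (simp add: borel_closed compact_imp_closed)

text \<open>Extended by 0, so that all lengths are integrals over the real line.\<close>

definition speed :: "real \<Rightarrow> real" where
  "speed s = (if s \<in> {0..1} then norm (g' s) else 0)"

lemma speed_nonneg [simp]: "speed s \<ge> 0"
  by (simp add: speed_def)

definition len :: "real set \<Rightarrow> ennreal" where
  "len A = (\<integral>\<^sup>+s. ennreal (speed s) * indicator A s \<partial>lebesgue)"

definition par :: "complex set \<Rightarrow> real set" where
  "par E = {0..1} \<inter> g -` E"

lemma par_borel: "E \<in> sets borel \<Longrightarrow> par E \<in> sets borel"
proof -
  assume E: "E \<in> sets borel"
  have "g \<in> borel_measurable (restrict_space borel {0..1})"
    by (rule borel_measurable_continuous_on_restrict[OF g_cont])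
  from measurable_sets[OF this E] show ?thesis
    by (auto simp: par_def sets_restrict_space space_restrict_space Int_commute)
qed

lemma speed_borel [measurable]: "speed \<in> borel_measurable borel"
  unfolding speed_def
  by (rule borel_measurable_continuous_on_if) (auto intro!: continuous_intros g'_cont)

lemma speed_lebesgue [measurable]: "speed \<in> borel_measurable lebesgue"
  using speed_borel by (simp add: measurable_completion)

lemma space_M [simp]: "space M = UNIV" and sets_M [simp]: "sets M = sets borel"
  by (simp_all add: arc_measure_def)

lemma emeasure_M: "E \<in> sets borel \<Longrightarrow> emeasure M E = len (par E)"
proof -
  assume E: "E \<in> sets borel"
  let ?N = "density (lebesgue_on {0..1}) (\<lambda>s. ennreal (norm (g' s)))"
  have gm: "g \<in> borel_measurable (lebesgue_on {0..1})"
    by (rule continuous_imp_measurable_on_sets_lebesgue[OF g_cont]) auto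
  have g'm: "(\<lambda>s. ennreal (norm (g' s))) \<in> borel_measurable (lebesgue_on {0..1})"
    by (intro measurable_compose[OF _ measurable_ennreal] continuous_imp_measurable_on_sets_lebesgue)
      (auto intro!: continuous_intros g'_cont)
  have gN: "g \<in> measurable ?N borel" using gm by simp
  have "emeasure M E = emeasure ?N (g -` E \<inter> space ?N)"
    unfolding arc_measure_def by (rule emeasure_distr[OF gN E])
  also have "\<dots> = (\<integral>\<^sup>+s. ennreal (norm (g' s)) * indicator (g -` E \<inter> {0..1}) s \<partial>lebesgue_on {0..1})"
    using measurable_sets[OF gm E] by (subst emeasure_density[OF g'm]) (auto simp: space_restrict_space)
  also have "\<dots> = (\<integral>\<^sup>+s. ennreal (norm (g' s)) * indicator (g -` E \<inter> {0..1}) s * indicator {0..1} s \<partial>lebesgue)"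
    by (rule nn_integral_restrict_space) auto
  also have "\<dots> = len (par E)"
    unfolding len_def by (rule nn_integral_cong) (auto simp: speed_def par_def indicator_def)
  finally show ?thesis .
qed

text \<open>This absorbs the ambiguity of the parameter at the junction of a closed curve and at the
  finitely many points sent there.\<close>

lemma len_spike:
  assumes "finite N" "\<And>s. s \<notin> N \<Longrightarrow> s \<in> A \<longleftrightarrow> s \<in> B"
  shows "len A = len B"
  unfolding len_def
  by (rule nn_integral_cong_AE, rule eventually_mono[OF AE_lebesgue_finite[OF assms(1)]])
    (use assms(2) in \<open>auto simp: indicator_def\<close>)

lemma speed_abs_integrable: "A \<in> sets lebesgue \<Longrightarrow> A \<subseteq> {0..1} \<Longrightarrow> speed absolutely_integrable_on A"
proof -
  assume A: "A \<in> sets lebesgue" "A \<subseteq> {0..1}"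
  have "continuous_on {0..1} speed"
    by (rule continuous_on_eq[of _ "\<lambda>s. norm (g' s)"]) (auto simp: speed_def intro!: continuous_intros g'_cont)
  then have "speed absolutely_integrable_on {0..1}" by (rule absolutely_integrable_continuous_real)
  then show ?thesis by (rule set_integrable_subset) (use A in auto)
qed

lemma len_eq_integral:
  assumes "A \<in> sets lebesgue" "A \<subseteq> {0..1}"
  shows "len A = ennreal (integral A speed)"
proof -
  have "(speed has_integral integral A speed) A"
    using speed_abs_integrable[OF assms] by (simp add: absolutely_integrable_on_def integrable_integral)
  then have "integral\<^sup>N lborel (\<lambda>x. indicator A x * speed x) = ennreal (integral A speed)"
    by (intro nn_integral_has_integral_lebesgue) simp_all
  then show ?thesis
    by (simp add: len_def nn_integral_completion mult.commute ennreal_mult' ennreal_indicator speed_nonneg)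
qed

lemma emeasure_M_finite: "emeasure M UNIV < \<infinity>"
proof -
  have "emeasure M UNIV = len {0..1}" by (simp add: emeasure_M par_def)
  then show ?thesis by (simp add: len_eq_integral)
qed

lemma emeasure_outside: "emeasure M (- G) = 0"
proof -
  have "par (- G) = {}" by (auto simp: par_def path_image_def)
  then show ?thesis using G_borel by (simp add: emeasure_M len_def borel_comp)
qed

text \<open>The length of the part of E traversed up to the parameter x depends continuously on x,
  so it takes every intermediate value.\<close>

lemma nonatomic:
  assumes E: "E \<in> sets borel" and c: "c \<le> emeasure M E"
  shows "\<exists>E'\<in>sets borel. E' \<subseteq> E \<and> emeasure M E' = c"
proof -
  let ?A = "par E"
  have A: "?A \<in> sets lebesgue" "?A \<subseteq> {0..1}" using par_borel[OF E] by (auto simp: par_def)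
  define f where "f s = (if s \<in> ?A then speed s else 0)" for s
  have fint: "f integrable_on {0..1}"
  proof -
    have "speed integrable_on ?A" using speed_abs_integrable[OF A] by (simp add: absolutely_integrable_on_def)
    then show ?thesis
      unfolding f_def by (subst integrable_restrict_Int) (use A in \<open>simp add: Int_absorb2\<close>)
  qed
  have int_f: "integral {0..x} f = integral (?A \<inter> {0..x}) speed" if "x \<in> {0..1}" for x
    unfolding f_def by (subst integral_restrict_Int) (simp add: Int_commute)
  have cont: "continuous_on {0..1} (\<lambda>x. integral {0..x} f)"
    by (rule indefinite_integral_continuous_1[OF fint])
  have "emeasure M E = ennreal (integral {0..1} f)"
    using int_f[of 1] A by (simp add: emeasure_M[OF E] len_eq_integral Int_absorb2)
  then obtain r where r: "c = ennreal r" "0 \<le> r" "r \<le> integral {0..1} f"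
  proof -
    have nonneg: "integral {0..1} f \<ge> 0" by (rule integral_nonneg[OF fint]) (auto simp: f_def speed_def)
    show thesis
    proof (cases c)
      case (real r)
      show thesis by (rule that[of r]) (use real c \<open>emeasure M E = _\<close> nonneg in auto)
    qed (use c \<open>emeasure M E = _\<close> in \<open>auto simp: top_unique\<close>)
  qed
  have "\<exists>x\<ge>0. x \<le> 1 \<and> integral {0..x} f = r"
    by (rule IVT') (use r cont in auto)
  then obtain x where x: "0 \<le> x" "x \<le> 1" "integral {0..x} f = r" by blast
  define E' where "E' = E \<inter> g ` {0..x}"
  have "compact (g ` {0..x})"
    by (rule compact_continuous_image) (use x in \<open>auto intro: continuous_on_subset[OF g_cont]\<close>)
  then have E': "E' \<in> sets borel" unfolding E'_def using E by (auto intro: borel_closed compact_imp_closed)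
  \<comment> \<open>On a closed curve the initial arc is also reached at the parameter 1, so the two
    parameter sets agree only up to the ends.\<close>
  have "len (par E') = len (?A \<inter> {0..x})"
  proof (rule len_spike[of "{0, 1}"])
    fix s :: real assume s: "s \<notin> {0, 1}"
    have "s \<in> {0..x}" if "s \<in> {0..1}" "g s \<in> g ` {0..x}"
    proof -
      obtain y where y: "y \<in> {0..x}" "g s = g y" using \<open>g s \<in> g ` {0..x}\<close> by blast
      then have "s = y" by (intro simple_path_inj_interior[OF simple]) (use s that x in auto)
      then show ?thesis using y by simp
    qed
    then show "s \<in> par E' \<longleftrightarrow> s \<in> ?A \<inter> {0..x}" by (auto simp: par_def E'_def)
  qed auto
  also have "\<dots> = ennreal r"
    using A x int_f[of x] by (subst len_eq_integral) auto
  finally have "emeasure M E' = c" using emeasure_M[OF E'] r by simp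
  then show ?thesis using E' by (auto simp: E'_def)
qed

lemma emeasure_ball_pos:
  assumes t: "t \<in> G" and r: "r > 0"
  shows "emeasure M (ball t r) > 0"
proof -
  obtain s where s: "s \<in> {0..1}" "t = g s" using t by (auto simp: path_image_def)
  obtain \<delta> where \<delta>: "\<delta> > 0" "\<And>x. x \<in> {0..1} \<Longrightarrow> dist x s < \<delta> \<Longrightarrow> dist (g x) (g s) < r"
    using g_cont s r unfolding continuous_on_iff by metis
  define A where "A = {max 0 (s - \<delta>) <..< min 1 (s + \<delta>)}"
  have A: "A \<subseteq> par (ball t r)" "A \<subseteq> {0..1}"
    using \<delta>(2) s by (auto simp: A_def par_def dist_commute dist_real_def abs_if)
  have Am: "A \<in> sets lebesgue" by (simp add: A_def)
  have "emeasure lebesgue A > 0" using s \<delta>(1) by (auto simp: A_def emeasure_lborel_Ioo)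
  show ?thesis
  proof (rule ccontr)
    assume "\<not> ?thesis"
    then have "len (par (ball t r)) = 0" by (simp add: emeasure_M)
    moreover have "len A \<le> len (par (ball t r))"
      unfolding len_def using A(1) by (intro nn_integral_mono) (auto simp: indicator_def)
    ultimately have "len A = 0" by simp
    then have "AE x in lebesgue. ennreal (speed x) * indicator A x = 0"
      unfolding len_def by (subst (asm) nn_integral_0_iff_AE) (use Am in measurable)
    then have "AE x in lebesgue. x \<notin> A"
      by (rule eventually_mono) (use A(2) g'_nz in \<open>auto simp: speed_def indicator_def split: if_splits\<close>)
    then have "emeasure lebesgue A = 0"
      by (subst (asm) AE_iff_null_sets[symmetric]) (auto simp: A_def)
    then show False using \<open>emeasure lebesgue A > 0\<close> by simp
  qed
qed

end


section \<open>The shift on the curve and its change of variables\<close>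

locale jordan_shift = jordan_curve g for g +
  fixes \<alpha> :: "complex \<Rightarrow> complex"
  assumes diffeo: "curve_diffeo G \<alpha>" and orient: "orientation_preserving g \<alpha>"
begin

text \<open>The identity outside the curve makes T and S mutually inverse on the whole
  plane.\<close>

definition T :: "complex \<Rightarrow> complex" where "T x = (if x \<in> G then \<alpha> x else x)"

definition S :: "complex \<Rightarrow> complex" where "S x = (if x \<in> G then inv_into G \<alpha> x else x)"

definition d :: "complex \<Rightarrow> real" where "d x = cmod (curve_deriv G \<alpha> x)"

lemma bij: "bij_betw \<alpha> G G"
  using diffeo by (simp add: curve_diffeo_def)

lemma \<alpha>_G: "x \<in> G \<Longrightarrow> \<alpha> x \<in> G" "x \<in> G \<Longrightarrow> inv_into G \<alpha> x \<in> G"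
  by (rule bij_betw_apply[OF bij], assumption, rule bij_betw_apply[OF bij_betw_inv_into[OF bij]])

lemma TG [simp]: "T x \<in> G \<longleftrightarrow> x \<in> G" and SG [simp]: "S x \<in> G \<longleftrightarrow> x \<in> G"
  by (simp_all add: T_def S_def \<alpha>_G)

lemma TS [simp]: "T (S x) = x" and ST [simp]: "S (T x) = x"
  by (simp_all add: T_def S_def \<alpha>_G bij_betw_inv_into_right[OF bij] bij_betw_inv_into_left[OF bij])

lemma \<alpha>_deriv: "t \<in> G \<Longrightarrow> (\<alpha> has_field_derivative curve_deriv G \<alpha> t) (at t within G)"
  using diffeo by (simp add: curve_diffeo_def curve_C1_def)

lemma cont_\<alpha>: "continuous_on G \<alpha>"
  using \<alpha>_deriv by (rule DERIV_continuous_on)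

lemma cont_inv: "continuous_on G (inv_into G \<alpha>)"
proof (rule DERIV_continuous_on)
  show "\<And>t. t \<in> G \<Longrightarrow> (inv_into G \<alpha> has_field_derivative curve_deriv G (inv_into G \<alpha>) t) (at t within G)"
    using diffeo by (simp add: curve_diffeo_def curve_C1_def)
qed

lemma cont_T: "continuous_on G T" and cont_S: "continuous_on G S"
  by (rule continuous_on_eq[OF cont_\<alpha>], simp add: T_def,
      rule continuous_on_eq[OF cont_inv], simp add: S_def)

lemma T_borel: "T \<in> borel_measurable borel" and S_borel: "S \<in> borel_measurable borel"
  unfolding T_def[abs_def] S_def[abs_def]
  by (rule borel_measurable_continuous_on_if[OF G_borel]; intro cont_\<alpha> cont_inv continuous_intros)+

lemma cont_d: "continuous_on G d"
  using diffeo unfolding d_def[abs_def] by (auto simp: curve_diffeo_def curve_C1_def intro!: continuous_intros)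

lemma d_pos: "x \<in> G \<Longrightarrow> d x > 0"
  using diffeo by (simp add: curve_diffeo_def d_def)

lemma d_bound: "\<exists>\<kappa>\<ge>1. \<forall>x\<in>G. d x \<le> \<kappa> \<and> 1 \<le> \<kappa> * d x"
proof -
  have ne: "G \<noteq> {}" by simp
  obtain M1 where M1: "\<And>x. x \<in> G \<Longrightarrow> d x \<le> d M1"
    using continuous_attains_sup[OF G_compact ne cont_d] by blast
  obtain m where m: "m \<in> G" "\<And>x. x \<in> G \<Longrightarrow> d m \<le> d x"
    using continuous_attains_inf[OF G_compact ne cont_d] by blast
  let ?\<kappa> = "max 1 (max (d M1) (1 / d m))"
  have "d x \<le> ?\<kappa> \<and> 1 \<le> ?\<kappa> * d x" if x: "x \<in> G" for x
  proof
    show "d x \<le> ?\<kappa>" using M1[OF x] by simp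
    have "1 = 1 / d m * d m" using d_pos[OF m(1)] by simp
    also have "\<dots> \<le> ?\<kappa> * d x" using m(2)[OF x] d_pos[OF m(1)] by (intro mult_mono) auto
    finally show "1 \<le> ?\<kappa> * d x" .
  qed
  then show ?thesis by (intro exI[of _ ?\<kappa>]) auto
qed

text \<open>An interior parameter is the only one for its point, so the choice hidden in the tangent
  is determined.\<close>

lemma tangent_eq:
  assumes s: "s \<in> {0<..<1}"
  shows "tangent g (g s) = g' s"
proof -
  have "(SOME r. r \<in> {0..1} \<and> g r = g s) = s"
    by (rule some_equality) (use s simple_path_inj_interior[OF simple s] in \<open>auto, metis\<close>)
  then show ?thesis by (simp add: tangent_def)
qed

text \<open>The derivative of the shift read in parameters: if g r = T (g s), this is dr/ds. It is
  real and positive by orientation, and differs from d by the ratio of the speeds at s and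
  r.\<close>

definition jac :: "complex \<Rightarrow> real" where
  "jac t = Re (curve_deriv G \<alpha> t * tangent g t / tangent g (\<alpha> t))"

lemma jac: "t \<in> G \<Longrightarrow> of_real (jac t) = curve_deriv G \<alpha> t * tangent g t / tangent g (\<alpha> t)"
  "t \<in> G \<Longrightarrow> jac t > 0"
  using orient by (auto simp: orientation_preserving_def jac_def complex_eq_iff)

lemma interior_image: "x \<in> G \<Longrightarrow> x \<noteq> g 0 \<Longrightarrow> x \<noteq> g 1 \<Longrightarrow> x \<in> g ` {0<..<1}"
  unfolding path_image_def by (force simp: less_eq_real_def)

lemma T_has_vector_derivative:
  assumes s: "s \<in> {0<..<1}" and r: "r \<in> {0<..<1}" "g r = T (g s)" and A: "A \<subseteq> {0..1}"
  shows "((\<lambda>x. T (g x)) has_vector_derivative of_real (jac (g s)) * g' r) (at s within A)"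
proof -
  have sG: "g s \<in> G" using s by (auto simp: path_image_def)
  have gA: "g ` A \<subseteq> G" using A by (auto simp: path_image_def)
  have "(g has_vector_derivative g' s) (at s within A)"
    using g_deriv[of s] s by (auto intro: has_vector_derivative_at_within)
  moreover have "(T has_field_derivative curve_deriv G \<alpha> (g s)) (at (g s) within g ` A)"
  proof (rule has_field_derivative_subset[OF _ gA])
    show "(T has_field_derivative curve_deriv G \<alpha> (g s)) (at (g s) within G)"
      by (rule has_field_derivative_transform_within[OF \<alpha>_deriv[OF sG], of 1]) (auto simp: T_def sG)
  qed
  ultimately have "(T \<circ> g has_vector_derivative g' s * curve_deriv G \<alpha> (g s)) (at s within A)"
    by (rule field_vector_diff_chain_within)
  moreover have "g' s * curve_deriv G \<alpha> (g s) = of_real (jac (g s)) * g' r"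
  proof -
    have "tangent g (\<alpha> (g s)) = g' r" using tangent_eq[OF r(1)] r(2) sG by (simp add: T_def)
    moreover have "g' r \<noteq> 0" using r by (intro g'_nz) auto
    ultimately show ?thesis using jac(1)[OF sG] tangent_eq[OF s] by (simp add: mult.commute)
  qed
  ultimately show ?thesis by (simp add: comp_def)
qed

text \<open>Change of variables for arc length. The shift is read in the parameter as an injective
  map h with derivative \<open>jac\<close>; its factor, the quotient of two speeds, turns the
  integral of the speed over the image into that of d times the speed.\<close>

lemma emeasure_image:
  assumes E: "E \<in> sets borel" "E \<subseteq> G"
  shows "emeasure M (S -` E) = (\<integral>\<^sup>+s. ennreal (d (g s) * speed s) * indicator (par E) s \<partial>lebesgue)"
proof -
  let ?I = "{0<..<1::real}"
  \<comment> \<open>The end points of the curve are removed together with their preimages: off them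
    every point has a unique interior parameter. Only finitely many parameters are lost.\<close>
  define e where "e = {g 0, g 1}"
  have e: "e \<subseteq> G" by (auto simp: e_def path_image_def)
  have g_e: "g s \<notin> e" if "s \<in> ?I" for s
    using simple_path_inj_interior[OF simple that, of 0] simple_path_inj_interior[OF simple that, of 1] that
    by (auto simp: e_def)
  have gI: "x \<in> g ` ?I" if "x \<in> G" "x \<notin> e" for x
    using interior_image that by (simp add: e_def)
  have inj: "inj_on g ?I" using simple_path_inj_interior[OF simple] by (auto simp: inj_on_def)
  have inv_g: "inv_into ?I g (g s) = s" if "s \<in> ?I" for s by (rule inv_into_f_f[OF inj that])
  have IG: "g s \<in> G" if "s \<in> ?I" for s using that by (auto simp: path_image_def)
  define A where "A = ?I \<inter> par (E \<inter> T -` (- e))"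
  define h where "h s = inv_into ?I g (T (g s))" for s
  have A_iff: "s \<in> A \<longleftrightarrow> s \<in> ?I \<and> g s \<in> E \<and> T (g s) \<notin> e" for s
    by (auto simp: A_def par_def)
  have h: "h s \<in> ?I" "g (h s) = T (g s)" if "s \<in> A" for s
  proof -
    have "T (g s) \<in> g ` ?I" using that IG by (intro gI) (auto simp: A_iff)
    then show "h s \<in> ?I" "g (h s) = T (g s)" by (simp_all only: h_def inv_into_into f_inv_into_f)
  qed
  have "E \<inter> T -` (- e) \<in> sets borel"
    using E measurable_sets[OF T_borel, of "- e"] by (auto simp: e_def)
  then have Am: "A \<in> sets lebesgue" unfolding A_def using par_borel by auto
  have fin: "finite {s \<in> ?I. f (g s) \<in> e}" if "inj f" for f
  proof -
    have "inj_on (\<lambda>s. f (g s)) ?I" using inj that by (auto simp: inj_on_def)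
    from finite_vimage_IntI[OF _ this, of e] show ?thesis
      by (simp add: e_def vimage_def Int_def conj_commute)
  qed
  have injTS: "inj T" "inj S" by (metis ST injI, metis TS injI)
  have hA_eq: "h ` A = ?I \<inter> par (S -` E \<inter> S -` (- e))"
  proof (intro set_eqI iffI)
    fix s assume "s \<in> h ` A"
    then obtain x where x: "x \<in> A" "s = h x" by blast
    then have "S (g s) = g x" using h(2)[OF x(1)] by simp
    then show "s \<in> ?I \<inter> par (S -` E \<inter> S -` (- e))"
      using x h(1)[OF x(1)] g_e[of x] by (auto simp: par_def A_iff)
  next
    fix s assume "s \<in> ?I \<inter> par (S -` E \<inter> S -` (- e))"
    then have sI: "s \<in> ?I" and SE: "S (g s) \<in> E" "S (g s) \<notin> e" by (auto simp: par_def)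
    then have "S (g s) \<in> g ` ?I" using E by (intro gI) auto
    then obtain x where x: "x \<in> ?I" "S (g s) = g x" by blast
    have Tx: "T (g x) = g s" using x(2)[symmetric] by simp
    have "x \<in> A" using x SE Tx g_e[OF sI] by (simp add: A_iff)
    moreover have "h x = s" using inv_g[OF sI] by (simp add: h_def Tx)
    ultimately show "s \<in> h ` A" by blast
  qed
  have "len (par (S -` E)) = len (h ` A)"
    by (rule len_spike[of "{0, 1} \<union> {s \<in> ?I. S (g s) \<in> e}"])
      (use fin[OF injTS(2)] in \<open>auto simp: hA_eq par_def\<close>)
  moreover have hA: "h ` A \<in> sets lebesgue" "h ` A \<subseteq> {0..1}"
  proof -
    have "S -` E \<inter> S -` (- e) \<in> sets borel"
      using measurable_sets[OF S_borel, of "- e"] measurable_sets[OF S_borel E(1)] by (auto simp: e_def)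
    then show "h ` A \<in> sets lebesgue" unfolding hA_eq using par_borel by auto
    show "h ` A \<subseteq> {0..1}" using h(1) by force
  qed
  ultimately have 1: "len (par (S -` E)) = ennreal (integral (h ` A) speed)"
    by (simp add: len_eq_integral)
  have h_cont: "continuous_on A h"
    unfolding h_def
  proof (rule continuous_on_compose2[OF continuous_on_inverse_simple_path[OF simple]])
    show "continuous_on A (\<lambda>s. T (g s))"
      by (rule continuous_on_compose2[OF cont_T continuous_on_subset[OF g_cont]])
        (use IG in \<open>auto simp: A_iff\<close>)
    show "(\<lambda>s. T (g s)) ` A \<subseteq> g ` {0<..<1}" using IG gI by (auto simp: A_iff)
  qed
  have der: "(h has_field_derivative jac (g s)) (at s within A)" if s: "s \<in> A" for s
  proof (rule has_real_derivative_lift[where g = g and k = "\<lambda>x. T (g x)" and v = "g' (h s)"])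
    have "h s \<in> {0..1}" using h(1)[OF s] by auto
    then show "(g has_vector_derivative g' (h s)) (at (h s))" "g' (h s) \<noteq> 0"
      by (rule g_deriv, rule g'_nz)
    show "((\<lambda>x. T (g x)) has_vector_derivative of_real (jac (g s)) * g' (h s)) (at s within A)"
      by (rule T_has_vector_derivative) (use s h[OF s] in \<open>auto simp: A_iff\<close>)
    show "continuous (at s within A) h" using h_cont s by (simp add: continuous_on_eq_continuous_within)
  qed (use s h in auto)
  have "inj_on h A"
  proof (rule inj_onI)
    fix x y assume xy: "x \<in> A" "y \<in> A" "h x = h y"
    then have "T (g x) = T (g y)" using h(2) by metis
    then have "g x = g y" by (metis ST)
    then show "x = y" using xy inj by (auto simp: A_iff inj_on_def)
  qed
  \<comment> \<open>One-dimensional change of variables for h on A, which needs only measurability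
    of A, injectivity, and the derivative within A.\<close>
  from has_absolute_integral_change_of_variables_1'[OF Am der this, of speed "integral (h ` A) speed"]
  have "(\<lambda>x. \<bar>jac (g x)\<bar> * speed (h x)) absolutely_integrable_on A"
    and I: "integral A (\<lambda>x. \<bar>jac (g x)\<bar> * speed (h x)) = integral (h ` A) speed"
    using speed_abs_integrable[OF hA] by blast+
  then have "((\<lambda>x. \<bar>jac (g x)\<bar> * speed (h x)) has_integral integral (h ` A) speed) A"
    by (metis absolutely_integrable_on_def integrable_integral)
  then have "integral\<^sup>N lborel (\<lambda>x. indicator A x * (\<bar>jac (g x)\<bar> * speed (h x))) = ennreal (integral (h ` A) speed)"
    by (intro nn_integral_has_integral_lebesgue) simp_all
  then have "ennreal (integral (h ` A) speed) = (\<integral>\<^sup>+x. ennreal (indicator A x * (\<bar>jac (g x)\<bar> * speed (h x))) \<partial>lebesgue)"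
    by (simp add: nn_integral_completion)
  also have "\<dots> = (\<integral>\<^sup>+s. ennreal (d (g s) * speed s) * indicator A s \<partial>lebesgue)"
  proof (rule nn_integral_cong)
    fix s
    show "ennreal (indicator A s * (\<bar>jac (g s)\<bar> * speed (h s))) = ennreal (d (g s) * speed s) * indicator A s"
    proof (cases "s \<in> A")
      case True
      have sI: "s \<in> ?I" using True by (simp add: A_iff)
      have "cmod (g' (h s)) \<noteq> 0" using g'_nz[of "h s"] h(1)[OF True] by auto
      \<comment> \<open>The tangents are unit-free here: they are the derivatives of g, so the speed
        at h s cancels the denominator.\<close>
      moreover have "of_real (jac (g s)) = curve_deriv G \<alpha> (g s) * g' s / g' (h s)"
        using jac(1)[OF IG[OF sI]] tangent_eq[OF sI] tangent_eq[OF h(1)[OF True]] h(2)[OF True] IG[OF sI]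
        by (simp add: T_def)
      then have "\<bar>jac (g s)\<bar> = cmod (curve_deriv G \<alpha> (g s)) * cmod (g' s) / cmod (g' (h s))"
        by (metis norm_divide norm_mult norm_of_real)
      ultimately show ?thesis using True sI h(1)[OF True] by (simp add: speed_def d_def)
    qed simp
  qed
  also have "\<dots> = (\<integral>\<^sup>+s. ennreal (d (g s) * speed s) * indicator (par E) s \<partial>lebesgue)"
  proof (rule nn_integral_cong_AE, rule eventually_mono[OF AE_lebesgue_finite])
    show "finite ({0, 1} \<union> {s \<in> ?I. T (g s) \<in> e})" using fin[OF injTS(1)] by simp
    fix s assume "s \<notin> {0, 1} \<union> {s \<in> ?I. T (g s) \<in> e}"
    then have "s \<in> A \<longleftrightarrow> s \<in> par E" by (auto simp: A_iff par_def)
    then show "ennreal (d (g s) * speed s) * indicator A s = ennreal (d (g s) * speed s) * indicator (par E) s"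
      by (simp add: indicator_def)
  qed
  finally show ?thesis using 1 emeasure_M measurable_sets[OF S_borel E(1)] by simp
qed

lemma emeasure_up:
  assumes E: "E \<in> sets borel" "E \<subseteq> G" and \<kappa>: "\<kappa> \<ge> 0" "\<And>x. x \<in> E \<Longrightarrow> d x \<le> \<kappa>"
  shows "emeasure M (S -` E) \<le> ennreal \<kappa> * emeasure M E"
proof -
  have [measurable]: "par E \<in> sets lebesgue" using par_borel[OF E(1)] by simp
  have "emeasure M (S -` E) \<le> (\<integral>\<^sup>+s. ennreal \<kappa> * (ennreal (speed s) * indicator (par E) s) \<partial>lebesgue)"
    unfolding emeasure_image[OF E]
    by (intro nn_integral_mono)
      (auto simp: indicator_def par_def ennreal_mult[OF \<kappa>(1), symmetric] intro!: ennreal_leI mult_right_mono \<kappa>(2))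
  also have "\<dots> = ennreal \<kappa> * emeasure M E"
    unfolding emeasure_M[OF E(1)] len_def by (rule nn_integral_cmult) measurable
  finally show ?thesis .
qed

lemma emeasure_low:
  assumes E: "E \<in> sets borel" "E \<subseteq> G" and \<kappa>: "\<kappa> \<ge> 0" "\<And>x. x \<in> E \<Longrightarrow> 1 \<le> \<kappa> * d x"
  shows "emeasure M E \<le> ennreal \<kappa> * emeasure M (S -` E)"
proof -
  \<comment> \<open>Continuity of d after g is available only on the parameter interval; the cut-off
    is Borel and agrees with it on \<open>par E\<close>.\<close>
  have "(\<lambda>s. if s \<in> {0..1} then d (g s) else 0) \<in> borel_measurable borel"
    by (rule borel_measurable_continuous_on_if)
      (auto intro!: continuous_on_compose2[OF cont_d g_cont] simp: path_image_def)
  then have dm: "(\<lambda>s. if s \<in> {0..1} then d (g s) else 0) \<in> borel_measurable lebesgue"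
    by (simp add: measurable_completion)
  have [measurable]: "par E \<in> sets lebesgue" using par_borel[OF E(1)] by simp
  have eq: "ennreal (d (g s) * speed s) * indicator (par E) s
      = ennreal ((if s \<in> {0..1} then d (g s) else 0) * speed s) * indicator (par E) s" for s
    by (auto simp: par_def indicator_def)
  have "emeasure M E \<le> (\<integral>\<^sup>+s. ennreal \<kappa> * (ennreal (d (g s) * speed s) * indicator (par E) s) \<partial>lebesgue)"
    unfolding emeasure_M[OF E(1)] len_def
  proof (rule nn_integral_mono)
    fix s
    have "speed s \<le> \<kappa> * (d (g s) * speed s)" if "g s \<in> E"
      using mult_right_mono[OF \<kappa>(2)[OF that] speed_nonneg[of s]] by (simp add: mult.assoc)
    then show "ennreal (speed s) * indicator (par E) s \<le> ennreal \<kappa> * (ennreal (d (g s) * speed s) * indicator (par E) s)"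
      using \<kappa>(1) by (auto simp: indicator_def par_def d_def ennreal_mult[symmetric] intro!: ennreal_leI)
  qed
  also have "\<dots> = ennreal \<kappa> * emeasure M (S -` E)"
    unfolding emeasure_image[OF E] eq by (rule nn_integral_cmult) (use dm in measurable)
  finally show ?thesis .
qed

end

section \<open>Fixed points and components\<close>

context jordan_shift
begin

lemma translate_has_vector_derivative:
  assumes f: "(f has_vector_derivative v) (at (x + c))" and ev: "\<forall>\<^sub>F y in nhds x. k y = f (y + c)"
  shows "(k has_vector_derivative v) (at x)"
proof -
  have "((\<lambda>y. y + c) has_vector_derivative 1) (at x)" by (auto intro!: derivative_eq_intros)
  from vector_diff_chain_at[OF this f] have "((\<lambda>y. f (y + c)) has_vector_derivative v) (at x)"
    by (simp add: comp_def)
  then show ?thesis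
    by (subst has_vector_derivative_cong_ev[where g = "\<lambda>y. f (y + c)"])
      (use ev eventually_nhds_x_imp_x[OF ev] in \<open>auto elim!: eventually_mono\<close>)
qed

text \<open>The curve may be reparametrised by a path u that is locally a translate of g, so the
  orientation hypothesis at a single point decides the monotonicity of the lift h.\<close>

lemma lift_strict_mono:
  assumes J: "is_interval J" "{0<..<1} \<subseteq> J" "J \<subseteq> {0..1}"
    and h: "\<And>x. x \<in> J \<Longrightarrow> h x \<in> J" "\<And>x. x \<in> J \<Longrightarrow> u (h x) = T (u x)" "continuous_on J h"
    and inj: "inj_on u J" and uG: "\<And>x. x \<in> J \<Longrightarrow> u x \<in> G"
    and F: "finite F" "\<And>x. x \<in> {0<..<1} - F \<Longrightarrow>
        \<exists>c. x + c \<in> {0<..<1} \<and> (\<forall>\<^sub>F y in nhds x. u y = g (y + c))"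
  shows "strict_mono_on J h"
proof -
  have injh: "inj_on h J"
  proof (rule inj_onI)
    fix x y assume xy: "x \<in> J" "y \<in> J" "h x = h y"
    then have "T (u x) = T (u y)" using h(2) by metis
    then have "u x = u y" by (metis ST)
    then show "x = y" using inj xy by (auto dest: inj_onD)
  qed
  \<comment> \<open>Both s and h s must avoid the junction and the ends. Injectivity of h leaves
    only finitely many bad s.\<close>
  let ?F = "F \<union> {0, 1}"
  have "finite (?F \<union> (h -` ?F \<inter> J))"
    using F(1) by (auto intro!: finite_vimage_IntI[OF _ injh] simp del: vimage_Un vimage_insert Un_insert_right)
  moreover have "infinite {0<..<1::real}" by (rule infinite_Ioo) simp
  ultimately obtain s where s: "s \<in> {0<..<1}" "s \<notin> ?F \<union> (h -` ?F \<inter> J)"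
    by (metis finite_subset subsetI)
  have sJ: "s \<in> J" using s J by blast
  have hs: "h s \<in> {0<..<1} - F" using h(1)[OF sJ] s sJ J(3) by force
  obtain c where c: "s + c \<in> {0<..<1}" "\<forall>\<^sub>F y in nhds s. u y = g (y + c)" using F(2)[of s] s by auto
  obtain c' where c': "h s + c' \<in> {0<..<1}" "\<forall>\<^sub>F y in nhds (h s). u y = g (y + c')" using F(2)[OF hs] by blast
  have us: "u s = g (s + c)" and uhs: "u (h s) = g (h s + c')"
    using eventually_nhds_x_imp_x[OF c(2)] eventually_nhds_x_imp_x[OF c'(2)] by auto
  let ?v = "g' (h s + c')"
  let ?r = "jac (u s)"
  have "(u has_vector_derivative ?v) (at (h s))"
    by (rule translate_has_vector_derivative[OF g_deriv c'(2)]) (use c' in auto)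
  moreover have "?v \<noteq> 0" using c' by (intro g'_nz) auto
  moreover have "((\<lambda>x. T (u x)) has_vector_derivative of_real ?r * ?v) (at s within J)"
  proof (rule has_vector_derivative_at_within, rule translate_has_vector_derivative)
    have "((\<lambda>x. T (g x)) has_vector_derivative of_real ?r * ?v) (at (s + c) within {0..1})"
      unfolding us by (rule T_has_vector_derivative) (use c c' uhs us h(2)[OF sJ] in auto)
    then show "((\<lambda>x. T (g x)) has_vector_derivative of_real ?r * ?v) (at (s + c))"
      using c(1) by (simp add: at_within_Icc_at)
    show "\<forall>\<^sub>F y in nhds s. T (u y) = T (g (y + c))" using c(2) by (rule eventually_mono) simp
  qed
  moreover have "continuous (at s within J) h" using h(3) sJ by (simp add: continuous_on_eq_continuous_within)
  ultimately have der: "(h has_field_derivative ?r) (at s within J)"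
    using h(2) sJ by (intro has_real_derivative_lift[where g = u and k = "\<lambda>x. T (u x)"]) auto
  have "?r > 0" using jac(2) uG[OF sJ] by blast
  from has_real_derivative_pos_inc_right[OF der this]
  obtain \<delta> where \<delta>: "\<delta> > 0" "\<And>y. 0 < y \<Longrightarrow> s + y \<in> J \<Longrightarrow> y < \<delta> \<Longrightarrow> h s < h (s + y)" by blast
  define y where "y = min (\<delta> / 2) ((1 - s) / 2)"
  have y: "y > 0" "y < \<delta>" "s + y \<in> J" using \<delta>(1) s J(2) by (auto simp: y_def min_def field_simps)
  have "h s < h (s + y)" using \<delta>(2) y by blast
  then have "\<not> strict_antimono_on J h" using sJ y by (force simp: monotone_on_def)
  then show ?thesis using injh injective_eq_monotone_map[OF J(1) h(3)] by blast
qed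

text \<open>An arc keeps its parametrisation: the lift is an increasing bijection of the closed
  interval, so it fixes the ends. A closed curve is cut open at the given fixed point, which then
  occupies both ends, and the shift acts on the open arc between them.\<close>

lemma exists_lift:
  assumes p: "p \<in> G" "T p = p"
  shows "\<exists>u h. simple_path u \<and> path_image u = G \<and> T (u 0) = u 0 \<and> T (u 1) = u 1 \<and>
      (\<forall>x\<in>{0<..<1}. h x \<in> {0<..<1} \<and> u (h x) = T (u x)) \<and> strict_mono_on {0<..<1} (h :: real \<Rightarrow> real)"
proof (cases "pathfinish g = pathstart g")
  case False
  have inj: "inj_on g {0..1}"
    using simple False unfolding simple_path_def loop_free_def inj_on_def pathfinish_def pathstart_def by metis
  define h where "h x = inv_into {0..1} g (T (g x))" for x
  have img: "g ` {0..1} = G" by (simp add: path_image_def)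
  have h: "h x \<in> {0..1}" "g (h x) = T (g x)" if "x \<in> {0..1}" for x
  proof -
    have "T (g x) \<in> g ` {0..1}" using that img by (metis TG imageI)
    then show "h x \<in> {0..1}" "g (h x) = T (g x)" by (simp_all only: h_def inv_into_into f_inv_into_f)
  qed
  have "continuous_on G (inv_into {0..1} g)"
    using continuous_on_inv[OF g_cont compact_Icc, of "inv_into {0..1} g"] inv_into_f_f[OF inj] img by simp
  then have hc: "continuous_on {0..1} h"
    unfolding h_def
  proof (rule continuous_on_compose2)
    show "continuous_on {0..1} (\<lambda>x. T (g x))"
      by (rule continuous_on_compose2[OF cont_T g_cont]) (use img in auto)
    show "(\<lambda>x. T (g x)) ` {0..1} \<subseteq> G" using img by auto
  qed
  have mono: "strict_mono_on {0..1} h"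
  proof (rule lift_strict_mono[where u = g and F = "{}"])
    show "\<exists>c. x + c \<in> {0<..<1} \<and> (\<forall>\<^sub>F y in nhds x. g y = g (y + c))" if "x \<in> {0<..<1} - {}" for x
      using that by (intro exI[of _ 0]) auto
  qed (use h hc inj img in \<open>auto simp: is_interval_cc\<close>)
  have surj: "\<exists>y\<in>{0..1}. h y = x" if "x \<in> {0..1}" for x
  proof -
    have "S (g x) \<in> g ` {0..1}" using that img by (metis SG imageI)
    then obtain y where y: "y \<in> {0..1}" "S (g x) = g y" by blast
    then have "g (h y) = g x" using h(2)[OF y(1)] by (metis TS)
    then have "h y = x" using inj_onD[OF inj _ h(1)[OF y(1)] that] by blast
    then show ?thesis using y by blast
  qed
  have h0: "h 0 = 0"
  proof -
    obtain y where y: "y \<in> {0..1}" "h y = 0" using surj[of 0] by auto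
    have "\<not> 0 < y" using strict_mono_onD[OF mono, of 0 y] y h(1)[of 0] by force
    then show ?thesis using y by simp
  qed
  have h1: "h 1 = 1"
  proof -
    obtain y where y: "y \<in> {0..1}" "h y = 1" using surj[of 1] by auto
    have "\<not> y < 1" using strict_mono_onD[OF mono, of y 1] y h(1)[of 1] by force
    then show ?thesis using y by simp
  qed
  have "h x \<in> {0<..<1}" if "x \<in> {0<..<1}" for x
    using strict_mono_onD[OF mono, of 0 x] strict_mono_onD[OF mono, of x 1] that h0 h1 by auto
  moreover have "strict_mono_on {0<..<1} h" using mono by (rule monotone_on_subset) auto
  ultimately show ?thesis
    using h(2)[of 0] h(2)[of 1] h0 h1 h(2) simple by (intro exI[of _ g] exI[of _ h]) auto
next
  case True
  obtain s0 where s0: "s0 \<in> {0..1}" "g s0 = p" using p by (auto simp: path_image_def)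
  define u where "u = shiftpath s0 g"
  have u: "simple_path u" "path_image u = G"
    unfolding u_def
    using simple_path_shiftpath[OF simple True, of s0] path_image_shiftpath[OF s0(1) True] s0(1) by simp_all
  have u01: "u 0 = p" "u 1 = p"
    using endpoints_shiftpath[OF True s0(1)] s0(2) by (simp_all add: u_def pathstart_def pathfinish_def)
  have inj: "inj_on u {0<..<1}" using simple_path_inj_interior[OF u(1)] by (auto simp: inj_on_def)
  have ne: "u x \<noteq> p" if "x \<in> {0<..<1}" for x
    using simple_path_inj_interior[OF u(1) that, of 0] that u01 by auto
  have uimg: "G = u ` {0..1}" using u(2) unfolding path_image_def[of u] by simp
  have img: "u ` {0<..<1} = G - {p}"
  proof (intro set_eqI iffI)
    fix t assume "t \<in> G - {p}"
    then obtain x where "x \<in> {0..1}" "t = u x" "t \<noteq> p" using uimg by auto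
    then show "t \<in> u ` {0<..<1}" using u01 by (force simp: less_eq_real_def)
  qed (use ne uimg in force)
  have Tne: "T t \<in> G - {p}" if "t \<in> G - {p}" for t using that p by (metis DiffD1 DiffD2 DiffI ST TG singletonD singletonI)
  define h where "h x = inv_into {0<..<1} u (T (u x))" for x
  have h: "h x \<in> {0<..<1}" "u (h x) = T (u x)" if "x \<in> {0<..<1}" for x
  proof -
    have "T (u x) \<in> u ` {0<..<1}" using Tne that unfolding img[symmetric] by blast
    then show "h x \<in> {0<..<1}" "u (h x) = T (u x)" by (simp_all only: h_def inv_into_into f_inv_into_f)
  qed
  have uc: "continuous_on {0..1} u" using u(1) by (simp add: simple_path_def path_def)
  have hc: "continuous_on {0<..<1} h"
    unfolding h_def
  proof (rule continuous_on_compose2[OF continuous_on_inverse_simple_path[OF u(1)]])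
    show "continuous_on {0<..<1} (\<lambda>x. T (u x))"
      by (rule continuous_on_compose2[OF cont_T continuous_on_subset[OF uc]]) (use img in auto)
    show "(\<lambda>x. T (u x)) ` {0<..<1} \<subseteq> u ` {0<..<1}" using Tne unfolding img[symmetric] by blast
  qed
  have "strict_mono_on {0<..<1} h"
  \<comment> \<open>At 1 - s0 the shifted path passes the junction of g; on either side of it the
    path is a translate of g, by s0 or by s0 - 1.\<close>
  proof (rule lift_strict_mono[where u = u and F = "{1 - s0}"])
    fix x assume x: "x \<in> {0<..<1} - {1 - s0}"
    show "\<exists>c. x + c \<in> {0<..<1} \<and> (\<forall>\<^sub>F y in nhds x. u y = g (y + c))"
    proof (cases "x < 1 - s0")
      case True
      have "\<forall>\<^sub>F y in nhds x. y < 1 - s0" using True by (intro eventually_nhds_in_open[of "{..<1 - s0}", simplified])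
      then have "\<forall>\<^sub>F y in nhds x. u y = g (y + s0)"
        by (rule eventually_mono) (auto simp: u_def shiftpath_def add.commute)
      then show ?thesis using x True s0(1) by (intro exI[of _ s0]) auto
    next
      case False
      then have "1 - s0 < x" using x by auto
      then have "\<forall>\<^sub>F y in nhds x. 1 - s0 < y" by (intro eventually_nhds_in_open[of "{1 - s0<..}", simplified])
      then have "\<forall>\<^sub>F y in nhds x. u y = g (y + (s0 - 1))"
        by (rule eventually_mono) (auto simp: u_def shiftpath_def algebra_simps)
      then show ?thesis using x \<open>1 - s0 < x\<close> s0(1) by (intro exI[of _ "s0 - 1"]) auto
    qed
  qed (use h hc inj img in \<open>auto simp: is_interval_oo\<close>)
  then show ?thesis using u u01 p h by (intro exI[of _ u] exI[of _ h]) auto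
qed

end

section \<open>Orbits and components of the moved set\<close>

locale lifted_shift = jordan_shift g \<alpha> for g \<alpha> +
  fixes u :: "real \<Rightarrow> complex" and h :: "real \<Rightarrow> real"
  assumes u_simple: "simple_path u" and u_image: "path_image u = G"
    and u_fixed: "T (u 0) = u 0" "T (u 1) = u 1"
    and h_in: "\<And>x. x \<in> {0<..<1} \<Longrightarrow> h x \<in> {0<..<1}"
    and u_h: "\<And>x. x \<in> {0<..<1} \<Longrightarrow> u (h x) = T (u x)"
    and h_mono: "strict_mono_on {0<..<1} h"
begin

text \<open>Its closure is \<Phi> and its complement in the curve is \<Lambda>, so it is the set
  \<Phi> - \<Lambda> of the theorem.\<close>

definition moved :: "complex set" where "moved = {t \<in> G. T t \<noteq> t}"

lemma u_cont: "continuous_on {0..1} u"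
  using u_simple by (simp add: simple_path_def path_def)

lemma u_connected: "connected I \<Longrightarrow> I \<subseteq> {0<..<1} \<Longrightarrow> connected (u ` I)"
  by (rule connected_continuous_image[OF continuous_on_subset[OF u_cont]]) auto

lemma u_G: "x \<in> {0..1} \<Longrightarrow> u x \<in> G"
  unfolding u_image[symmetric] by (simp add: path_image_def)

lemma G_param: "t \<in> G \<Longrightarrow> \<exists>x\<in>{0..1}. t = u x"
  unfolding u_image[symmetric] by (auto simp: path_image_def)

lemma moved_param: "t \<in> moved \<Longrightarrow> \<exists>x\<in>{0<..<1}. t = u x \<and> h x \<noteq> x"
proof -
  assume t: "t \<in> moved"
  then obtain x where x: "x \<in> {0..1}" "t = u x" using G_param[of t] by (auto simp: moved_def)
  then have "x \<in> {0<..<1}" using u_fixed t by (force simp: moved_def less_eq_real_def)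
  moreover have "h x \<noteq> x" using u_h[OF \<open>x \<in> {0<..<1}\<close>] t x by (auto simp: moved_def)
  ultimately show ?thesis using x by blast
qed

lemma u_moved_iff: "x \<in> {0<..<1} \<Longrightarrow> u x \<in> moved \<longleftrightarrow> h x \<noteq> x"
proof -
  assume x: "x \<in> {0<..<1}"
  have "u x \<in> G" using x by (intro u_G) auto
  moreover have "T (u x) = u x \<longleftrightarrow> h x = x"
    using u_h[OF x] simple_path_inj_interior[OF u_simple h_in[OF x], of x] x by auto
  ultimately show ?thesis by (simp add: moved_def)
qed

text \<open>Since h is increasing, iterating it from a point with h x > x gives a strictly
  increasing sequence, and from h x < x a strictly decreasing one. Hence there are no periodic
  orbits outside the fixed points.\<close>

lemma T_pow_distinct:
  assumes t: "t \<in> moved" and jk: "j \<noteq> k"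
  shows "(T ^^ j) t \<noteq> (T ^^ k) t"
proof -
  obtain x where x: "x \<in> {0<..<1}" "t = u x" "h x \<noteq> x" using moved_param[OF t] by blast
  have pow: "(h ^^ n) x \<in> {0<..<1} \<and> u ((h ^^ n) x) = (T ^^ n) t" for n
    by (induction n) (use x h_in u_h in auto)
  have "inj (\<lambda>n. (h ^^ n) x)"
  proof (cases "x < h x")
    case True
    have "(h ^^ n) x < (h ^^ Suc n) x" for n
    proof (induction n)
      case (Suc n)
      then show ?case using strict_mono_onD[OF h_mono, of "(h ^^ n) x" "(h ^^ Suc n) x"] pow[of n] pow[of "Suc n"] by simp
    qed (use True in simp)
    then have "strict_mono (\<lambda>n. (h ^^ n) x)" by (rule strict_mono_Suc_iff[THEN iffD2, rule_format])
    then show ?thesis by (rule strict_mono_imp_inj_on)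
  next
    case False
    have "(h ^^ Suc n) x < (h ^^ n) x" for n
    proof (induction n)
      case (Suc n)
      then show ?case using strict_mono_onD[OF h_mono, of "(h ^^ Suc n) x" "(h ^^ n) x"] pow[of n] pow[of "Suc n"] by simp
    qed (use False x in simp)
    then have "strict_mono (\<lambda>n. - (h ^^ n) x)" by (simp add: strict_mono_Suc_iff)
    then have "inj (\<lambda>n. - (h ^^ n) x)" by (rule strict_mono_imp_inj_on)
    then show ?thesis by (auto simp: inj_on_def)
  qed
  then have "(h ^^ j) x \<noteq> (h ^^ k) x" using jk by (auto dest: injD)
  then show ?thesis
    using simple_path_inj_interior[OF u_simple, of "(h ^^ j) x" "(h ^^ k) x"] pow[of j] pow[of k] by auto
qed

text \<open>A fixed parameter strictly between x and h x would be crossed by an increasing map that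
  keeps it in place.\<close>

lemma arc_moved:
  assumes x: "x \<in> {0<..<1}" "h x \<noteq> x" and y: "min x (h x) \<le> y" "y \<le> max x (h x)"
  shows "h y \<noteq> y" "y \<in> {0<..<1}"
proof -
  show y01: "y \<in> {0<..<1}" using x(1) h_in[OF x(1)] y by (auto simp: min_def max_def split: if_splits)
  show "h y \<noteq> y"
  proof
    assume hy: "h y = y"
    consider "x < y" | "y < x" | "x = y" by linarith
    then show False
    proof cases
      case 1
      then have "h x < y" using strict_mono_onD[OF h_mono x(1) y01] hy by simp
      with 1 y show ?thesis by (simp add: max_def split: if_splits)
    next
      case 2
      then have "y < h x" using strict_mono_onD[OF h_mono y01 x(1)] hy by simp
      with 2 y show ?thesis by (simp add: min_def split: if_splits)
    qed (use hy x in simp)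
  qed
qed

text \<open>The arc of parameters between x and h x contains no fixed point, so it joins a moved
  point to its image inside the moved set.\<close>

lemma component_invariant:
  assumes C: "C \<in> components moved"
  shows "T t \<in> C \<longleftrightarrow> t \<in> C"
proof -
  have *: "\<exists>c. connected c \<and> c \<subseteq> moved \<and> t \<in> c \<and> T t \<in> c" if t: "t \<in> moved" for t
  proof -
    obtain x where x: "x \<in> {0<..<1}" "t = u x" "h x \<noteq> x" using moved_param[OF t] by blast
    let ?I = "{min x (h x)..max x (h x)}"
    have I: "?I \<subseteq> {0<..<1}" "\<And>y. y \<in> ?I \<Longrightarrow> h y \<noteq> y" using arc_moved[OF x(1,3)] by auto
    have "connected (u ` ?I)"
      by (rule u_connected[OF _ I(1)]) (rule connected_Icc)
    moreover have "u ` ?I \<subseteq> moved" using I u_moved_iff by blast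
    moreover have "t \<in> u ` ?I" using x by auto
    moreover have "T t \<in> u ` ?I" using x(2) by (intro image_eqI[of _ _ "h x"]) (simp_all add: u_h[OF x(1)])
    ultimately show ?thesis by blast
  qed
  have Cm: "C \<subseteq> moved" by (rule in_components_subset[OF C])
  have mv: "T t \<in> moved \<longleftrightarrow> t \<in> moved" by (auto simp: moved_def) (metis ST)
  show ?thesis
  proof
    assume "t \<in> C"
    then obtain c where c: "connected c" "c \<subseteq> moved" "t \<in> c" "T t \<in> c" using * Cm by blast
    then show "T t \<in> C" using components_maximal[OF C c(1,2)] \<open>t \<in> C\<close> by blast
  next
    assume "T t \<in> C"
    then have "t \<in> moved" using Cm mv by blast
    then obtain c where c: "connected c" "c \<subseteq> moved" "t \<in> c" "T t \<in> c" using * by blast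
    then show "t \<in> C" using components_maximal[OF C c(1,2)] \<open>T t \<in> C\<close> by blast
  qed
qed

lemma fixed_closed: "closed (G - moved)"
proof -
  have "G - moved = {t \<in> G. T t - t = 0}" by (auto simp: moved_def)
  moreover have "closedin (top_of_set G) {t \<in> G. T t - t = 0}"
    by (rule continuous_closedin_preimage_constant) (intro continuous_intros cont_T)
  ultimately show ?thesis using G_compact closedin_closed_trans compact_imp_closed by metis
qed

lemma component_borel: "C \<in> components moved \<Longrightarrow> C \<in> sets borel"
proof -
  assume C: "C \<in> components moved"
  obtain D where D: "closed D" "C = moved \<inter> D"
    using closedin_component[OF C] by (auto simp: closedin_closed)
  have "moved = G - (G - moved)" by (auto simp: moved_def)
  then have "moved \<in> sets borel" using G_borel fixed_closed by (metis borel_closed sets.Diff)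
  then show ?thesis using D by (auto intro: borel_closed)
qed

text \<open>Components are relatively open in the curve. A short parameter interval around the point
  stays in its component, and a small ball excludes all other parameters.\<close>

lemma component_nbhd:
  assumes C: "C \<in> components moved" and t: "t \<in> C"
  obtains r where "r > 0" "G \<inter> ball t r \<subseteq> C"
proof -
  have tm: "t \<in> moved" using in_components_subset[OF C] t by blast
  obtain x where x: "x \<in> {0<..<1}" "t = u x" "h x \<noteq> x" using moved_param[OF tm] by blast
  have "open (- (G - moved))" by (rule open_Compl[OF fixed_closed])
  moreover have "t \<in> - (G - moved)" using tm by simp
  ultimately obtain e where e: "e > 0" "ball t e \<subseteq> - (G - moved)" by (rule openE)
  obtain \<delta> where \<delta>: "\<delta> > 0" "\<And>y. y \<in> {0..1} \<Longrightarrow> dist y x < \<delta> \<Longrightarrow> dist (u y) (u x) < e"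
    using u_cont e(1) x(1) unfolding continuous_on_iff by (metis atLeastAtMost_iff greaterThanLessThan_iff less_imp_le)
  let ?I = "{max 0 (x - \<delta>) <..< min 1 (x + \<delta>)}"
  have I: "?I \<subseteq> {0<..<1}" by auto
  have "connected (u ` ?I)"
    by (rule u_connected[OF _ I]) (rule connected_Ioo)
  moreover have "u ` ?I \<subseteq> moved"
  proof
    fix z assume "z \<in> u ` ?I"
    then obtain y where y: "y \<in> ?I" "z = u y" by blast
    have "dist (u y) (u x) < e" by (rule \<delta>(2)) (use y in \<open>auto simp: dist_real_def abs_if\<close>)
    then have "z \<in> ball t e" using x y by (simp add: dist_commute)
    moreover have "z \<in> G" using y u_G by auto
    ultimately show "z \<in> moved" using e by blast
  qed
  moreover have "x \<in> ?I" using x(1) \<delta>(1) by auto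
  ultimately have IC: "u ` ?I \<subseteq> C" using components_maximal[OF C] t x(2) by blast
  \<comment> \<open>The rest of the curve is compact and misses t, because the interior parameter x
    is the only one for t. So a ball around t meets the curve only in the chosen arc.\<close>
  let ?K = "u ` ({0..1} - ?I)"
  have "compact ({0..1} - ?I)" by (intro compact_diff compact_Icc open_greaterThanLessThan)
  then have "closed ?K"
    by (intro compact_imp_closed compact_continuous_image continuous_on_subset[OF u_cont Diff_subset])
  moreover have "t \<notin> ?K"
  proof
    assume "t \<in> ?K"
    then obtain y where y: "t = u y" "y \<in> {0..1} - ?I" by (rule imageE)
    have "x = y" by (rule simple_path_inj_interior[OF u_simple x(1)]) (use y x(2) in auto)
    then show False using y(2) \<open>x \<in> ?I\<close> by (metis DiffD2)
  qed
  ultimately have "open (- ?K)" "t \<in> - ?K" by (simp_all add: open_Compl)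
  then obtain r where r: "r > 0" "ball t r \<subseteq> - ?K" by (rule openE)
  have "G \<inter> ball t r \<subseteq> C"
  proof
    fix z assume z: "z \<in> G \<inter> ball t r"
    then obtain y where y: "y \<in> {0..1}" "z = u y" using G_param by blast
    have "z \<notin> ?K" using r z by blast
    then have "y \<in> ?I" using y by (metis DiffI imageI)
    then show "z \<in> C" using IC y by blast
  qed
  then show ?thesis using that r by blast
qed

text \<open>Infinitely many exceptional components would supply parameters outside U accumulating at
  some s. Two components have a boundary point between them, so boundary points accumulate at u s
  too, which places u s in U. But u s is a limit of points outside the open set U.\<close>

lemma finite_components_outside:
  assumes U: "open U" and lim: "\<And>\<tau>. \<tau> islimpt ((G - moved) \<inter> closure moved) \<Longrightarrow> \<tau> \<in> U"
  shows "finite {C \<in> components moved. \<not> C \<subseteq> U}"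
proof (rule ccontr)
  let ?K = "{C \<in> components moved. \<not> C \<subseteq> U}"
  assume inf: "infinite ?K"
  have "\<forall>C\<in>?K. \<exists>x. x \<in> {0<..<1} \<and> u x \<in> C \<and> u x \<notin> U"
  proof
    fix C assume C: "C \<in> ?K"
    then obtain t where t: "t \<in> C" "t \<notin> U" by blast
    then have "t \<in> moved" using in_components_subset C by blast
    then show "\<exists>x. x \<in> {0<..<1} \<and> u x \<in> C \<and> u x \<notin> U" using moved_param t by blast
  qed
  then obtain \<xi> where \<xi>: "\<And>C. C \<in> ?K \<Longrightarrow> \<xi> C \<in> {0<..<1} \<and> u (\<xi> C) \<in> C \<and> u (\<xi> C) \<notin> U"
    by metis
  have inj\<xi>: "inj_on \<xi> ?K"
  proof (rule inj_onI)
    fix C D assume CD: "C \<in> ?K" "D \<in> ?K" "\<xi> C = \<xi> D"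
    then have "u (\<xi> C) \<in> C \<inter> D" using \<xi>[OF CD(1)] \<xi>[OF CD(2)] by simp
    then have "C \<inter> D \<noteq> {}" by blast
    then show "C = D" using CD components_nonoverlap[of C moved D] by auto
  qed
  then have "infinite (\<xi> ` ?K)" using inf by (simp add: finite_image_iff)
  moreover have "\<xi> ` ?K \<subseteq> {0..1}" using \<xi> by force
  ultimately obtain s where s: "s \<in> {0..1}" "s islimpt (\<xi> ` ?K)"
    using compact_eq_Bolzano_Weierstrass[of "{0..1::real}"] by (metis compact_Icc)
  have usU: "u s \<notin> U"
  proof
    assume "u s \<in> U"
    then obtain e where e: "e > 0" "ball (u s) e \<subseteq> U" using U by (meson openE)
    obtain \<delta> where \<delta>: "\<delta> > 0" "\<And>y. y \<in> {0..1} \<Longrightarrow> dist y s < \<delta> \<Longrightarrow> dist (u y) (u s) < e"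
      using u_cont e(1) s(1) unfolding continuous_on_iff by metis
    obtain y where y: "y \<in> \<xi> ` ?K" "dist y s < \<delta>"
      using s(2) \<delta>(1) unfolding islimpt_approachable by blast
    then have "dist (u y) (u s) < e" by (intro \<delta>(2) subsetD[OF \<open>\<xi> ` ?K \<subseteq> {0..1}\<close>])
    then have "u y \<in> U" using e by (auto simp: dist_commute)
    then show False using y \<xi> by blast
  qed
  have "u s islimpt ((G - moved) \<inter> closure moved)"
    unfolding islimpt_approachable
  proof (intro allI impI)
    fix e :: real assume e: "e > 0"
    obtain \<delta> where \<delta>: "\<delta> > 0" "\<And>y. y \<in> {0..1} \<Longrightarrow> dist y s < \<delta> \<Longrightarrow> dist (u y) (u s) < e"
      using u_cont e s(1) unfolding continuous_on_iff by metis
    have "infinite (\<xi> ` ?K \<inter> ball s \<delta>)"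
      using s(2) \<delta>(1) unfolding islimpt_eq_infinite_ball by blast
    then have i: "infinite ((\<xi> ` ?K \<inter> ball s \<delta>) - {s})" by simp
    define P where "P = (\<xi> ` ?K \<inter> ball s \<delta>) - {s}"
    have P: "z \<in> \<xi> ` ?K" "dist z s < \<delta>" if "z \<in> P" for z
      using that by (auto simp: P_def dist_commute)
    have two: "\<exists>x\<in>A. \<exists>y\<in>A. x < y" if A: "infinite A" for A :: "real set"
    proof -
      obtain x where x: "x \<in> A" using infinite_imp_nonempty[OF A] by blast
      obtain y where "y \<in> A - {x}" using infinite_imp_nonempty[of "A - {x}"] A by auto
      then show ?thesis using x by (cases x y rule: linorder_cases) auto
    qed
    \<comment> \<open>Two parameters on the same side of s are needed, so that the boundary point
      found between them differs from u s.\<close>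
    have "P = (P \<inter> {s<..}) \<union> (P \<inter> {..<s})" by (auto simp: P_def)
    then have "infinite (P \<inter> {s<..}) \<or> infinite (P \<inter> {..<s})"
      using i unfolding P_def[symmetric] by (metis finite_Un)
    then obtain x y where xy: "x \<in> P" "y \<in> P" "x < y" "s < x \<or> y < s" using two by blast
    obtain C where C: "x = \<xi> C" "C \<in> ?K" using P(1)[OF xy(1)] by (rule imageE)
    obtain D where D: "y = \<xi> D" "D \<in> ?K" using P(1)[OF xy(2)] by (rule imageE)
    have xy01: "x \<in> {0<..<1}" "y \<in> {0<..<1}" "u x \<in> C" "u y \<in> D"
      using \<xi>[OF C(2)] \<xi>[OF D(2)] C(1) D(1) by simp_all
    have CDm: "C \<in> components moved" "D \<in> components moved" using C(2) D(2) by simp_all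
    have "C \<noteq> D" using C(1) D(1) xy(3) by auto
    have I01: "{x..y} \<subseteq> {0<..<1}" using xy01 by auto
    have fixed: "\<exists>z\<in>{x..y}. u z \<notin> moved"
    proof (rule ccontr)
      assume "\<not> ?thesis"
      then have sub: "u ` {x..y} \<subseteq> moved" by blast
      have con: "connected (u ` {x..y})"
        by (rule u_connected[OF _ I01]) (rule connected_Icc)
      have ends: "u x \<in> u ` {x..y}" "u y \<in> u ` {x..y}" using xy(3) by auto
      then have "C \<inter> u ` {x..y} \<noteq> {}" using xy01(3) by blast
      then have "u ` {x..y} \<subseteq> C" using components_maximal[OF CDm(1) con sub] by blast
      then have "C \<inter> D \<noteq> {}" using ends(2) xy01(4) by blast
      then show False using components_nonoverlap[OF CDm] \<open>C \<noteq> D\<close> by simp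
    qed
    let ?Z = "{z \<in> {x..y}. u z \<in> G - moved}"
    have "closedin (top_of_set {x..y}) ?Z"
      using fixed_closed I01 continuous_closedin_preimage[of "{x..y}" u "G - moved"]
        continuous_on_subset[OF u_cont, of "{x..y}"]
      by (force simp: vimage_def Int_def)
    then have "compact ?Z" using closedin_compact[of "{x..y}"] by blast
    moreover have uIG: "u z \<in> G" if "z \<in> {x..y}" for z
      using that I01 by (intro u_G) force
    then have "?Z \<noteq> {}" using fixed by blast
    \<comment> \<open>The first fixed parameter after x: everything before it is moved, so u z is a
      boundary point.\<close>
    ultimately obtain z where z: "z \<in> ?Z" "\<And>w. w \<in> ?Z \<Longrightarrow> z \<le> w"
      using compact_attains_inf[of ?Z] by blast
    have "u x \<in> moved" using xy01(3) in_components_subset[OF CDm(1)] by blast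
    then have "x \<noteq> z" using z by blast
    then have xz: "x < z" using z by auto
    have below: "u w \<in> moved" if "x \<le> w" "w < z" for w
      using z that uIG[of w] by force
    have "u z \<in> closure moved"
      unfolding closure_approachable
    proof (intro allI impI)
      fix e' :: real assume "e' > 0"
      have z01: "z \<in> {0..1}" using z I01 by force
      obtain \<delta>' where \<delta>': "\<delta>' > 0" "\<And>w. w \<in> {0..1} \<Longrightarrow> dist w z < \<delta>' \<Longrightarrow> dist (u w) (u z) < e'"
        using u_cont \<open>e' > 0\<close> z01 unfolding continuous_on_iff by metis
      define w where "w = max x (z - \<delta>' / 2)"
      have w: "x \<le> w" "w < z" "dist w z < \<delta>'" using xz \<delta>'(1) by (auto simp: w_def dist_real_def)
      then have "w \<in> {0..1}" using xy01 z01 by auto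
      then show "\<exists>y\<in>moved. dist y (u z) < e'" using below[OF w(1,2)] \<delta>'(2)[OF _ w(3)] by blast
    qed
    moreover have "dist (u z) (u s) < e"
    proof (rule \<delta>(2))
      show "z \<in> {0..1}" using z I01 by force
      have "dist x s < \<delta>" "dist y s < \<delta>" "x \<le> z" "z \<le> y" using P(2) xy(1,2) z(1) by auto
      then show "dist z s < \<delta>" by (auto simp: dist_real_def abs_if split: if_splits)
    qed
    moreover have "u z \<noteq> u s"
    proof
      assume "u z = u s"
      then have "z = s" using z I01 s(1) by (intro simple_path_inj_interior[OF u_simple]) auto
      then show False using xy(4) xz z by auto
    qed
    ultimately show "\<exists>x'\<in>(G - moved) \<inter> closure moved. x' \<noteq> u s \<and> dist x' (u s) < e"
      using z by blast
  qed
  then show False using lim usU by blast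
qed

end

section \<open>The invertibility criterion\<close>

text \<open>With \<open>nhds\<close> and a membership premise, several conditions on the curve
  combine directly by \<open>eventually_elim\<close>.\<close>

lemma continuous_on_nhds:
  fixes f :: "'a::topological_space \<Rightarrow> 'b::topological_space"
  assumes "continuous_on A f" "open B" "x \<in> A" "f x \<in> B"
  shows "\<forall>\<^sub>F y in nhds x. y \<in> A \<longrightarrow> f y \<in> B"
proof -
  obtain U where U: "open U" "U \<inter> A = f -` B \<inter> A"
    using assms(1,2) unfolding continuous_on_open_invariant by blast
  have "x \<in> U" using U(2) assms(3,4) by blast
  with U(1) have "\<forall>\<^sub>F y in nhds x. y \<in> U" by (rule eventually_nhds_in_open)
  then show ?thesis by (rule eventually_mono) (use U(2) in blast)
qed

lemma continuous_on_nhds_less: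
  fixes f k :: "'a::topological_space \<Rightarrow> real"
  assumes "continuous_on A f" "continuous_on A k" "x \<in> A" "f x < k x"
  shows "\<forall>\<^sub>F y in nhds x. y \<in> A \<longrightarrow> f y < k y"
proof -
  have "\<forall>\<^sub>F y in nhds x. y \<in> A \<longrightarrow> f y - k y \<in> {..<0}"
    by (rule continuous_on_nhds) (use assms in \<open>auto intro: continuous_intros\<close>)
  then show ?thesis by (rule eventually_mono) auto
qed

lemma continuous_on_open_less:
  fixes f k :: "'a::topological_space \<Rightarrow> real"
  assumes "continuous_on A f" "continuous_on A k"
  obtains U where "open U" "\<And>x. x \<in> A \<Longrightarrow> x \<in> U \<longleftrightarrow> f x < k x"
proof -
  have "continuous_on A (\<lambda>x. f x - k x)" using assms by (rule continuous_on_diff)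
  then obtain U where "open U" "U \<inter> A = (\<lambda>x. f x - k x) -` {..<0} \<inter> A"
    unfolding continuous_on_open_invariant by (metis open_lessThan)
  then show ?thesis by (intro that[of U]) (auto simp: set_eq_iff)
qed

lemma compact_pos_lower_bound:
  fixes f :: "'a::topological_space \<Rightarrow> real"
  assumes "compact K" "continuous_on K f" "\<And>x. x \<in> K \<Longrightarrow> 0 < f x"
  obtains c where "c > 0" "\<And>x. x \<in> K \<Longrightarrow> c \<le> f x"
proof (cases "K = {}")
  case False
  then obtain x where "x \<in> K" "\<And>y. y \<in> K \<Longrightarrow> f x \<le> f y"
    using continuous_attains_inf[OF assms(1) _ assms(2)] by blast
  then show ?thesis using that assms(3) by blast
qed (use that[of 1] in auto)

lemma connected_pos:
  fixes f :: "'a::topological_space \<Rightarrow> real"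
  assumes "connected C" "continuous_on C f" "\<And>x. x \<in> C \<Longrightarrow> f x \<noteq> 0" "x \<in> C" "y \<in> C" "0 < f x"
  shows "0 < f y"
proof (rule ccontr)
  assume "\<not> 0 < f y"
  then have "0 \<in> f ` C"
    using connectedD_interval[OF connected_continuous_image[OF assms(2,1)], of "f y" "f x" 0] assms(4-6) by simp
  then show False using assms(3) by auto
qed

locale shift_setting = lifted_shift g \<alpha> u h for g \<alpha> u h +
  fixes \<rho> :: "(complex \<Rightarrow> ennreal) \<Rightarrow> ennreal" and a b :: "complex \<Rightarrow> complex"
  assumes ri_M: "ri_space M \<rho>" and ca: "continuous_on G a" and cb: "continuous_on G b"
begin

text \<open>Extension by 0 off the curve, where the given coefficients are arbitrary, makes them
  Borel on the plane.\<close>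

definition a0 :: "complex \<Rightarrow> complex" where "a0 x = (if x \<in> G then a x else 0)"
definition b0 :: "complex \<Rightarrow> complex" where "b0 x = (if x \<in> G then b x else 0)"

lemma ca0: "continuous_on G a0" and cb0: "continuous_on G b0"
  by (rule continuous_on_eq[OF ca], simp add: a0_def, rule continuous_on_eq[OF cb], simp add: b0_def)

lemma ab_bound: "\<exists>B. \<forall>x\<in>G. cmod (a0 x) \<le> B \<and> cmod (b0 x) \<le> B"
proof -
  have "bounded (a0 ` G)" "bounded (b0 ` G)"
    using ca0 cb0 G_compact by (auto intro: compact_imp_bounded compact_continuous_image)
  then obtain B1 B2 where "\<forall>x\<in>G. cmod (a0 x) \<le> B1" "\<forall>x\<in>G. cmod (b0 x) \<le> B2"
    by (auto simp: bounded_iff)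
  then show ?thesis by (intro exI[of _ "max B1 B2"]) auto
qed

sublocale X: shift_space M \<rho> G T S d a0 b0
proof
  show "ri_space M \<rho>" by (rule ri_M)
  show "emeasure M UNIV < \<infinity>" by (rule emeasure_M_finite)
  show "\<exists>E'\<in>sets M. E' \<subseteq> E \<and> emeasure M E' = c" if "E \<in> sets M" "c \<le> emeasure M E" for E c
    using nonatomic[of E c] that by simp
  show "emeasure M (- G) = 0" by (rule emeasure_outside)
  show "T \<in> measurable M M" "S \<in> measurable M M"
    using T_borel S_borel by (simp_all add: measurable_def)
  have "a0 \<in> borel_measurable borel" "b0 \<in> borel_measurable borel"
    unfolding a0_def[abs_def] b0_def[abs_def]
    by (rule borel_measurable_continuous_on_if[OF G_borel]; intro ca cb continuous_intros)+
  then show "a0 \<in> borel_measurable M" "b0 \<in> borel_measurable M"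
    by (simp_all add: measurable_def)
  show "\<exists>\<kappa>\<ge>1. \<forall>x\<in>G. d x \<le> \<kappa> \<and> 1 \<le> \<kappa> * d x" by (rule d_bound)
  show "\<exists>B. \<forall>x\<in>G. cmod (a0 x) \<le> B \<and> cmod (b0 x) \<le> B" by (rule ab_bound)
qed (simp_all add: G_borel emeasure_up emeasure_low)

lemma op_eq: "shift_op G a b \<alpha> = X.op"
  by (intro ext) (simp add: shift_op_def X.op_def a0_def b0_def T_def)

lemma inv_G: "X.inv_set G"
  by (simp add: X.inv_set_def G_borel)

lemma moved_borel: "moved \<in> sets borel"
proof -
  have "moved = G - (G - moved)" by (auto simp: moved_def)
  then show ?thesis using G_borel fixed_closed by (metis borel_closed sets.Diff)
qed

lemma T_moved: "T x \<in> moved \<longleftrightarrow> x \<in> moved"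
  unfolding moved_def by (simp, metis ST)

lemma inv_component: "C \<in> components moved \<Longrightarrow> X.inv_set C"
  unfolding X.inv_set_def
  using component_borel component_invariant in_components_subset[of C moved] by (auto simp: moved_def)

section \<open>Necessity of the conditions\<close>

lemma T_pow_fixed: "T \<tau> = \<tau> \<Longrightarrow> (T ^^ k) \<tau> = \<tau>"
  by (induction k) auto

lemma cont_T_pow: "continuous_on G (T ^^ k)"
proof (induction k)
  case (Suc k)
  have "continuous_on G (\<lambda>x. T ((T ^^ k) x))"
    by (rule continuous_on_compose2[OF cont_T Suc]) auto
  then show ?case by (simp add: comp_def)
qed (simp add: id_def)

lemma ball_G: "t \<in> G \<Longrightarrow> r > 0 \<Longrightarrow> emeasure M (G \<inter> ball t r) > 0"
proof -
  assume "t \<in> G" "r > 0"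
  then have "0 < emeasure M (ball t r)" by (rule emeasure_ball_pos)
  also have "\<dots> = emeasure M (G \<inter> ball t r)"
    by (rule emeasure_eq_AE) (use X.AE_G G_borel in \<open>auto elim: eventually_mono\<close>)
  finally show ?thesis .
qed

text \<open>Along the fixed points every difference quotient equals 1.\<close>

lemma deriv_at_limit_of_fixed:
  assumes "\<tau> islimpt (G - moved)"
  shows "\<tau> \<in> G - moved" "curve_deriv G \<alpha> \<tau> = 1" "d \<tau> = 1"
proof -
  show \<tau>: "\<tau> \<in> G - moved" using assms fixed_closed by (simp add: closed_limpt)
  then have "(\<alpha> has_field_derivative curve_deriv G \<alpha> \<tau>) (at \<tau> within G - moved)"
    using \<alpha>_deriv by (blast intro: has_field_derivative_subset)
  then have "((\<lambda>y. (\<alpha> y - \<alpha> \<tau>) / (y - \<tau>)) \<longlongrightarrow> curve_deriv G \<alpha> \<tau>) (at \<tau> within G - moved)"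
    by (simp add: has_field_derivative_iff)
  moreover have "((\<lambda>y. (\<alpha> y - \<alpha> \<tau>) / (y - \<tau>)) \<longlongrightarrow> 1) (at \<tau> within G - moved)"
  proof (rule tendsto_eventually)
    show "\<forall>\<^sub>F y in at \<tau> within G - moved. (\<alpha> y - \<alpha> \<tau>) / (y - \<tau>) = 1"
      unfolding eventually_at_filter using \<tau> by (auto simp: moved_def T_def intro!: always_eventually)
  qed
  moreover have "at \<tau> within G - moved \<noteq> bot" using assms by (simp add: trivial_limit_within)
  ultimately show "curve_deriv G \<alpha> \<tau> = 1" by (metis tendsto_unique)
  then show "d \<tau> = 1" by (simp add: d_def)
qed

text \<open>If the coefficients vanish at \<tau>, both are small nearby; otherwise orbit blocks of
  any length start near \<tau>. The hypothesis \<open>near\<close> lets this apply both to the whole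
  curve and to a single component with \<tau> in its closure.\<close>

lemma not_invertible_at:
  assumes \<Omega>: "X.inv_set \<Omega>" and \<tau>: "\<tau> \<in> G" "T \<tau> = \<tau>" "d \<tau> = 1" and eq: "cmod (a \<tau>) = cmod (b \<tau>)"
    and near: "\<And>r. r > 0 \<Longrightarrow> \<exists>t\<in>moved \<inter> ball \<tau> r. \<exists>r'>0. G \<inter> ball t r' \<subseteq> \<Omega>"
  shows "\<not> X.right_inv \<Omega> \<and> \<not> X.left_inv \<Omega>"
proof -
  have eq0: "cmod (a0 \<tau>) = cmod (b0 \<tau>)" using eq \<tau>(1) by (simp add: a0_def b0_def)
  \<comment> \<open>A property valid near \<tau> is transferred to a neighbourhood of some moved
    point, where orbits do not return.\<close>
  have "\<exists>t\<in>moved. (\<forall>\<^sub>F x in nhds t. x \<in> G \<longrightarrow> x \<in> \<Omega> \<and> Q x)"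
    if Q: "\<forall>\<^sub>F x in nhds \<tau>. x \<in> G \<longrightarrow> Q x" for Q
  proof -
    obtain r where r: "r > 0" "\<And>x. dist x \<tau> < r \<Longrightarrow> x \<in> G \<Longrightarrow> Q x"
      using Q unfolding eventually_nhds_metric by blast
    obtain t r' where t: "t \<in> moved" "t \<in> ball \<tau> r" "r' > 0" "G \<inter> ball t r' \<subseteq> \<Omega>" using near[OF r(1)] by blast
    have "\<forall>\<^sub>F x in nhds t. x \<in> ball \<tau> r \<inter> ball t r'"
      by (rule eventually_nhds_in_open) (use t in auto)
    then have "\<forall>\<^sub>F x in nhds t. x \<in> G \<longrightarrow> x \<in> \<Omega> \<and> Q x"
    proof (rule eventually_mono, intro impI conjI)
      fix x assume x: "x \<in> ball \<tau> r \<inter> ball t r'" "x \<in> G"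
      show "x \<in> \<Omega>" using t(4) x by blast
      show "Q x" using r(2) x by (simp add: dist_commute)
    qed
    then show ?thesis using t(1) by blast
  qed
  note find = this
  \<comment> \<open>Such a neighbourhood contains a set of positive measure on which the property
    holds.\<close>
  have D: "\<exists>D\<in>sets M. D \<subseteq> \<Omega> \<and> emeasure M D > 0 \<and> (\<forall>x\<in>D. R x)"
    if t: "t \<in> moved" and ev: "\<forall>\<^sub>F x in nhds t. x \<in> G \<longrightarrow> x \<in> \<Omega> \<and> R x" for R t
  proof -
    obtain r where r: "r > 0" "\<And>x. dist x t < r \<Longrightarrow> x \<in> G \<Longrightarrow> x \<in> \<Omega> \<and> R x"
      using ev unfolding eventually_nhds_metric by blast
    have "t \<in> G" using t by (simp add: moved_def)
    then show ?thesis using r ball_G[of t r] G_borel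
      by (intro bexI[of _ "G \<inter> ball t r"]) (auto simp: dist_commute)
  qed
  show ?thesis
  proof (cases "a0 \<tau> = 0")
    case True
    then have b\<tau>: "b0 \<tau> = 0" using eq0 by simp
    have S\<tau>: "S \<tau> = \<tau>" using \<tau>(2) ST by metis
    have cbS: "continuous_on G (\<lambda>x. b0 (S x))"
      by (rule continuous_on_compose2[OF cb0 cont_S]) auto
    have "\<exists>D\<in>sets M. D \<subseteq> \<Omega> \<and> emeasure M D > 0 \<and>
        (\<forall>x\<in>D. cmod (a0 x) \<le> \<epsilon> \<and> cmod (b0 x) \<le> \<epsilon> \<and> cmod (b0 (S x)) \<le> \<epsilon>)" if \<epsilon>: "\<epsilon> > 0" for \<epsilon>
    proof -
      let ?Q = "\<lambda>x. cmod (a0 x) \<le> \<epsilon> \<and> cmod (b0 x) \<le> \<epsilon> \<and> cmod (b0 (S x)) \<le> \<epsilon>"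
      have "\<forall>\<^sub>F x in nhds \<tau>. x \<in> G \<longrightarrow> cmod (a0 x) < \<epsilon>" "\<forall>\<^sub>F x in nhds \<tau>. x \<in> G \<longrightarrow> cmod (b0 x) < \<epsilon>"
        "\<forall>\<^sub>F x in nhds \<tau>. x \<in> G \<longrightarrow> cmod (b0 (S x)) < \<epsilon>"
        by (rule continuous_on_nhds_less;
            use \<tau>(1) True b\<tau> S\<tau> \<epsilon> in \<open>auto intro!: continuous_intros ca0 cb0 cbS\<close>)+
      then have "\<forall>\<^sub>F x in nhds \<tau>. x \<in> G \<longrightarrow> ?Q x" by eventually_elim auto
      then show ?thesis by (rule bexE[OF find]) (rule D)
    qed
    then show ?thesis by (rule X.not_invertible_zero[OF \<Omega>])
  next
    case False
    define A0 where "A0 = cmod (a0 \<tau>) + 1"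
    have A0: "A0 > 0" by (simp add: A0_def add_nonneg_pos)
    have b\<tau>: "b0 \<tau> \<noteq> 0" using False eq0 by auto
    have "\<exists>D l. orbit_block M \<rho> G T S d a0 b0 \<Omega> D n l A0" if n: "n > 0" for n
    proof -
      \<comment> \<open>The largest ratio whose 3n-th power is at most 2. It exceeds 1, so the
        strict inequalities hold at \<tau>, where |a| = |b| and d = 1; since \<tau> is fixed, they
        persist nearby along the first 3n iterates.\<close>
      define l where "l = root (3 * n) 2"
      have l: "l > 1" "l ^ (3 * n) = 2" using n by (simp_all add: l_def)
      let ?Q = "\<lambda>y. cmod (a0 y) > 0 \<and> cmod (a0 y) < A0 \<and> cmod (a0 y) < l * cmod (b0 y) \<and>
          cmod (b0 y) < l * cmod (a0 y) \<and> d y < l \<and> 1 < l * d y"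
      have ev1: "\<forall>\<^sub>F x in nhds \<tau>. x \<in> G \<longrightarrow> ?Q ((T ^^ k) x)" for k
      proof -
        have c: "continuous_on G (\<lambda>x. f ((T ^^ k) x))" if "continuous_on G f" for f :: "complex \<Rightarrow> 'z::topological_space"
          by (rule continuous_on_compose2[OF that cont_T_pow]) auto
        note ct = c[OF ca0] c[OF cb0] c[OF cont_d]
        have v: "cmod (a0 \<tau>) < l * cmod (b0 \<tau>)" "cmod (b0 \<tau>) < l * cmod (a0 \<tau>)"
          using l(1) False b\<tau> eq0 by auto
        have "\<forall>\<^sub>F x in nhds \<tau>. x \<in> G \<longrightarrow> 0 < cmod (a0 ((T ^^ k) x))"
          "\<forall>\<^sub>F x in nhds \<tau>. x \<in> G \<longrightarrow> cmod (a0 ((T ^^ k) x)) < A0"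
          "\<forall>\<^sub>F x in nhds \<tau>. x \<in> G \<longrightarrow> cmod (a0 ((T ^^ k) x)) < l * cmod (b0 ((T ^^ k) x))"
          "\<forall>\<^sub>F x in nhds \<tau>. x \<in> G \<longrightarrow> cmod (b0 ((T ^^ k) x)) < l * cmod (a0 ((T ^^ k) x))"
          "\<forall>\<^sub>F x in nhds \<tau>. x \<in> G \<longrightarrow> d ((T ^^ k) x) < l"
          "\<forall>\<^sub>F x in nhds \<tau>. x \<in> G \<longrightarrow> 1 < l * d ((T ^^ k) x)"
          by (rule continuous_on_nhds_less;
              use \<tau>(1,3) False v l(1) in \<open>auto simp: T_pow_fixed[OF \<tau>(2)] A0_def intro!: continuous_intros ct\<close>)+
        then show ?thesis by eventually_elim auto
      qed
      have "\<forall>\<^sub>F x in nhds \<tau>. \<forall>k\<in>{..<3*n}. x \<in> G \<longrightarrow> ?Q ((T ^^ k) x)"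
        by (rule eventually_ball_finite) (use ev1 in auto)
      then have "\<forall>\<^sub>F x in nhds \<tau>. x \<in> G \<longrightarrow> (\<forall>k<3*n. ?Q ((T ^^ k) x))"
        by (rule eventually_mono) auto
      from find[OF this] obtain t where t: "t \<in> moved"
        "\<forall>\<^sub>F x in nhds t. x \<in> G \<longrightarrow> x \<in> \<Omega> \<and> (\<forall>k<3*n. ?Q ((T ^^ k) x))" by (rule bexE)
      have tG: "t \<in> G" using t(1) by (simp add: moved_def)
      \<comment> \<open>The orbit points of t are distinct. If D is so small that its j-th image
        stays within half of these distances from the j-th point, its images are disjoint by the
        triangle inequality.\<close>
      define \<delta> where "\<delta> j k = dist ((T ^^ j) t) ((T ^^ k) t)" for j k
      let ?pairs = "{(j, k). j \<le> 3 * n \<and> k \<le> 3 * n \<and> j \<noteq> k}"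
      have "\<forall>\<^sub>F x in nhds t. \<forall>p\<in>?pairs. x \<in> G \<longrightarrow> dist ((T ^^ fst p) x) ((T ^^ fst p) t) < \<delta> (fst p) (snd p) / 2"
      proof (rule eventually_ball_finite)
        have "?pairs \<subseteq> {..3*n} \<times> {..3*n}" by auto
        then show "finite ?pairs" by (rule finite_subset) simp
        show "\<forall>p\<in>?pairs. \<forall>\<^sub>F x in nhds t. x \<in> G \<longrightarrow> dist ((T ^^ fst p) x) ((T ^^ fst p) t) < \<delta> (fst p) (snd p) / 2"
        proof
          fix p assume "p \<in> ?pairs"
          then have "\<delta> (fst p) (snd p) > 0" using T_pow_distinct[OF t(1)] by (auto simp: \<delta>_def)
          then show "\<forall>\<^sub>F x in nhds t. x \<in> G \<longrightarrow> dist ((T ^^ fst p) x) ((T ^^ fst p) t) < \<delta> (fst p) (snd p) / 2"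
            by (intro continuous_on_nhds_less) (use tG cont_T_pow in \<open>auto intro!: continuous_intros\<close>)
        qed
      qed
      with t(2) have "\<forall>\<^sub>F x in nhds t. x \<in> G \<longrightarrow> x \<in> \<Omega> \<and> ((\<forall>k<3*n. ?Q ((T ^^ k) x)) \<and>
          (\<forall>p\<in>?pairs. dist ((T ^^ fst p) x) ((T ^^ fst p) t) < \<delta> (fst p) (snd p) / 2))"
        by eventually_elim blast
      from D[OF t(1) this] obtain D where D: "D \<in> sets M" "D \<subseteq> \<Omega>" "emeasure M D > 0"
        "\<And>x k. x \<in> D \<Longrightarrow> k < 3 * n \<Longrightarrow> ?Q ((T ^^ k) x)"
        "\<And>x p. x \<in> D \<Longrightarrow> p \<in> ?pairs \<Longrightarrow> dist ((T ^^ fst p) x) ((T ^^ fst p) t) < \<delta> (fst p) (snd p) / 2"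
        by blast
      have "orbit_block M \<rho> G T S d a0 b0 \<Omega> D n l A0"
      proof unfold_locales
        show "(S ^^ k) ((T ^^ j) x) \<notin> D" if x: "x \<in> D" and jk: "j \<le> 3 * n" "k \<le> 3 * n" "j \<noteq> k" for x j k
        proof
          let ?y = "(S ^^ k) ((T ^^ j) x)"
          assume y: "?y \<in> D"
          have "dist ((T ^^ j) x) ((T ^^ j) t) < \<delta> j k / 2" using D(5)[OF x, of "(j, k)"] jk by simp
          moreover have "dist ((T ^^ k) ?y) ((T ^^ k) t) < \<delta> k j / 2" using D(5)[OF y, of "(k, j)"] jk by simp
          moreover have "(T ^^ k) ?y = (T ^^ j) x" by simp
          moreover have "\<delta> k j = \<delta> j k" by (simp add: \<delta>_def dist_commute)
          ultimately have "dist ((T ^^ j) x) ((T ^^ j) t) + dist ((T ^^ j) x) ((T ^^ k) t) < \<delta> j k" by simp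
          then show False using dist_triangle3[of "(T ^^ j) t" "(T ^^ k) t" "(T ^^ j) x"] by (simp add: \<delta>_def)
        qed
      qed (use \<Omega> D n l A0 in \<open>force intro: less_imp_le\<close>)+
      then show ?thesis by blast
    qed
    then show ?thesis by (rule X.not_invertible_orbit[OF \<Omega> A0])
  qed
qed

abbreviation "bd \<equiv> (G - moved) \<inter> closure moved"

lemma closure_moved_G: "closure moved \<subseteq> G"
  using G_compact by (intro closure_minimal compact_imp_closed) (auto simp: moved_def)

lemma bd_closed: "closed bd"
  using fixed_closed by (intro closed_Int closed_closure)

lemma necessary_fixed:
  assumes t: "t \<in> G - closure moved" and eq: "a t = b t"
  shows "\<not> X.right_inv G \<and> \<not> X.left_inv G"
proof -
  have eq0: "a0 t = b0 t" using t eq by (simp add: a0_def b0_def)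
  have "\<exists>D\<in>sets M. D \<subseteq> G \<and> emeasure M D > 0 \<and> (\<forall>x\<in>D. T x = x \<and> cmod (a0 x - b0 x) \<le> \<epsilon>)"
    if \<epsilon>: "\<epsilon> > 0" for \<epsilon>
  proof -
    have "\<forall>\<^sub>F x in nhds t. x \<in> - closure moved"
      by (rule eventually_nhds_in_open) (use t in auto)
    moreover have "\<forall>\<^sub>F x in nhds t. x \<in> G \<longrightarrow> cmod (a0 x - b0 x) < \<epsilon>"
      by (rule continuous_on_nhds_less) (use t eq0 \<epsilon> in \<open>auto intro!: continuous_intros ca0 cb0\<close>)
    ultimately have "\<forall>\<^sub>F x in nhds t. x \<in> G \<longrightarrow> T x = x \<and> cmod (a0 x - b0 x) \<le> \<epsilon>"
    proof eventually_elim
      case (elim x)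
      then have "x \<notin> moved" using closure_subset by blast
      then show ?case using elim by (auto simp: moved_def)
    qed
    then obtain r where r: "r > 0" "\<And>x. dist x t < r \<Longrightarrow> x \<in> G \<Longrightarrow> T x = x \<and> cmod (a0 x - b0 x) \<le> \<epsilon>"
      unfolding eventually_nhds_metric by blast
    show ?thesis using r ball_G[of t r] t G_borel
      by (intro bexI[of _ "G \<inter> ball t r"]) (auto simp: dist_commute)
  qed
  then show ?thesis by (rule X.not_invertible_fixed[OF inv_G])
qed

lemma limpt_bd:
  assumes "\<tau> islimpt bd"
  shows "\<tau> \<in> bd" "curve_deriv G \<alpha> \<tau> = 1" "d \<tau> = 1" "T \<tau> = \<tau>"
proof -
  show "\<tau> \<in> bd" using bd_closed assms by (simp add: closed_limpt)
  then show "T \<tau> = \<tau>" by (auto simp: moved_def)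
  have "\<tau> islimpt (G - moved)" using assms by (rule islimpt_subset) auto
  then show "curve_deriv G \<alpha> \<tau> = 1" "d \<tau> = 1" by (rule deriv_at_limit_of_fixed)+
qed

lemma necessary_limit:
  assumes \<tau>: "\<tau> islimpt bd" and eq: "cmod (a \<tau>) = cmod (b \<tau>)"
  shows "\<not> X.right_inv G \<and> \<not> X.left_inv G"
proof -
  have "\<exists>t\<in>moved \<inter> ball \<tau> r. \<exists>r'>0. G \<inter> ball t r' \<subseteq> G" if r: "r > 0" for r
  proof -
    obtain t where "t \<in> moved" "dist t \<tau> < r"
      using limpt_bd(1)[OF \<tau>] r unfolding Int_iff closure_approachable by blast
    then show ?thesis by (intro bexI[of _ t] exI[of _ 1]) (auto simp: dist_commute)
  qed
  then show ?thesis
    using not_invertible_at[OF inv_G _ limpt_bd(4)[OF \<tau>] limpt_bd(3)[OF \<tau>] eq] limpt_bd(1)[OF \<tau>] by blast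
qed

text \<open>This serves the sufficiency direction: invertibility on one component already forces |a|
  and |b| to differ at its boundary points that are limits of fixed points.\<close>

lemma necessary_component:
  assumes C: "C \<in> components moved" and \<tau>: "\<tau> \<in> closure C" "\<tau> islimpt (G - moved)"
    and eq: "cmod (a \<tau>) = cmod (b \<tau>)"
  shows "\<not> X.right_inv C \<and> \<not> X.left_inv C"
proof -
  have near: "\<exists>t\<in>moved \<inter> ball \<tau> r. \<exists>r'>0. G \<inter> ball t r' \<subseteq> C" if r: "r > 0" for r
  proof -
    obtain t where t: "t \<in> C" "dist t \<tau> < r" using \<tau>(1) r unfolding closure_approachable by blast
    obtain r' where "r' > 0" "G \<inter> ball t r' \<subseteq> C" using component_nbhd[OF C t(1)] by blast
    moreover have "t \<in> moved \<inter> ball \<tau> r" using t in_components_subset[OF C] by (auto simp: dist_commute)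
    ultimately show ?thesis by blast
  qed
  have fix\<tau>: "\<tau> \<in> G" "T \<tau> = \<tau>" using deriv_at_limit_of_fixed(1)[OF \<tau>(2)] by (auto simp: moved_def)
  show ?thesis
    by (rule not_invertible_at[OF inv_component[OF C] fix\<tau> deriv_at_limit_of_fixed(3)[OF \<tau>(2)] eq near])
qed

section \<open>Sufficiency of the conditions\<close>

lemma emeasure_finite_set: "finite F \<Longrightarrow> AE x in M. x \<notin> F"
proof -
  assume F: "finite F"
  have "par F \<subseteq> {0, 1} \<union> ({0<..<1} \<inter> g -` F)" by (force simp: par_def less_eq_real_def)
  moreover have "finite ({0<..<1} \<inter> g -` F)"
    using finite_vimage_IntI[OF F, of g "{0<..<1}"] simple_path_inj_interior[OF simple]
    by (auto simp: inj_on_def Int_commute)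
  ultimately have "finite (par F)" by (metis finite.emptyI finite.insertI finite_UnI finite_subset)
  then have "len (par F) = len {}" by (rule len_spike) auto
  then have "emeasure M F = 0" using F by (simp add: emeasure_M finite_imp_closed len_def borel_closed)
  then have "F \<in> null_sets M" using F by (simp add: null_sets_def finite_imp_closed borel_closed)
  then show ?thesis by (rule AE_not_in)
qed

text \<open>K collects the finitely many components not contained in the good neighbourhood of the
  limit points. The others are sorted according to which of |a| and |b| is larger, one Neumann
  series for each group.\<close>

lemma components_near_limits_invertible:
  assumes lim: "\<And>\<tau>. \<tau> islimpt bd \<Longrightarrow> cmod (a \<tau>) \<noteq> cmod (b \<tau>)"
  obtains K V1 V2 where "finite K" "K \<subseteq> components moved" "X.inv_set V1" "X.inv_set V2"
    "V1 \<inter> V2 = {}" "V1 \<union> V2 = moved - \<Union>K"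
    "X.right_inv V1" "X.left_inv V1"
    "X.right_inv V2" "X.left_inv V2"
proof -
  define Y' where "Y' = {\<tau>. \<tau> islimpt bd}"
  define f where "f x = \<bar>cmod (a0 x) - cmod (b0 x)\<bar>" for x
  have cf: "continuous_on G f" unfolding f_def by (intro continuous_intros ca0 cb0)
  have Y'G: "Y' \<subseteq> G" using limpt_bd(1) by (auto simp: Y'_def)
  have "closed Y'" unfolding Y'_def by (rule closed_limpts)
  then have "compact Y'" using G_compact Y'G by (metis compact_Int_closed inf.absorb2)
  moreover have "0 < f x" if "x \<in> Y'" for x
    using lim[of x] Y'G that by (auto simp: f_def Y'_def a0_def b0_def)
  ultimately obtain c where c: "c > 0" "\<And>x. x \<in> Y' \<Longrightarrow> c \<le> f x"
    using compact_pos_lower_bound continuous_on_subset[OF cf Y'G] by metis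
  obtain B0 where B0: "\<And>x. x \<in> G \<Longrightarrow> cmod (a0 x) \<le> B0 \<and> cmod (b0 x) \<le> B0" using ab_bound by blast
  define B where "B = max B0 c"
  have B: "B \<ge> c" "\<And>x. x \<in> G \<Longrightarrow> cmod (a0 x) \<le> B" "\<And>x. x \<in> G \<Longrightarrow> cmod (b0 x) \<le> B"
    using B0 by (force simp: B_def)+
  \<comment> \<open>If p is the larger and q the smaller modulus, then p - q > c/2 = eB and p is at
    most B, so q is at most (1 - e)p. Derivatives are allowed to vary by the factor 1 + e, and (1 -
    e)(1 + e) < 1. Taking B at least c gives 1 - e > 0.\<close>
  define e where "e = c / (2 * B)"
  have e: "0 < e" "e \<le> 1 / 2" "e * B = c / 2" using c(1) B(1) by (auto simp: e_def field_simps)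
  have qk: "(1 - e) * (1 + e) < 1" using e(1) by (simp add: algebra_simps)
  obtain U1 where U1: "open U1" "\<And>x. x \<in> G \<Longrightarrow> x \<in> U1 \<longleftrightarrow> c / 2 < f x"
    using continuous_on_open_less[OF continuous_on_const cf] by metis
  obtain U2 where U2: "open U2" "\<And>x. x \<in> G \<Longrightarrow> x \<in> U2 \<longleftrightarrow> d x < 1 + e"
    using continuous_on_open_less[OF cont_d continuous_on_const] by metis
  have "continuous_on G (\<lambda>x. (1 + e) * d x)" by (intro continuous_intros cont_d)
  then obtain U3 where U3: "open U3" "\<And>x. x \<in> G \<Longrightarrow> x \<in> U3 \<longleftrightarrow> 1 < (1 + e) * d x"
    using continuous_on_open_less[OF continuous_on_const] by metis
  define U where "U = U1 \<inter> U2 \<inter> U3"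
  have U: "open U" using U1 U2 U3 by (simp add: U_def open_Int)
  have Y'U: "\<tau> \<in> U" if "\<tau> islimpt bd" for \<tau>
  proof -
    have "\<tau> \<in> G" "\<tau> \<in> Y'" using limpt_bd(1)[OF that] that by (auto simp: Y'_def)
    moreover have "c / 2 < f \<tau>" using c(1) c(2)[OF \<open>\<tau> \<in> Y'\<close>] by simp
    ultimately show ?thesis using U1(2) U2(2) U3(2) limpt_bd(3)[OF that] e(1) by (simp add: U_def)
  qed
  define K where "K = {C \<in> components moved. \<not> C \<subseteq> U}"
  have K: "finite K" "K \<subseteq> components moved"
    using finite_components_outside[OF U Y'U] by (auto simp: K_def)
  define V where "V = moved - \<Union>K"
  have V_comp: "\<exists>C\<in>components moved. x \<in> C \<and> C \<subseteq> U \<and> C \<subseteq> V" if "x \<in> V" for x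
  proof -
    have xm: "x \<in> moved" using that by (simp add: V_def)
    then have "x \<in> \<Union>(components moved)" by (metis Union_components)
    then obtain C where C: "C \<in> components moved" "x \<in> C" by blast
    then have "C \<notin> K" using that by (auto simp: V_def)
    then have "C \<subseteq> U" using C by (simp add: K_def)
    moreover have "C \<inter> C' = {}" if "C' \<in> K" for C'
      using components_nonoverlap[OF C(1), of C'] K(2) that \<open>C \<notin> K\<close> by blast
    then have "C \<subseteq> V" using in_components_subset[OF C(1)] by (auto simp: V_def)
    ultimately show ?thesis using C by blast
  qed
  have VG: "V \<subseteq> G" by (auto simp: V_def moved_def)
  have "\<Union>K \<in> sets borel" using K component_borel by (intro sets.finite_Union) auto
  then have Vb: "V \<in> sets borel" unfolding V_def using moved_borel by (rule sets.Diff[rotated])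
  define V1 where "V1 = {x \<in> V. cmod (b0 x) < cmod (a0 x)}"
  define V2 where "V2 = {x \<in> V. cmod (a0 x) < cmod (b0 x)}"
  have fV: "c / 2 < f x" "d x < 1 + e" "1 < (1 + e) * d x" if "x \<in> V" for x
  proof -
    have "x \<in> U" "x \<in> G" using V_comp[OF that] VG that by auto
    then show "c / 2 < f x" "d x < 1 + e" "1 < (1 + e) * d x"
      using U1(2) U2(2) U3(2) by (simp_all add: U_def)
  qed
  have V12: "V1 \<union> V2 = V" "V1 \<inter> V2 = {}"
    using fV(1) c(1) by (force simp: V1_def V2_def f_def)+
  have same: "T x \<in> C \<longleftrightarrow> x \<in> C" if "C \<in> components moved" for x C by (rule component_invariant[OF that])
  \<comment> \<open>The difference of the moduli has no zero on a connected component, so its sign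
    is constant there; with s = 1 and s = -1 this makes both \<open>V1\<close> and \<open>V2\<close>
    invariant.\<close>
  have sign: "0 < s * (cmod (a0 x) - cmod (b0 x)) \<longleftrightarrow> 0 < s * (cmod (a0 y) - cmod (b0 y))"
    if C: "C \<in> components moved" "C \<subseteq> V" "x \<in> C" "y \<in> C" and s: "s \<noteq> 0" for C x y s
  proof -
    have con: "connected C" by (rule in_components_connected[OF C(1)])
    have cont: "continuous_on C (\<lambda>x. s * (cmod (a0 x) - cmod (b0 x)))"
      using C(2) VG by (intro continuous_intros continuous_on_subset[OF ca0] continuous_on_subset[OF cb0]) auto
    have nz: "s * (cmod (a0 x) - cmod (b0 x)) \<noteq> 0" if "x \<in> C" for x
      using fV(1)[of x] C(2) that c(1) s by (auto simp: f_def)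
    show ?thesis using connected_pos[OF con cont nz] C(3,4) by blast
  qed
  have V_inv: "T x \<in> V \<longleftrightarrow> x \<in> V" for x
    using T_moved[of x] same[of _ x] K(2) unfolding V_def by blast
  have V1i: "T x \<in> V1 \<longleftrightarrow> x \<in> V1" and V2i: "T x \<in> V2 \<longleftrightarrow> x \<in> V2" for x
  proof -
    consider "x \<notin> V" | C where "C \<in> components moved" "C \<subseteq> V" "x \<in> C" "T x \<in> C"
      using V_comp[of x] same by blast
    then have "(T x \<in> V1 \<longleftrightarrow> x \<in> V1) \<and> (T x \<in> V2 \<longleftrightarrow> x \<in> V2)"
    proof cases
      case 1 then show ?thesis using V_inv[of x] by (auto simp: V1_def V2_def)
    next
      case 2
      then show ?thesis using sign[OF 2(1-4), of 1] sign[OF 2(1-4), of "-1"]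
        by (auto simp: V1_def V2_def)
    qed
    then show "T x \<in> V1 \<longleftrightarrow> x \<in> V1" "T x \<in> V2 \<longleftrightarrow> x \<in> V2" by blast+
  qed
  have meas: "{x. cmod (b0 x) < cmod (a0 x)} \<in> sets M" "{x. cmod (a0 x) < cmod (b0 x)} \<in> sets M"
    using X.a X.b borel_measurable_less[of "\<lambda>x. cmod (b0 x)" M "\<lambda>x. cmod (a0 x)"]
      borel_measurable_less[of "\<lambda>x. cmod (a0 x)" M "\<lambda>x. cmod (b0 x)"] by auto
  have "V1 = V \<inter> {x. cmod (b0 x) < cmod (a0 x)}" "V2 = V \<inter> {x. cmod (a0 x) < cmod (b0 x)}"
    by (auto simp: V1_def V2_def)
  then have "V1 \<in> sets M" "V2 \<in> sets M" using Vb meas by auto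
  then have inv: "X.inv_set V1" "X.inv_set V2"
    using V1i V2i VG by (auto simp: X.inv_set_def V1_def V2_def)
  have dom: "q \<le> (1 - e) * p" if "p \<le> B" "c / 2 < p - q" for p q :: real
  proof -
    have "e * p \<le> e * B" using that(1) e(1) by (intro mult_left_mono) auto
    then show ?thesis using that(2) e(3) by (simp add: algebra_simps)
  qed
  have V1_dom: "c / 2 \<le> cmod (a0 x)" "cmod (b0 x) \<le> (1 - e) * cmod (a0 x)" "1 \<le> (1 + e) * d x"
    if "x \<in> V1" for x
  proof -
    have x: "x \<in> V" "cmod (b0 x) < cmod (a0 x)" "x \<in> G" using that VG by (auto simp: V1_def)
    then have gap: "c / 2 < cmod (a0 x) - cmod (b0 x)" using fV(1)[OF x(1)] by (simp add: f_def)
    then show "c / 2 \<le> cmod (a0 x)" using norm_ge_zero[of "b0 x"] by linarith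
    show "cmod (b0 x) \<le> (1 - e) * cmod (a0 x)" by (rule dom[OF B(2)[OF x(3)] gap])
    show "1 \<le> (1 + e) * d x" using fV(3)[OF x(1)] by simp
  qed
  have par: "c / 2 > 0" "0 \<le> 1 - e" "1 \<le> 1 + e" using c(1) e by auto
  note V1 = X.invertible_dominant_a[OF inv(1) par(1) V1_dom(1) par(2) V1_dom(2) par(3) qk V1_dom(3)]
  have V2_dom: "c / 2 \<le> cmod (b0 x)" "cmod (a0 x) \<le> (1 - e) * cmod (b0 x)" "d x \<le> 1 + e"
    if "x \<in> V2" for x
  proof -
    have x: "x \<in> V" "cmod (a0 x) < cmod (b0 x)" "x \<in> G" using that VG by (auto simp: V2_def)
    then have gap: "c / 2 < cmod (b0 x) - cmod (a0 x)" using fV(1)[OF x(1)] by (simp add: f_def)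
    then show "c / 2 \<le> cmod (b0 x)" using norm_ge_zero[of "a0 x"] by linarith
    show "cmod (a0 x) \<le> (1 - e) * cmod (b0 x)" by (rule dom[OF B(3)[OF x(3)] gap])
    show "d x \<le> 1 + e" using fV(2)[OF x(1)] by simp
  qed
  have par: "c / 2 > 0" "0 \<le> 1 - e" "1 \<le> 1 + e" using c(1) e by auto
  note V2 = X.invertible_dominant_b[OF inv(2) par(1) V2_dom(1) par(2) V2_dom(2) par(3) qk V2_dom(3)]
  show ?thesis by (rule that[OF K inv V12(2) V12(1)[unfolded V_def] V1[THEN conjunct1] V1[THEN conjunct2]
        V2[THEN conjunct1] V2[THEN conjunct2]])
qed

text \<open>On the fixed set the operator multiplies by a - b. A pointwise inequality is not enough;
  the bound from below comes from compactness of a set Z that leaves out only finitely many points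
  beyond a neighbourhood.\<close>

lemma fixed_part_invertible:
  assumes comp: "\<And>C \<tau>. C \<in> components moved \<Longrightarrow> \<tau> \<in> closure C \<Longrightarrow> \<tau> islimpt (G - moved) \<Longrightarrow> cmod (a \<tau>) \<noteq> cmod (b \<tau>)"
    and ii: "\<And>t. t \<in> G - closure moved \<Longrightarrow> a t \<noteq> b t"
    and lim: "\<And>\<tau>. \<tau> islimpt bd \<Longrightarrow> cmod (a \<tau>) \<noteq> cmod (b \<tau>)"
  shows "X.inv_set (G - moved)" "X.right_inv (G - moved)" "X.left_inv (G - moved)"
proof -
  define Y' where "Y' = {\<tau>. \<tau> islimpt bd}"
  have Y'c: "closed Y'" unfolding Y'_def by (rule closed_limpts)
  have Y'G: "Y' \<subseteq> G - moved" using limpt_bd(1) by (auto simp: Y'_def)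
  \<comment> \<open>Exactly the points of the fixed set where a and b are forced to differ on a
    closed set: the closure of the complement of \<Phi>, and the limit points of the
    boundary.\<close>
  define Z where "Z = closure (G - closure moved) \<union> Y'"
  have "G - closure moved \<subseteq> G - moved" using closure_subset by blast
  then have clF: "closure (G - closure moved) \<subseteq> G - moved" using fixed_closed by (rule closure_minimal)
  have ZF: "Z \<subseteq> G - moved" using clF Y'G by (auto simp: Z_def)
  have "closed Z" unfolding Z_def using Y'c by auto
  then have Zc: "compact Z" using G_compact ZF by (metis Diff_subset compact_Int_closed inf.absorb2 order_trans)
  have pos: "0 < cmod (a0 x - b0 x)" if x: "x \<in> Z" for x
  proof -
    have "a x \<noteq> b x"
    proof (cases "x \<in> Y' \<or> x \<in> G - closure moved")
      case True
      then show ?thesis using lim[of x] ii[of x] by (auto simp: Y'_def)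
    next
      case False
      then have xcl: "x \<in> closure (G - closure moved)" "x \<notin> G - closure moved" using x by (auto simp: Z_def)
      then have "x islimpt (G - closure moved)" by (auto simp: closure_def)
      then have l: "x islimpt (G - moved)" by (rule islimpt_subset) fact
      have xcm: "x \<in> closure moved" using xcl clF by blast
      \<comment> \<open>Near such a point the boundary does not accumulate, so a small ball meets
        only finitely many components. The point is then in the closure of one of them, while also
        being a limit of fixed points.\<close>
      have "open (- Y')" "x \<in> - Y'" using Y'c False by auto
      then obtain r where r: "r > 0" "cball x r \<subseteq> - Y'" by (meson open_contains_cball)
      let ?K = "{C \<in> components moved. \<not> C \<subseteq> - cball x r}"
      have finK: "finite ?K"
        by (rule finite_components_outside) (use r(2) in \<open>auto simp: Y'_def\<close>)
      have "moved \<inter> ball x r \<subseteq> \<Union>?K"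
      proof
        fix t assume t: "t \<in> moved \<inter> ball x r"
        then have "t \<in> \<Union>(components moved)" by (metis IntD1 Union_components)
        then obtain C where "C \<in> components moved" "t \<in> C" by blast
        moreover have "t \<in> cball x r" using t by auto
        ultimately show "t \<in> \<Union>?K" by blast
      qed
      moreover have "x \<in> closure (moved \<inter> ball x r)"
      proof -
        have "ball x r \<inter> closure moved \<subseteq> closure (ball x r \<inter> moved)" by (rule open_Int_closure_subset) simp
        then show ?thesis using xcm r(1) by (auto simp: Int_commute)
      qed
      ultimately have "x \<in> closure (\<Union>?K)" using closure_mono by blast
      also have "closure (\<Union>?K) \<subseteq> (\<Union>C\<in>?K. closure C)"
      proof (rule closure_minimal)
        show "\<Union>?K \<subseteq> (\<Union>C\<in>?K. closure C)" using closure_subset by blast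
        show "closed (\<Union>C\<in>?K. closure C)" using finK by (intro closed_UN) auto
      qed
      finally obtain C where "C \<in> components moved" "x \<in> closure C" by blast
      then have "cmod (a x) \<noteq> cmod (b x)" using comp l by blast
      then show ?thesis by auto
    qed
    then show ?thesis using x ZF by (auto simp: a0_def b0_def)
  qed
  have cont: "continuous_on G (\<lambda>x. cmod (a0 x - b0 x))" by (intro continuous_intros ca0 cb0)
  have "Z \<subseteq> G" using ZF by blast
  obtain c where c: "c > 0" "\<And>x. x \<in> Z \<Longrightarrow> c \<le> cmod (a0 x - b0 x)"
    using compact_pos_lower_bound[OF Zc continuous_on_subset[OF cont \<open>Z \<subseteq> G\<close>] pos] by blast
  obtain W where W: "open W" "\<And>x. x \<in> G \<Longrightarrow> x \<in> W \<longleftrightarrow> c / 2 < cmod (a0 x - b0 x)"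
    using continuous_on_open_less[OF continuous_on_const cont] by metis
  have ZW: "Z \<subseteq> W"
  proof
    fix x assume x: "x \<in> Z"
    then have "c / 2 < cmod (a0 x - b0 x)" using c(1) c(2)[OF x] by simp
    then show "x \<in> W" using W(2) \<open>Z \<subseteq> G\<close> x by blast
  qed
  \<comment> \<open>At isolated boundary points a may equal b. Those outside W form a compact set
    whose limit points would have to lie in W, so there are finitely many, and they have length
    0.\<close>
  have fin: "finite (bd - W)"
  proof (rule ccontr)
    assume inf: "infinite (bd - W)"
    have "closed (bd - W)" using bd_closed W(1) by (rule closed_Diff)
    then have "compact (G \<inter> (bd - W))" by (rule compact_Int_closed[OF G_compact])
    moreover have "G \<inter> (bd - W) = bd - W" by blast
    ultimately have "compact (bd - W)" by simp
    then obtain \<tau> where \<tau>: "\<tau> \<in> bd - W" "\<tau> islimpt (bd - W)"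
      using inf unfolding compact_eq_Bolzano_Weierstrass by blast
    have "\<tau> islimpt bd" using \<tau>(2) by (rule islimpt_subset) auto
    then have "\<tau> \<in> W" using ZW by (auto simp: Z_def Y'_def)
    then show False using \<tau>(1) by blast
  qed
  show inv: "X.inv_set (G - moved)"
    using moved_borel G_borel T_moved by (auto simp: X.inv_set_def)
  have ae: "AE x in M. x \<in> G - moved \<longrightarrow> c / 2 \<le> cmod (a0 x - b0 x)"
  proof (rule eventually_mono[OF emeasure_finite_set[OF fin]], rule impI)
    fix x assume x: "x \<notin> bd - W" "x \<in> G - moved"
    have "x \<in> W"
    proof (cases "x \<in> closure moved")
      case False
      then have "x \<in> G - closure moved" using x by blast
      then have "x \<in> closure (G - closure moved)" by (rule subsetD[OF closure_subset])
      then have "x \<in> Z" by (simp only: Z_def UnI1)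
      then show ?thesis using ZW by blast
    qed (use x in blast)
    then show "c / 2 \<le> cmod (a0 x - b0 x)" using W(2)[of x] x by auto
  qed
  show "X.right_inv (G - moved)" "X.left_inv (G - moved)"
    by (rule X.invertible_fixed[OF inv _ _ ae]; use c(1) in \<open>auto simp: moved_def\<close>)+
qed

lemma invertible_from_parts:
  assumes ii: "\<And>t. t \<in> G - closure moved \<Longrightarrow> a t \<noteq> b t"
    and lim: "\<And>\<tau>. \<tau> islimpt bd \<Longrightarrow> cmod (a \<tau>) \<noteq> cmod (b \<tau>)"
  shows "(\<And>C. C \<in> components moved \<Longrightarrow> X.right_inv C) \<Longrightarrow> X.right_inv G"
    and "(\<And>C. C \<in> components moved \<Longrightarrow> X.left_inv C) \<Longrightarrow> X.left_inv G"
proof -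
  obtain K V1 V2 where K: "finite K" "K \<subseteq> components moved" and V: "X.inv_set V1" "X.inv_set V2"
    "V1 \<inter> V2 = {}" "V1 \<union> V2 = moved - \<Union>K"
    and V1: "X.right_inv V1" "X.left_inv V1"
    and V2: "X.right_inv V2" "X.left_inv V2"
    using components_near_limits_invertible[OF lim] by metis
  \<comment> \<open>A finite partition of the curve into invariant sets: the fixed points, the two
    groups of good components, and the remaining components one by one.\<close>
  let ?I = "insert (G - moved) (insert V1 (insert V2 K))"
  have Km: "C \<subseteq> moved" if "C \<in> K" for C using in_components_subset K(2) that by blast
  have un: "\<Union>?I = G"
  proof -
    have "\<Union>?I = (G - moved) \<union> (V1 \<union> V2) \<union> \<Union>K" by auto
    also have "\<dots> = (G - moved) \<union> moved" unfolding V(4) using Km by auto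
    also have "\<dots> = G" by (auto simp: moved_def)
    finally show ?thesis .
  qed
  have V12: "V1 \<subseteq> moved - \<Union>K" "V2 \<subseteq> moved - \<Union>K" using V(4) by auto
  have disj: "pairwise disjnt ?I"
  proof -
    have dK: "pairwise disjnt K" unfolding pairwise_def disjnt_def
      using components_nonoverlap[of _ moved] K(2) by blast
    have 1: "disjnt (G - moved) V1" "disjnt (G - moved) V2" "disjnt V1 V2"
      using V12 V(3) by (auto simp: disjnt_def)
    have 2: "disjnt (G - moved) C" "disjnt V1 C" "disjnt V2 C" if "C \<in> K" for C
      using Km[OF that] V12 that by (auto simp: disjnt_def)
    show ?thesis unfolding pairwise_insert using dK 1 2 by (blast intro: disjnt_sym)
  qed
  have invK: "X.inv_set C" if "C \<in> K" for C using inv_component K(2) that by blast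
  {
    assume P: "\<And>C. C \<in> components moved \<Longrightarrow> X.right_inv C"
    note F = fixed_part_invertible[OF _ ii lim]
    have F1: "X.inv_set (G - moved)" "X.right_inv (G - moved)"
      by (rule F(1) F(2); use necessary_component P in blast)+
    have "X.right_inv (\<Union>?I)"
      by (rule X.invertible_Union(1)) (use K invK V V1 V2 F1 P disj in auto)
    then show "X.right_inv G" unfolding un .
  }
  {
    assume P: "\<And>C. C \<in> components moved \<Longrightarrow> X.left_inv C"
    note F = fixed_part_invertible[OF _ ii lim]
    have F1: "X.inv_set (G - moved)" "X.left_inv (G - moved)"
      by (rule F(1) F(3); use necessary_component P in blast)+
    have "X.left_inv (\<Union>?I)"
      by (rule X.invertible_Union(2)) (use K invK V V1 V2 F1 P disj in auto)
    then show "X.left_inv G" unfolding un .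
  }
qed

lemma right_invertible_iff:
  "X.right_inv G \<longleftrightarrow> (\<forall>C\<in>components moved. X.right_inv C) \<and>
     (\<forall>t\<in>G - closure moved. a t \<noteq> b t) \<and> (\<forall>\<tau>. \<tau> islimpt bd \<longrightarrow> cmod (a \<tau>) \<noteq> cmod (b \<tau>))"
proof -
  have "X.right_inv C" if "X.right_inv G" "C \<in> components moved" for C
    by (rule X.right_invertible_restrict[OF that(1) inv_component[OF that(2)]])
      (use X.inv_setD(2)[OF inv_component[OF that(2)]] in blast)
  then show ?thesis
    using necessary_fixed necessary_limit invertible_from_parts(1) by blast
qed

lemma left_invertible_iff:
  "X.left_inv G \<longleftrightarrow> (\<forall>C\<in>components moved. X.left_inv C) \<and>
     (\<forall>t\<in>G - closure moved. a t \<noteq> b t) \<and> (\<forall>\<tau>. \<tau> islimpt bd \<longrightarrow> cmod (a \<tau>) \<noteq> cmod (b \<tau>))"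
proof -
  have "X.left_inv C" if "X.left_inv G" "C \<in> components moved" for C
    by (rule X.left_invertible_restrict[OF that(1) inv_component[OF that(2)]])
      (use X.inv_setD(2)[OF inv_component[OF that(2)]] in blast)
  then show ?thesis
    using necessary_fixed necessary_limit invertible_from_parts(2) by blast
qed

text \<open>A limit point of the boundary is a limit of fixed points, so the derivative there is 1 and
  the Boyd indices drop out of condition (iii).\<close>

lemma boyd_condition_iff:
  "(infinite bd \<longrightarrow> (\<forall>\<tau>. \<tau> islimpt bd \<longrightarrow>
      (cmod (a \<tau>) - cmod (b \<tau>) * min (cmod (curve_deriv G \<alpha> \<tau>) powr p) (cmod (curve_deriv G \<alpha> \<tau>) powr q)) *
      (cmod (a \<tau>) - cmod (b \<tau>) * max (cmod (curve_deriv G \<alpha> \<tau>) powr p) (cmod (curve_deriv G \<alpha> \<tau>) powr q)) > 0))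
   \<longleftrightarrow> (\<forall>\<tau>. \<tau> islimpt bd \<longrightarrow> cmod (a \<tau>) \<noteq> cmod (b \<tau>))"
proof -
  have "(cmod (a \<tau>) - cmod (b \<tau>) * min (cmod (curve_deriv G \<alpha> \<tau>) powr p) (cmod (curve_deriv G \<alpha> \<tau>) powr q)) *
      (cmod (a \<tau>) - cmod (b \<tau>) * max (cmod (curve_deriv G \<alpha> \<tau>) powr p) (cmod (curve_deriv G \<alpha> \<tau>) powr q)) > 0
      \<longleftrightarrow> cmod (a \<tau>) \<noteq> cmod (b \<tau>)" if "\<tau> islimpt bd" for \<tau>
    using limpt_bd(2)[OF that] by (auto simp: zero_less_mult_iff)
  moreover have "infinite bd" if "\<tau> islimpt bd" for \<tau> using that islimpt_finite by blast
  ultimately show ?thesis by blast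
qed

end

theorem theorem4p4:
  fixes g :: "real \<Rightarrow> complex" and \<alpha> a b :: "complex \<Rightarrow> complex"
    and \<rho> :: "(complex \<Rightarrow> ennreal) \<Rightarrow> ennreal"
  defines "\<Gamma> \<equiv> path_image g"
    and "M \<equiv> arc_measure g"
    and "\<Lambda> \<equiv> {t \<in> path_image g. \<alpha> t = t}"
    and "\<Phi> \<equiv> closure {t \<in> path_image g. \<alpha> t \<noteq> t}"
    and "A \<equiv> shift_op (path_image g) a b \<alpha>"
  assumes curve: "smooth_jordan_curve g"
    and diffeo: "curve_diffeo \<Gamma> \<alpha>"
    and orient: "orientation_preserving g \<alpha>"
    and fixed: "\<Lambda> \<noteq> {}"
    and ri: "ri_space M \<rho>"
    and refl: "reflexive_X M \<rho>"
    and ftype: "fundamental_type M \<rho>"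
    and nontriv: "nontrivial_boyd M \<rho>"
    and ca: "continuous_on \<Gamma> a" and cb: "continuous_on \<Gamma> b"
  shows
    "(right_invertible_in M \<rho> \<Gamma> A \<longleftrightarrow>
        (\<forall>\<gamma>\<in>components (\<Phi> - \<Lambda>). right_invertible_in M \<rho> \<gamma> A) \<and>
        (\<forall>t\<in>\<Gamma> - \<Phi>. a t \<noteq> b t) \<and>
        (infinite (\<Lambda> \<inter> \<Phi>) \<longrightarrow>
           (\<forall>\<tau>. \<tau> islimpt (\<Lambda> \<inter> \<Phi>) \<longrightarrow>
              (cmod (a \<tau>) - cmod (b \<tau>) *
                 min (cmod (curve_deriv \<Gamma> \<alpha> \<tau>) powr (- lower_boyd M \<rho>))
                     (cmod (curve_deriv \<Gamma> \<alpha> \<tau>) powr (- upper_boyd M \<rho>))) *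
              (cmod (a \<tau>) - cmod (b \<tau>) *
                 max (cmod (curve_deriv \<Gamma> \<alpha> \<tau>) powr (- lower_boyd M \<rho>))
                     (cmod (curve_deriv \<Gamma> \<alpha> \<tau>) powr (- upper_boyd M \<rho>))) > 0)))
     \<and>
     (left_invertible_in M \<rho> \<Gamma> A \<longleftrightarrow>
        (\<forall>\<gamma>\<in>components (\<Phi> - \<Lambda>). left_invertible_in M \<rho> \<gamma> A) \<and>
        (\<forall>t\<in>\<Gamma> - \<Phi>. a t \<noteq> b t) \<and>
        (infinite (\<Lambda> \<inter> \<Phi>) \<longrightarrow>
           (\<forall>\<tau>. \<tau> islimpt (\<Lambda> \<inter> \<Phi>) \<longrightarrow>
              (cmod (a \<tau>) - cmod (b \<tau>) *
                 min (cmod (curve_deriv \<Gamma> \<alpha> \<tau>) powr (- lower_boyd M \<rho>))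
                     (cmod (curve_deriv \<Gamma> \<alpha> \<tau>) powr (- upper_boyd M \<rho>))) *
              (cmod (a \<tau>) - cmod (b \<tau>) *
                 max (cmod (curve_deriv \<Gamma> \<alpha> \<tau>) powr (- lower_boyd M \<rho>))
                     (cmod (curve_deriv \<Gamma> \<alpha> \<tau>) powr (- upper_boyd M \<rho>))) > 0)))"
proof -
  interpret jordan_shift g \<alpha>
    using curve diffeo orient unfolding \<Gamma>_def by unfold_locales
  obtain p where "p \<in> path_image g" "T p = p" using fixed by (auto simp: \<Lambda>_def T_def)
  then obtain u h where uh: "simple_path u" "path_image u = path_image g" "T (u 0) = u 0" "T (u 1) = u 1"
    "\<forall>x\<in>{0<..<1}. h x \<in> {0<..<1} \<and> u (h x) = T (u x)" "strict_mono_on {0<..<1} h"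
    using exists_lift by blast
  interpret shift_setting g \<alpha> u h \<rho> a b
    using uh ri ca cb unfolding M_def \<Gamma>_def by unfold_locales auto
  have \<Lambda>: "\<Lambda> = path_image g - moved" and \<Phi>: "\<Phi> = closure moved"
    by (auto simp: \<Lambda>_def \<Phi>_def moved_def T_def intro!: arg_cong[of _ _ closure])
  have moved: "\<Phi> - \<Lambda> = moved"
    unfolding \<Lambda> \<Phi> using closure_moved_G closure_subset[of moved] by (auto simp: moved_def)
  have A: "A = X.op" unfolding A_def by (rule op_eq)
  show ?thesis
    unfolding A moved unfolding \<Lambda> \<Phi> \<Gamma>_def M_def boyd_condition_iff
    using right_invertible_iff left_invertible_iff by blast
qed

end
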